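(* Let $(b,a)$ be a Pythagorean pair. For $\epsilon>0$, let $a_\epsilon$ be the outer function such that $|a_\epsilon|=\max\{|a|,\epsilon\}$ a.e. on $\mathbb{T}$ and $a_\epsilon(0)>0$. Set $\phi_\epsilon:=b/a_\epsilon$. (i) If $f\in\mathcal{H}(b)$, then $$\|f\|_{\mathcal{H}(b)}^2=\sum_{m\ge0}|\hat{f}(m)|^2+\lim_{\epsilon\to0^+}\sum_{m\ge0}\Bigl|\sum_{n\ge0}\overline{\hat{\phi}_\epsilon(n)}\hat{f}(m+n)\Bigr|^2.$$ (ii) If $f\in H^2$ but $f\notin\mathcal{H}(b)$, then $$\lim_{\epsilon\to0^+}\sum_{m\ge0}\Bigl|\sum_{n\ge0}\overline{\hat{\phi}_\epsilon(n)}\hat{f}(m+n)\Bigr|^2=\infty.$$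
   Context: $\mathbb{D}$ is the open unit disk, $\mathbb{T}$ the unit circle, and $H^p$ ($0<p\le\infty$) the Hardy spaces on $\mathbb{D}$. A Pythagorean pair is a pair $(b,a)$ of functions in $H^\infty$ such that $|b|^2+|a|^2=1$ a.e. on $\mathbb{T}$, $a$ is outer and $a(0)>0$. For $b\in H^\infty$ with $\|b\|_{H^\infty}\le1$, the de Branges--Rovnyak space $\mathcal{H}(b)$ is the Hilbert space of functions on $\mathbb{D}$ with reproducing kernel $(z,w)\mapsto (1-\overline{b(w)}b(z))/(1-\overline{w}z)$; it is contractively contained in $H^2$. For $f$ holomorphic on $\mathbb{D}$, $\hat{f}(n)$ denotes the $n$-th Taylor coefficient of $f$ at $0$. *)

theory Defs
  imports "HOL-Complex_Analysis.Complex_Analysis"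
begin

text \<open>
  The unit disk is \<^term>\<open>ball 0 1 :: complex set\<close>. The unit circle is parametrised by
  \<^term>\<open>cis\<close> on \<^term>\<open>{0..2*pi}\<close>, and \<open>a.e.\<close> on the circle refers to Lebesgue measure there.
  A function on the disk is a function of type \<^typ>\<open>complex \<Rightarrow> complex\<close> whose values outside
  the disk are irrelevant.
\<close>

abbreviation circle_measure :: "real measure" where
  "circle_measure \<equiv> lebesgue_on {0..2*pi}"

definition taylor_coeff :: "(complex \<Rightarrow> complex) \<Rightarrow> nat \<Rightarrow> complex" where
  "taylor_coeff f n = fps_nth (fps_expansion f 0) n"

subsection \<open>Hardy spaces\<close>

text \<open>The intended range of the exponent is \<open>0 < p\<close>.\<close>

definition hardy :: "real \<Rightarrow> (complex \<Rightarrow> complex) set" where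
  "hardy p = {f. f holomorphic_on ball 0 1 \<and>
     bdd_above ((\<lambda>r. 1 / (2*pi) *
       (LINT t|circle_measure. cmod (f (complex_of_real r * cis t)) powr p)) ` {0..<1})}"

definition hardy_infinity :: "(complex \<Rightarrow> complex) set" where
  "hardy_infinity = {f. f holomorphic_on ball 0 1 \<and> bounded (f ` ball 0 1)}"

subsection \<open>Boundary values and outer functions\<close>

text \<open>
  Boundary values are radial limits. An identity between boundary values is understood to hold
  at a point of the circle only if the radial limits involved exist there. By Fatou's theorem,
  existence is automatic almost everywhere for functions in \<open>H\<^sup>p\<close>.
\<close>

definition radial_limit :: "(complex \<Rightarrow> complex) \<Rightarrow> real \<Rightarrow> complex \<Rightarrow> bool" where
  "radial_limit f t l \<longleftrightarrow> ((\<lambda>r. f (complex_of_real r * cis t)) \<longlongrightarrow> l) (at_left (1::real))"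

text \<open>\<open>k\<close> is the logarithm of the modulus of the boundary values.\<close>

definition outer :: "(complex \<Rightarrow> complex) \<Rightarrow> bool" where
  "outer f \<longleftrightarrow> (\<exists>c k. cmod c = 1 \<and> integrable circle_measure (k :: real \<Rightarrow> real) \<and>
     (\<forall>z\<in>ball 0 1. f z = c * exp (1 / (2 * complex_of_real pi) *
        (LINT t|circle_measure. (cis t + z) / (cis t - z) * complex_of_real (k t)))))"

definition pythagorean_pair :: "(complex \<Rightarrow> complex) \<Rightarrow> (complex \<Rightarrow> complex) \<Rightarrow> bool" where
  "pythagorean_pair b a \<longleftrightarrow>
     b \<in> hardy_infinity \<and> a \<in> hardy_infinity \<and>
     (AE t in circle_measure. \<exists>\<beta> \<alpha>. radial_limit b t \<beta> \<and> radial_limit a t \<alpha> \<and>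
        (cmod \<beta>)\<^sup>2 + (cmod \<alpha>)\<^sup>2 = 1) \<and>
     outer a \<and> a 0 \<in> \<real> \<and> Re (a 0) > 0"

text \<open>
  \<open>outer_truncation a e g\<close>: \<open>g\<close> is the outer function, unique on the disk, with \<open>|g| = max |a| e\<close>
  a.e. on the circle and \<open>g 0 > 0\<close>.
\<close>

definition outer_truncation ::
    "(complex \<Rightarrow> complex) \<Rightarrow> real \<Rightarrow> (complex \<Rightarrow> complex) \<Rightarrow> bool" where
  "outer_truncation a e g \<longleftrightarrow>
     outer g \<and>
     (AE t in circle_measure. \<exists>\<gamma> \<alpha>. radial_limit g t \<gamma> \<and> radial_limit a t \<alpha> \<and>
        cmod \<gamma> = max (cmod \<alpha>) e) \<and>
     g 0 \<in> \<real> \<and> Re (g 0) > 0"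

subsection \<open>Hilbert spaces with reproducing kernel\<close>

definition ip_norm :: "(('a \<Rightarrow> complex) \<Rightarrow> ('a \<Rightarrow> complex) \<Rightarrow> complex) \<Rightarrow> ('a \<Rightarrow> complex) \<Rightarrow> real" where
  "ip_norm ip f = sqrt (Re (ip f f))"

text \<open>
  \<open>H\<close> with inner product \<open>ip\<close> (linear in the first argument) is a Hilbert space of functions
  on \<open>X\<close>. Functions that agree on \<open>X\<close> represent the same element: \<open>H\<close> is closed under changing
  values outside \<open>X\<close>, and a vector of norm zero is one that vanishes on \<open>X\<close>. By the
  Cauchy-Schwarz inequality, \<open>ip\<close> then only depends on the values on \<open>X\<close>.
\<close>

locale hilbert_function_space =
  fixes X :: "'a set"
    and H :: "('a \<Rightarrow> complex) set"
    and ip :: "('a \<Rightarrow> complex) \<Rightarrow> ('a \<Rightarrow> complex) \<Rightarrow> complex"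
  assumes cong_closed: "\<lbrakk>f \<in> H; \<And>x. x \<in> X \<Longrightarrow> g x = f x\<rbrakk> \<Longrightarrow> g \<in> H"
    and zero_closed: "(\<lambda>x. 0) \<in> H"
    and add_closed: "\<lbrakk>f \<in> H; g \<in> H\<rbrakk> \<Longrightarrow> (\<lambda>x. f x + g x) \<in> H"
    and scale_closed: "f \<in> H \<Longrightarrow> (\<lambda>x. c * f x) \<in> H"
    and ip_add: "\<lbrakk>f \<in> H; g \<in> H; h \<in> H\<rbrakk> \<Longrightarrow> ip (\<lambda>x. f x + g x) h = ip f h + ip g h"
    and ip_scale: "\<lbrakk>f \<in> H; h \<in> H\<rbrakk> \<Longrightarrow> ip (\<lambda>x. c * f x) h = c * ip f h"
    and ip_cnj: "\<lbrakk>f \<in> H; g \<in> H\<rbrakk> \<Longrightarrow> ip g f = cnj (ip f g)"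
    and ip_nonneg: "f \<in> H \<Longrightarrow> 0 \<le> Re (ip f f)"
    and ip_definite: "f \<in> H \<Longrightarrow> ip f f = 0 \<longleftrightarrow> (\<forall>x\<in>X. f x = 0)"
    and complete: "\<lbrakk>\<And>n. s n \<in> H;
         \<forall>e>0. \<exists>N. \<forall>m\<ge>N. \<forall>n\<ge>N. ip_norm ip (\<lambda>x. s m x - s n x) < e\<rbrakk> \<Longrightarrow>
         \<exists>f\<in>H. (\<lambda>n::nat. ip_norm ip (\<lambda>x. s n x - f x)) \<longlonglongrightarrow> 0"

text \<open>These data are uniquely determined by the kernel \<open>K\<close> (Moore-Aronszajn).\<close>

locale reproducing_kernel_hilbert_space = hilbert_function_space X H ip
  for X :: "'a set" and H ip +
  fixes K :: "'a \<Rightarrow> 'a \<Rightarrow> complex"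
  assumes kernel_in: "w \<in> X \<Longrightarrow> (\<lambda>z. K z w) \<in> H"
    and reproducing: "\<lbrakk>f \<in> H; w \<in> X\<rbrakk> \<Longrightarrow> ip f (\<lambda>z. K z w) = f w"

definition dbr_kernel :: "(complex \<Rightarrow> complex) \<Rightarrow> complex \<Rightarrow> complex \<Rightarrow> complex" where
  "dbr_kernel b z w = (1 - cnj (b w) * b z) / (1 - cnj w * z)"

text \<open>\<open>H\<close> with inner product \<open>ip\<close> is the de Branges--Rovnyak space of \<open>b\<close>.\<close>

definition de_branges_rovnyak ::
    "(complex \<Rightarrow> complex) \<Rightarrow> (complex \<Rightarrow> complex) set \<Rightarrow>
     ((complex \<Rightarrow> complex) \<Rightarrow> (complex \<Rightarrow> complex) \<Rightarrow> complex) \<Rightarrow> bool" where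
  "de_branges_rovnyak b H ip \<longleftrightarrow>
     reproducing_kernel_hilbert_space (ball 0 1) H ip (dbr_kernel b)"

end

theory Submission
  imports Defs "HOL-Library.Diagonal_Subsequence"
begin

text \<open>
  Write \<open>T\<^sub>u\<close> for the co-analytic Toeplitz operator whose symbol is the conjugate of \<open>u\<close>. It is the
  adjoint of multiplication by \<open>u\<close>, so it is bounded by the supremum of \<open>\<bar>u\<bar>\<close>, and \<open>T\<^sub>u T\<^sub>v\<close> is the
  operator of the product \<open>u v\<close>. Since multiplication by the column \<open>(b, a)\<close> is isometric on \<open>H\<^sup>2\<close>,
  the functions \<open>f \<in> H\<^sup>2\<close> for which \<open>T\<^sub>b f = T\<^sub>a g\<close> has a solution \<open>g \<in> H\<^sup>2\<close>, with squared norm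
  \<open>\<parallel>f\<parallel>\<^sup>2 + \<parallel>g\<parallel>\<^sup>2\<close>, form a Hilbert space with the kernel of \<open>H(b)\<close>, hence equal \<open>H(b)\<close>.
  Let \<open>v = a / a\<^sub>\<epsilon>\<close>. Then \<open>\<bar>v\<bar> \<le> 1\<close> on the disk and \<open>v(0)\<close> tends to \<open>1\<close>, so \<open>v\<close> tends to \<open>1\<close> in \<open>H\<^sup>2\<close>
  and \<open>T\<^sub>v g\<close> tends to \<open>g\<close>. If \<open>f \<in> H(b)\<close>, then \<open>T\<^sub>\<phi> f = T\<^sub>v g\<close>, which gives the limit. Conversely, if
  \<open>T\<^sub>\<phi> f\<close> stays bounded along a sequence of \<open>\<epsilon>\<close>, a weak limit point \<open>g\<close> satisfies
  \<open>T\<^sub>a g = lim T\<^sub>v T\<^sub>b f = T\<^sub>b f\<close>, so \<open>f \<in> H(b)\<close>.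
\<close>

subsection \<open>Hilbert function spaces\<close>

text \<open>\<open>Hb\<close> is given only through its kernel and \<open>a_eps\<close> only through
  its boundary modulus, so two identifications shape the proof. For \<open>Hb\<close>: the pairs
  \<open>(f, g)\<close> with \<open>T_b f = T_a g\<close> are shown to reproduce
  \<open>dbr_kernel b\<close>, and a kernel determines its space together with the norm. For
  \<open>a_eps\<close>: an outer function comes with some density \<open>k\<close>, and estimates
  inside the disk need \<open>k\<close> to be the logarithm of the boundary modulus. The hypotheses
  supply the radial limits, so only their modulus must be found; it is read off from L1 convergence
  of Poisson integrals along fixed radii, which becomes a.e. convergence along a subsequence. The
  value \<open>v(0)\<close> is enough because multiplication by \<open>v\<close> is contractive: the
  squared H^2 distance from \<open>v\<close> to 1 is the squared norm of \<open>v\<close> minus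
  \<open>2 Re v(0)\<close> plus 1, hence at most \<open>2 - 2 Re v(0)\<close>. The same
  approximation makes \<open>T_a\<close> injective, since \<open>T_v = T_q T_a\<close> with
  \<open>q = 1 / a_eps\<close>; so the companion \<open>g\<close> of \<open>f\<close> is unique and
  the norm on pairs is a norm on functions.\<close>

context hilbert_function_space
begin

lemma diff_closed: "f \<in> H \<Longrightarrow> g \<in> H \<Longrightarrow> (\<lambda>x. f x - g x) \<in> H"
  using add_closed[OF _ scale_closed[of g "-1"], of f] by simp

lemma ip_add_right: "f \<in> H \<Longrightarrow> g \<in> H \<Longrightarrow> h \<in> H \<Longrightarrow> ip h (\<lambda>x. f x + g x) = ip h f + ip h g"
  by (metis (no_types, lifting) add_closed complex_cnj_add ip_add ip_cnj)

lemma ip_scale_right: "f \<in> H \<Longrightarrow> h \<in> H \<Longrightarrow> ip h (\<lambda>x. c * f x) = cnj c * ip h f"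
  by (metis (no_types, lifting) scale_closed complex_cnj_mult ip_scale ip_cnj)

lemma ip_diff: "f \<in> H \<Longrightarrow> g \<in> H \<Longrightarrow> h \<in> H \<Longrightarrow> ip (\<lambda>x. f x - g x) h = ip f h - ip g h"
  using ip_add[OF _ scale_closed[of g "-1"], of f h] ip_scale[of g h "-1"] by simp

lemma ip_diff_right: "f \<in> H \<Longrightarrow> g \<in> H \<Longrightarrow> h \<in> H \<Longrightarrow> ip h (\<lambda>x. f x - g x) = ip h f - ip h g"
  using ip_add_right[OF _ scale_closed[of g "-1"], of f h] ip_scale_right[of g h "-1"] by simp

lemma ip_self: "f \<in> H \<Longrightarrow> ip f f = of_real ((ip_norm ip f)\<^sup>2)"
  using ip_cnj[of f f] ip_nonneg[of f] by (simp add: ip_norm_def complex_eq_iff)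

lemma norm_sq: "f \<in> H \<Longrightarrow> (ip_norm ip f)\<^sup>2 = Re (ip f f)"
  using ip_nonneg[of f] by (simp add: ip_norm_def)

lemma norm_nonneg: "f \<in> H \<Longrightarrow> 0 \<le> ip_norm ip f"
  using ip_nonneg[of f] by (simp add: ip_norm_def)

lemma norm_eq_0_iff: "f \<in> H \<Longrightarrow> ip_norm ip f = 0 \<longleftrightarrow> (\<forall>x\<in>X. f x = 0)"
  using ip_definite[of f] ip_self[of f] by (metis of_real_eq_0_iff zero_eq_power2)

lemma norm_sq_diff:
  assumes "f \<in> H" "g \<in> H"
  shows "(ip_norm ip (\<lambda>x. f x - c * g x))\<^sup>2 =
    (ip_norm ip f)\<^sup>2 - 2 * Re (cnj c * ip f g) + (cmod c)\<^sup>2 * (ip_norm ip g)\<^sup>2"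
proof -
  let ?h = "\<lambda>x. c * g x"
  have h: "?h \<in> H" using assms scale_closed by auto
  have "ip (\<lambda>x. f x - ?h x) (\<lambda>x. f x - ?h x) = ip f f - ip f ?h - ip ?h f + ip ?h ?h"
    using assms h by (simp add: ip_diff ip_diff_right diff_closed)
  also have "\<dots> = ip f f - cnj c * ip f g - c * cnj (ip f g) + c * cnj c * ip g g"
    using assms h by (simp add: ip_scale ip_scale_right ip_cnj[of f g] mult.assoc)
  finally have "Re (ip (\<lambda>x. f x - ?h x) (\<lambda>x. f x - ?h x)) =
     Re (ip f f) - 2 * Re (cnj c * ip f g) + Re (c * cnj c * ip g g)"
    by simp
  also have "c * cnj c * ip g g = of_real ((cmod c)\<^sup>2 * (ip_norm ip g)\<^sup>2)"
    using ip_self[of g] assms complex_norm_square[of c] by simp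
  finally show ?thesis using assms h by (simp only: norm_sq diff_closed Re_complex_of_real)
qed

text \<open>The squared norm of \<open>f - c g\<close> with \<open>c = t * ip f g\<close> is a
  nonnegative real quadratic in \<open>t\<close>. Its minimum at \<open>t = 1/C\<close> is the
  claim; for \<open>C = 0\<close> it is linear in \<open>t\<close>, which forces
  \<open>B = 0\<close>.\<close>

lemma cauchy_schwarz:
  assumes "f \<in> H" "g \<in> H"
  shows "cmod (ip f g) \<le> ip_norm ip f * ip_norm ip g"
proof -
  define A B C where "A = (ip_norm ip f)\<^sup>2" and "B = (cmod (ip f g))\<^sup>2" and "C = (ip_norm ip g)\<^sup>2"
  have quad: "0 \<le> A - 2 * t * B + t\<^sup>2 * B * C" for t :: real
  proof -
    have "0 \<le> (ip_norm ip (\<lambda>x. f x - (of_real t * ip f g) * g x))\<^sup>2" by simp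
    also have "\<dots> = A - 2 * Re (cnj (of_real t * ip f g) * ip f g) + (cmod (of_real t * ip f g))\<^sup>2 * C"
      using norm_sq_diff[OF assms] by (simp add: A_def C_def)
    also have "cnj (of_real t * ip f g) * ip f g = of_real (t * B)"
      unfolding B_def of_real_mult complex_norm_square by simp
    finally show ?thesis by (simp add: B_def norm_mult power_mult_distrib)
  qed
  have "B \<le> A * C"
  proof (cases "C = 0")
    case True
    have "B \<le> 0"
    proof (rule ccontr)
      assume "\<not> B \<le> 0"
      \<comment> \<open>This \<open>t\<close> gives the linear expression the value -1.\<close>
      then have "0 \<le> A - (A + 1)" using quad[of "(A+1)/(2*B)"] True by simp
      then show False by simp
    qed
    then show ?thesis using True by simp
  next
    case False
    then have C: "C > 0" by (simp add: C_def)
    have "0 \<le> A - B / C" using quad[of "1/C"] C by (simp add: power2_eq_square field_simps)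
    then show ?thesis using C by (simp add: field_simps)
  qed
  then have "(cmod (ip f g))\<^sup>2 \<le> (ip_norm ip f * ip_norm ip g)\<^sup>2"
    by (simp add: A_def B_def C_def power_mult_distrib)
  then show ?thesis using assms by (simp add: norm_nonneg power2_le_iff_abs_le)
qed

lemma norm_scale: "f \<in> H \<Longrightarrow> ip_norm ip (\<lambda>x. c * f x) = cmod c * ip_norm ip f"
proof -
  assume f: "f \<in> H"
  have "(ip_norm ip (\<lambda>x. c * f x))\<^sup>2 = Re (c * cnj c * ip f f)"
    using f by (simp add: norm_sq scale_closed ip_scale ip_scale_right mult.assoc)
  also have "c * cnj c * ip f f = of_real ((cmod c * ip_norm ip f)\<^sup>2)"
    using ip_self[OF f] complex_norm_square[of c] by (simp add: power_mult_distrib)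
  finally show ?thesis using f by (simp add: norm_nonneg scale_closed)
qed

lemma norm_triangle:
  assumes "f \<in> H" "g \<in> H"
  shows "ip_norm ip (\<lambda>x. f x + g x) \<le> ip_norm ip f + ip_norm ip g"
proof -
  have "(ip_norm ip (\<lambda>x. f x + g x))\<^sup>2 = (ip_norm ip f)\<^sup>2 + 2 * Re (ip f g) + (ip_norm ip g)\<^sup>2"
    using norm_sq_diff[OF assms, of "-1"] by simp
  also have "\<dots> \<le> (ip_norm ip f)\<^sup>2 + 2 * (ip_norm ip f * ip_norm ip g) + (ip_norm ip g)\<^sup>2"
    using complex_Re_le_cmod[of "ip f g"] cauchy_schwarz[OF assms] by simp
  also have "\<dots> = (ip_norm ip f + ip_norm ip g)\<^sup>2" by (simp add: power2_sum)
  finally show ?thesis by (rule power2_le_imp_le) (simp add: assms norm_nonneg)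
qed

lemma norm_diff_commute:
  assumes "f \<in> H" "g \<in> H"
  shows "ip_norm ip (\<lambda>x. f x - g x) = ip_norm ip (\<lambda>x. g x - f x)"
  using norm_scale[OF diff_closed[OF assms], of "-1"] by simp

lemma norm_diff_triangle:
  assumes "f \<in> H" "g \<in> H" "h \<in> H"
  shows "ip_norm ip (\<lambda>x. f x - h x) \<le> ip_norm ip (\<lambda>x. f x - g x) + ip_norm ip (\<lambda>x. g x - h x)"
  using norm_triangle[OF diff_closed[OF assms(1,2)] diff_closed[OF assms(2,3)]] by simp

lemma norm_diff_ineq:
  assumes "f \<in> H" "g \<in> H"
  shows "\<bar>ip_norm ip f - ip_norm ip g\<bar> \<le> ip_norm ip (\<lambda>x. f x - g x)"
  using norm_triangle[OF diff_closed[OF assms(1,2)] assms(2)]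
    norm_triangle[OF diff_closed[OF assms(2,1)] assms(1)] norm_diff_commute[OF assms] by simp

lemma parallelogram:
  assumes "f \<in> H" "g \<in> H"
  shows "(ip_norm ip (\<lambda>x. f x + g x))\<^sup>2 + (ip_norm ip (\<lambda>x. f x - g x))\<^sup>2 =
    2 * (ip_norm ip f)\<^sup>2 + 2 * (ip_norm ip g)\<^sup>2"
  using norm_sq_diff[OF assms, of "-1"] norm_sq_diff[OF assms, of 1] by simp

lemma norm_cong:
  assumes "f \<in> H" "\<And>x. x \<in> X \<Longrightarrow> g x = f x"
  shows "ip_norm ip g = ip_norm ip f"
proof -
  have g: "g \<in> H" using cong_closed[OF assms] .
  have "ip_norm ip (\<lambda>x. g x - f x) = 0"
    using assms by (simp add: norm_eq_0_iff g diff_closed)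
  then show ?thesis using norm_diff_ineq[OF g assms(1)] by simp
qed

lemma tendsto_norm:
  assumes "\<And>n. s n \<in> H" "f \<in> H" "((\<lambda>n. ip_norm ip (\<lambda>x. s n x - f x)) \<longlongrightarrow> 0) F"
  shows "((\<lambda>n. ip_norm ip (s n)) \<longlongrightarrow> ip_norm ip f) F"
proof -
  have "((\<lambda>n. ip_norm ip (s n) - ip_norm ip f) \<longlongrightarrow> 0) F"
    by (rule tendsto_rabs_zero_cancel, rule tendsto_sandwich[OF _ _ tendsto_const assms(3)])
       (auto intro!: always_eventually norm_diff_ineq assms)
  then show ?thesis using Lim_null by blast
qed

lemma tendsto_ip:
  assumes "\<And>n. s n \<in> H" "f \<in> H" "g \<in> H" "((\<lambda>n. ip_norm ip (\<lambda>x. s n x - f x)) \<longlongrightarrow> 0) F"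
  shows "((\<lambda>n. ip (s n) g) \<longlongrightarrow> ip f g) F"
proof -
  have lim: "((\<lambda>n. ip_norm ip (\<lambda>x. s n x - f x) * ip_norm ip g) \<longlongrightarrow> 0) F"
    using tendsto_mult[OF assms(4) tendsto_const, of "ip_norm ip g"] by simp
  moreover have "cmod (ip (s n) g - ip f g) \<le> ip_norm ip (\<lambda>x. s n x - f x) * ip_norm ip g" for n
    using cauchy_schwarz[OF diff_closed[OF assms(1,2)] assms(3)] by (simp add: ip_diff assms)
  ultimately have "((\<lambda>n. ip (s n) g - ip f g) \<longlongrightarrow> 0) F"
    by (intro Lim_null_comparison[OF _ lim] always_eventually) auto
  then show ?thesis using Lim_null by blast
qed

lemma tendsto_ip_right:
  assumes "\<And>n. s n \<in> H" "f \<in> H" "g \<in> H" "((\<lambda>n. ip_norm ip (\<lambda>x. s n x - f x)) \<longlongrightarrow> 0) F"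
  shows "((\<lambda>n. ip g (s n)) \<longlongrightarrow> ip g f) F"
proof -
  have "ip g h = cnj (ip h g)" if "h \<in> H" for h using that assms(3) by (rule ip_cnj)
  then show ?thesis using tendsto_cnj[OF tendsto_ip[OF assms]] assms(1,2) by simp
qed

end

subsection \<open>Uniqueness of the space with a given reproducing kernel\<close>

text \<open>The linear span of the kernels, built one term at a time so that inner products on it
  can be compared by induction, without indexing finite sums.\<close>

inductive_set kernel_span :: "'a set \<Rightarrow> ('a \<Rightarrow> 'a \<Rightarrow> complex) \<Rightarrow> ('a \<Rightarrow> complex) set"
  for X K where
  zero: "(\<lambda>z. 0) \<in> kernel_span X K"
| step: "s \<in> kernel_span X K \<Longrightarrow> w \<in> X \<Longrightarrow> (\<lambda>z. s z + c * K z w) \<in> kernel_span X K"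

lemma kernel_span_scale:
  "s \<in> kernel_span X K \<Longrightarrow> (\<lambda>z. c * s z) \<in> kernel_span X K"
proof (induction rule: kernel_span.induct)
  case zero
  then show ?case using kernel_span.zero by simp
next
  case (step s w d)
  from kernel_span.step[OF step(3) step(2), of "c * d"] show ?case
    by (simp add: algebra_simps)
qed

lemma kernel_span_add:
  assumes "t \<in> kernel_span X K" "s \<in> kernel_span X K"
  shows "(\<lambda>z. s z + t z) \<in> kernel_span X K"
  using assms
proof (induction rule: kernel_span.induct)
  case zero
  then show ?case by simp
next
  case (step t w d)
  from kernel_span.step[OF step(3) step(2), of d] step.prems show ?case
    by (simp add: algebra_simps)
qed

lemma kernel_span_diff:
  assumes "s \<in> kernel_span X K" "t \<in> kernel_span X K"
  shows "(\<lambda>z. s z - t z) \<in> kernel_span X K"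
  using kernel_span_add[OF kernel_span_scale[OF assms(2), of "-1"] assms(1)] by simp

context reproducing_kernel_hilbert_space
begin

lemma kernel_span_in: "s \<in> kernel_span X K \<Longrightarrow> s \<in> H"
proof (induction rule: kernel_span.induct)
  case zero
  then show ?case using zero_closed .
next
  case (step s w c)
  then show ?case using add_closed[OF _ scale_closed[OF kernel_in]] by blast
qed

text \<open>A minimising sequence for the distance from \<open>f\<close> to the span converges, and \<open>f\<close> minus its
  limit is orthogonal to every kernel, that is, zero at every point.\<close>

lemma kernel_span_dense:
  assumes f: "f \<in> H"
  obtains s where "\<And>n::nat. s n \<in> kernel_span X K" "(\<lambda>n. ip_norm ip (\<lambda>x. s n x - f x)) \<longlonglongrightarrow> 0"
proof -
  let ?N = "ip_norm ip"
  define D where "D = (\<lambda>s. (?N (\<lambda>x. f x - s x))\<^sup>2) ` kernel_span X K"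
  define d where "d = Inf D"
  have ne: "D \<noteq> {}" using kernel_span.zero unfolding D_def by blast
  have bdd: "bdd_below D" by (auto simp: D_def intro!: bdd_belowI[of _ 0])
  have low: "d \<le> (?N (\<lambda>x. f x - s x))\<^sup>2" if "s \<in> kernel_span X K" for s
    unfolding d_def by (rule cInf_lower) (use that bdd in \<open>auto simp: D_def\<close>)
  have "\<exists>s\<in>kernel_span X K. (?N (\<lambda>x. f x - s x))\<^sup>2 < d + 1 / real (Suc n)" for n
  proof -
    have "Inf D < d + 1 / real (Suc n)" by (simp add: d_def)
    then obtain x where "x \<in> D" "x < d + 1 / real (Suc n)" using cInf_lessD[OF ne] by blast
    then show ?thesis unfolding D_def by blast
  qed
  then obtain s where s: "\<And>n. s n \<in> kernel_span X K"
    and up: "\<And>n. (?N (\<lambda>x. f x - s n x))\<^sup>2 < d + 1 / real (Suc n)" by metis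
  have sH: "s n \<in> H" for n using s kernel_span_in by auto
  have fs: "(\<lambda>x. f x - s n x) \<in> H" for n using f sH diff_closed by auto
  \<comment> \<open>Parallelogram law for \<open>f - s n\<close> and \<open>f - s m\<close>: their
    sum is twice the distance vector to the midpoint of \<open>s n\<close> and \<open>s m\<close>,
    which lies in the span, so its squared norm is at least \<open>4 * d\<close>.\<close>
  have par: "(?N (\<lambda>x. s m x - s n x))\<^sup>2 \<le> 2 / real (Suc m) + 2 / real (Suc n)" for m n
  proof -
    have mid: "(\<lambda>x. (1/2) * (s n x + s m x)) \<in> kernel_span X K"
      by (intro kernel_span_scale kernel_span_add s)
    have "?N (\<lambda>x. (f x - s n x) + (f x - s m x)) = ?N (\<lambda>x. 2 * (f x - (1/2) * (s n x + s m x)))"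
      by (rule arg_cong[where f = ?N]) (simp add: fun_eq_iff field_simps)
    also have "\<dots> = 2 * ?N (\<lambda>x. f x - (1/2) * (s n x + s m x))"
      using norm_scale[OF diff_closed[OF f kernel_span_in[OF mid]], of 2] by simp
    finally have "(?N (\<lambda>x. (f x - s n x) + (f x - s m x)))\<^sup>2
        = 4 * (?N (\<lambda>x. f x - (1/2) * (s n x + s m x)))\<^sup>2" by (simp add: power_mult_distrib)
    with low[OF mid] have "(?N (\<lambda>x. (f x - s n x) + (f x - s m x)))\<^sup>2 \<ge> 4 * d" by simp
    moreover have "(\<lambda>x. (f x - s n x) - (f x - s m x)) = (\<lambda>x. s m x - s n x)"
      by (simp add: fun_eq_iff)
    ultimately show ?thesis using parallelogram[OF fs[of n] fs[of m]] up[of n] up[of m] by simp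
  qed
  have "\<exists>N. \<forall>m\<ge>N. \<forall>n\<ge>N. ?N (\<lambda>x. s m x - s n x) < e" if "e > 0" for e
  proof -
    obtain N where N: "1 / real (Suc N) < e\<^sup>2 / 4"
      using nat_approx_posE[of "e\<^sup>2/4"] \<open>e > 0\<close> by auto
    have "?N (\<lambda>x. s m x - s n x) < e" if "m \<ge> N" "n \<ge> N" for m n
    proof -
      have "1 / real (Suc m) \<le> 1 / real (Suc N)" "1 / real (Suc n) \<le> 1 / real (Suc N)"
        using that by (auto intro!: divide_left_mono)
      with par[of m n] N have "(?N (\<lambda>x. s m x - s n x))\<^sup>2 < e\<^sup>2" by simp
      then show ?thesis using \<open>e > 0\<close> by (simp add: power2_less_imp_less)
    qed
    then show ?thesis by blast
  qed
  then obtain g where g: "g \<in> H" and lim: "(\<lambda>n. ?N (\<lambda>x. s n x - g x)) \<longlonglongrightarrow> 0"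
    using complete[of s, OF sH] by auto
  define p where "p = (\<lambda>x. f x - g x)"
  have p: "p \<in> H" using f g by (simp add: p_def diff_closed)
  have "(\<lambda>n. ?N (\<lambda>x. (f x - s n x - c * K x w))) \<longlonglongrightarrow> ?N (\<lambda>x. p x - c * K x w)" if "w \<in> X" for c w
  proof (rule tendsto_norm)
    show "(\<lambda>n. ?N (\<lambda>x. (f x - s n x - c * K x w) - (p x - c * K x w))) \<longlonglongrightarrow> 0"
      using lim norm_diff_commute[OF g sH] by (simp add: p_def)
  qed (use that in \<open>auto intro!: diff_closed fs p scale_closed kernel_in\<close>)
  note lim2 = this
  have pup: "(?N p)\<^sup>2 \<le> d"
  proof (rule LIMSEQ_le)
    show "(\<lambda>n. (?N (\<lambda>x. f x - s n x))\<^sup>2) \<longlonglongrightarrow> (?N p)\<^sup>2"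
      by (intro tendsto_power tendsto_norm fs p)
        (use lim norm_diff_commute[OF g sH] in \<open>simp add: p_def\<close>)
    show "(\<lambda>n. d + 1 / real (Suc n)) \<longlonglongrightarrow> d"
      using tendsto_add[OF tendsto_const LIMSEQ_inverse_real_of_nat, of d] by (simp add: inverse_eq_divide)
  qed (use up less_imp_le in blast)
  have "p w = 0" if w: "w \<in> X" for w
  proof -
    define C where "C = (?N (\<lambda>z. K z w))\<^sup>2"
    \<comment> \<open>Adding a multiple of a kernel to \<open>s n\<close> stays in the span, so in
      the limit subtracting such a multiple cannot make \<open>p\<close> shorter.\<close>
    have ge: "(?N p)\<^sup>2 \<le> (?N (\<lambda>x. p x - c * K x w))\<^sup>2" for c
    proof -
      have "d \<le> (?N (\<lambda>x. f x - s n x - c * K x w))\<^sup>2" for n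
        using low[OF kernel_span.step[OF s w], of n c] by (simp add: algebra_simps)
      then have "d \<le> (?N (\<lambda>x. p x - c * K x w))\<^sup>2"
        by (intro LIMSEQ_le_const[OF tendsto_power[OF lim2[OF w]]]) auto
      then show ?thesis using pup by simp
    qed
    \<comment> \<open>The coefficient \<open>c = t * p w\<close> makes the cross term real, because
      the inner product of \<open>p\<close> with the kernel is \<open>p w\<close>.\<close>
    have quad: "2 * t * (cmod (p w))\<^sup>2 \<le> t\<^sup>2 * (cmod (p w))\<^sup>2 * C" for t :: real
    proof -
      have "0 \<le> - 2 * Re (cnj (of_real t * p w) * p w) + (cmod (of_real t * p w))\<^sup>2 * C"
        using ge[of "of_real t * p w"] norm_sq_diff[OF p kernel_in[OF w], of "of_real t * p w"]
        by (simp add: reproducing[OF p w] C_def)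
      also have "cnj (of_real t * p w) * p w = of_real (t * (cmod (p w))\<^sup>2)"
        unfolding of_real_mult complex_norm_square by simp
      finally show ?thesis by (simp add: norm_mult power_mult_distrib)
    qed
    have "C \<ge> 0" by (simp add: C_def)
    \<comment> \<open>The value \<open>t = 1/(C+1)\<close> violates the quadratic bound unless
      \<open>p w = 0\<close>; the summand 1 keeps the denominator positive when
      \<open>C = 0\<close>.\<close>
    have "2 * (1/(C+1)) \<le> (1/(C+1))\<^sup>2 * C" if "p w \<noteq> 0"
    proof (rule mult_right_le_imp_le)
      show "2 * (1/(C+1)) * (cmod (p w))\<^sup>2 \<le> (1/(C+1))\<^sup>2 * C * (cmod (p w))\<^sup>2"
        using quad[of "1/(C+1)"] by (simp only: mult_ac)
      show "0 < (cmod (p w))\<^sup>2" using that by simp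
    qed
    moreover have "(1/(C+1))\<^sup>2 * C < 2 * (1/(C+1))"
      using \<open>C \<ge> 0\<close> by (simp add: power2_eq_square divide_simps) 
    ultimately show ?thesis by (meson not_le)
  qed
  \<comment> \<open>Since \<open>p\<close> vanishes on \<open>X\<close> only, \<open>g\<close> may
    differ from \<open>f\<close> as a function; it is the norm of the difference that is
    zero.\<close>
  then have "?N (\<lambda>x. g x - f x) = 0"
    by (simp add: norm_eq_0_iff diff_closed f g p_def)
  then have "?N (\<lambda>x. s n x - f x) \<le> ?N (\<lambda>x. s n x - g x)" for n
    using norm_diff_triangle[OF sH g f] by (metis add.right_neutral)
  then have "(\<lambda>n. ?N (\<lambda>x. s n x - f x)) \<longlonglongrightarrow> 0"
    by (intro tendsto_sandwich[OF _ _ tendsto_const lim] always_eventually)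
       (auto intro!: norm_nonneg diff_closed f sH)
  with s show ?thesis using that by blast
qed

end

text \<open>The kernel determines the inner product on the span of the kernels. A sequence from the
  span that approximates \<open>f\<close> in the first space is therefore Cauchy in the second;
  evaluation at a point is continuous in both, so its limit there has the values of \<open>f\<close>
  on \<open>X\<close>.\<close>

lemma rkhs_unique_aux:
  assumes R1: "reproducing_kernel_hilbert_space X H1 ip1 K"
    and R2: "reproducing_kernel_hilbert_space X H2 ip2 K" and f: "f \<in> H1"
  shows "f \<in> H2 \<and> ip_norm ip2 f = ip_norm ip1 f"
proof -
  interpret R1: reproducing_kernel_hilbert_space X H1 ip1 K by (rule R1)
  interpret R2: reproducing_kernel_hilbert_space X H2 ip2 K by (rule R2)
  \<comment> \<open>Induction on the second argument, the slot in which the reproducing property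
    reads the kernel.\<close>
  have ipeq: "ip1 t s = ip2 t s" if "t \<in> kernel_span X K" "s \<in> kernel_span X K" for s t
    using that(2,1)
  proof (induction s rule: kernel_span.induct)
    case zero
    then show ?case
      using R1.ip_scale_right[OF R1.zero_closed R1.kernel_span_in, of t 0]
        R2.ip_scale_right[OF R2.zero_closed R2.kernel_span_in, of t 0] by simp
  next
    case (step s w c)
    then show ?case
      using R1.kernel_span_in[of s] R1.kernel_span_in[of t]
        R2.kernel_span_in[of s] R2.kernel_span_in[of t]
      by (simp add: R1.ip_add_right R2.ip_add_right R1.ip_scale_right R2.ip_scale_right
          R1.scale_closed R2.scale_closed R1.kernel_in R2.kernel_in R1.reproducing R2.reproducing)
  qed
  have neq: "ip_norm ip1 s = ip_norm ip2 s" if "s \<in> kernel_span X K" for s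
    using ipeq[OF that that] by (simp add: ip_norm_def)
  obtain s where s: "\<And>n::nat. s n \<in> kernel_span X K"
    and lim: "(\<lambda>n. ip_norm ip1 (\<lambda>x. s n x - f x)) \<longlonglongrightarrow> 0"
    using R1.kernel_span_dense[OF f] by blast
  have sH: "s n \<in> H1" "s n \<in> H2" for n
    using s R1.kernel_span_in R2.kernel_span_in by auto
  have "\<exists>N. \<forall>m\<ge>N. \<forall>n\<ge>N. ip_norm ip2 (\<lambda>x. s m x - s n x) < e" if "e > 0" for e
  proof -
    obtain N where N: "\<And>n. n \<ge> N \<Longrightarrow> ip_norm ip1 (\<lambda>x. s n x - f x) < e / 2"
      using order_tendstoD(2)[OF lim, of "e/2"] \<open>e > 0\<close> by (auto simp: eventually_sequentially)
    have "ip_norm ip2 (\<lambda>x. s m x - s n x) < e" if "m \<ge> N" "n \<ge> N" for m n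
    proof -
      have "ip_norm ip2 (\<lambda>x. s m x - s n x) = ip_norm ip1 (\<lambda>x. s m x - s n x)"
        using neq kernel_span_diff s by metis
      also have "\<dots> \<le> ip_norm ip1 (\<lambda>x. s m x - f x) + ip_norm ip1 (\<lambda>x. f x - s n x)"
        by (rule R1.norm_diff_triangle) (auto simp: f sH)
      also have "\<dots> < e"
        using N[OF that(1)] N[OF that(2)] R1.norm_diff_commute[OF f sH(1)[of n]] by simp
      finally show ?thesis .
    qed
    then show ?thesis by blast
  qed
  then obtain g where g: "g \<in> H2" and lim2: "(\<lambda>n. ip_norm ip2 (\<lambda>x. s n x - g x)) \<longlonglongrightarrow> 0"
    using R2.complete[of s, OF sH(2)] by auto
  have eq: "f w = g w" if "w \<in> X" for w
  proof (rule LIMSEQ_unique)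
    show "(\<lambda>n. s n w) \<longlonglongrightarrow> f w"
      using R1.tendsto_ip[OF sH(1) f R1.kernel_in[OF that] lim] that by (simp add: R1.reproducing f sH)
    show "(\<lambda>n. s n w) \<longlonglongrightarrow> g w"
      using R2.tendsto_ip[OF sH(2) g R2.kernel_in[OF that] lim2] that by (simp add: R2.reproducing g sH)
  qed
  have "ip_norm ip2 f = ip_norm ip2 g" using R2.norm_cong[OF g eq] by blast
  also have "\<dots> = ip_norm ip1 f"
    using R2.tendsto_norm[OF sH(2) g lim2] R1.tendsto_norm[OF sH(1) f lim]
    unfolding neq[OF s] by (rule LIMSEQ_unique)
  finally show ?thesis using R2.cong_closed[OF g eq] by blast
qed

lemma rkhs_unique:
  assumes "reproducing_kernel_hilbert_space X H1 ip1 K"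
    and "reproducing_kernel_hilbert_space X H2 ip2 K"
  shows "H1 = H2" and "f \<in> H1 \<Longrightarrow> ip_norm ip1 f = ip_norm ip2 f"
proof -
  show "H1 = H2"
    using rkhs_unique_aux[OF assms] rkhs_unique_aux[OF assms(2,1)] by blast
  show "ip_norm ip1 f = ip_norm ip2 f" if "f \<in> H1"
    using rkhs_unique_aux[OF assms that] by simp
qed

subsection \<open>Square-summable sequences and Toeplitz operators\<close>

definition l2 :: "(nat \<Rightarrow> complex) set" where
  "l2 = {f. summable (\<lambda>n. (cmod (f n))\<^sup>2)}"

definition l2_ip :: "(nat \<Rightarrow> complex) \<Rightarrow> (nat \<Rightarrow> complex) \<Rightarrow> complex" where
  "l2_ip f g = (\<Sum>n. f n * cnj (g n))"

abbreviation l2_norm :: "(nat \<Rightarrow> complex) \<Rightarrow> real" where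
  "l2_norm \<equiv> ip_norm l2_ip"

lemma l2_ip_summable_norm:
  assumes "f \<in> l2" "g \<in> l2"
  shows "summable (\<lambda>n. norm (f n * cnj (g n)))"
proof (rule summable_comparison_test'[where N = 0])
  show "summable (\<lambda>n. (cmod (f n))\<^sup>2 + (cmod (g n))\<^sup>2)"
    using assms by (auto simp: l2_def intro: summable_add)
  fix n
  show "norm (norm (f n * cnj (g n))) \<le> (cmod (f n))\<^sup>2 + (cmod (g n))\<^sup>2"
  proof -
    have "0 \<le> cmod (f n) * cmod (g n)" by simp
    then show ?thesis
      using sum_squares_bound[of "cmod (f n)" "cmod (g n)"]
      unfolding norm_mult complex_mod_cnj real_norm_def abs_mult abs_norm_cancel by linarith
  qed
qed

lemma l2_ip_summable: "f \<in> l2 \<Longrightarrow> g \<in> l2 \<Longrightarrow> summable (\<lambda>n. f n * cnj (g n))"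
  by (rule summable_norm_cancel[OF l2_ip_summable_norm])

lemma l2_ip_sums: "f \<in> l2 \<Longrightarrow> g \<in> l2 \<Longrightarrow> (\<lambda>n. f n * cnj (g n)) sums l2_ip f g"
  unfolding l2_ip_def by (rule summable_sums[OF l2_ip_summable])

lemma l2_ip_self: "f \<in> l2 \<Longrightarrow> l2_ip f f = of_real (\<Sum>n. (cmod (f n))\<^sup>2)"
  unfolding l2_ip_def complex_norm_square[symmetric] l2_def
  by (subst suminf_of_real) auto

lemma l2_norm_sq: "f \<in> l2 \<Longrightarrow> (l2_norm f)\<^sup>2 = (\<Sum>n. (cmod (f n))\<^sup>2)"
  unfolding ip_norm_def by (simp add: l2_ip_self l2_def suminf_nonneg)

lemma l2_norm_nonneg: "f \<in> l2 \<Longrightarrow> 0 \<le> l2_norm f"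
  unfolding ip_norm_def by (simp add: l2_ip_self l2_def suminf_nonneg)

lemma l2_add: "f \<in> l2 \<Longrightarrow> g \<in> l2 \<Longrightarrow> (\<lambda>n. f n + g n) \<in> l2"
proof -
  assume "f \<in> l2" "g \<in> l2"
  have summ: "summable (\<lambda>n. 2 * (cmod (f n))\<^sup>2 + 2 * (cmod (g n))\<^sup>2)"
    using \<open>f \<in> l2\<close> \<open>g \<in> l2\<close> by (auto simp: l2_def intro!: summable_add summable_mult)
  have "(cmod (f n + g n))\<^sup>2 \<le> 2 * (cmod (f n))\<^sup>2 + 2 * (cmod (g n))\<^sup>2" for n
  proof -
    have "(cmod (f n + g n))\<^sup>2 \<le> (cmod (f n) + cmod (g n))\<^sup>2"
      by (intro power_mono norm_triangle_ineq) auto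
    also have "\<dots> \<le> 2 * (cmod (f n))\<^sup>2 + 2 * (cmod (g n))\<^sup>2"
      using sum_squares_bound[of "cmod (f n)" "cmod (g n)"] by (simp add: power2_sum)
    finally show ?thesis .
  qed
  then show ?thesis unfolding l2_def mem_Collect_eq
    by (intro summable_comparison_test'[OF summ, of 0]) simp
qed

lemma l2_scale: "f \<in> l2 \<Longrightarrow> (\<lambda>n. c * f n) \<in> l2"
  by (auto simp: l2_def norm_mult power_mult_distrib intro: summable_mult)

text \<open>A partial sum of squares is a finite sum and passes to the limit, so all of them stay
  below \<open>C\<^sup>2\<close>. The filter is arbitrary because the limits taken are both along
  sequences and over radii tending to 1.\<close>

lemma l2_fatou:
  assumes lim: "\<And>k. ((\<lambda>n. s n k) \<longlongrightarrow> g k) F" and F: "F \<noteq> bot"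
    and bound: "eventually (\<lambda>n. s n \<in> l2 \<and> l2_norm (s n) \<le> C) F"
  shows "g \<in> l2" "l2_norm g \<le> C"
proof -
  obtain n0 where n0: "s n0 \<in> l2" "l2_norm (s n0) \<le> C"
    using eventually_happens[OF bound] F by auto
  have C: "C \<ge> 0" using n0 l2_norm_nonneg[of "s n0"] by simp
  have part: "(\<Sum>k<K. (cmod (g k))\<^sup>2) \<le> C\<^sup>2" for K
  proof (rule tendsto_upperbound[OF _ _ F])
    show "((\<lambda>n. \<Sum>k<K. (cmod (s n k))\<^sup>2) \<longlongrightarrow> (\<Sum>k<K. (cmod (g k))\<^sup>2)) F"
      by (intro tendsto_intros lim)
    show "eventually (\<lambda>n. (\<Sum>k<K. (cmod (s n k))\<^sup>2) \<le> C\<^sup>2) F"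
      using bound
    proof eventually_elim
      case (elim n)
      have "(\<Sum>k<K. (cmod (s n k))\<^sup>2) \<le> (\<Sum>k. (cmod (s n k))\<^sup>2)"
        using elim by (intro sum_le_suminf) (auto simp: l2_def)
      also have "\<dots> = (l2_norm (s n))\<^sup>2" using elim by (simp add: l2_norm_sq)
      also have "\<dots> \<le> C\<^sup>2" using elim by (intro power_mono) (auto simp: l2_norm_nonneg)
      finally show ?case .
    qed
  qed
  have summ: "summable (\<lambda>k. (cmod (g k))\<^sup>2)"
    by (rule summableI_nonneg_bounded[OF _ part]) simp
  then show g: "g \<in> l2" by (simp add: l2_def)
  have "(l2_norm g)\<^sup>2 \<le> C\<^sup>2"
    using g suminf_le_const[OF summ part] by (simp add: l2_norm_sq)
  then show "l2_norm g \<le> C" using C by (rule power2_le_imp_le)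
qed

lemma coeff_le_l2_norm: "f \<in> l2 \<Longrightarrow> cmod (f k) \<le> l2_norm f"
proof -
  assume f: "f \<in> l2"
  have "(\<Sum>n\<in>{k}. (cmod (f n))\<^sup>2) \<le> (\<Sum>n. (cmod (f n))\<^sup>2)"
    using f by (intro sum_le_suminf) (auto simp: l2_def)
  then have "(cmod (f k))\<^sup>2 \<le> (l2_norm f)\<^sup>2" using f by (simp add: l2_norm_sq)
  then show ?thesis by (rule power2_le_imp_le) (use f l2_norm_nonneg in auto)
qed

interpretation l2: hilbert_function_space UNIV l2 l2_ip
proof
  fix s :: "nat \<Rightarrow> nat \<Rightarrow> complex"
  assume s: "\<And>n. s n \<in> l2"
    and cauchy: "\<forall>e>0. \<exists>N. \<forall>m\<ge>N. \<forall>n\<ge>N. l2_norm (\<lambda>x. s m x - s n x) < e"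
  have diff: "f \<in> l2 \<Longrightarrow> g \<in> l2 \<Longrightarrow> (\<lambda>n. f n - g n) \<in> l2" for f g
    using l2_add[OF _ l2_scale[of g "-1"]] by simp
  have "\<exists>l. (\<lambda>n. s n k) \<longlonglongrightarrow> l" for k
  proof -
    have "Cauchy (\<lambda>n. s n k)"
    proof (rule CauchyI)
      fix e :: real assume "0 < e"
      then obtain N where "\<forall>m\<ge>N. \<forall>n\<ge>N. l2_norm (\<lambda>x. s m x - s n x) < e" using cauchy by blast
      moreover have "norm (s m k - s n k) \<le> l2_norm (\<lambda>x. s m x - s n x)" for m n
        by (rule coeff_le_l2_norm) (rule diff[OF s s])
      ultimately show "\<exists>N. \<forall>m\<ge>N. \<forall>n\<ge>N. norm (s m k - s n k) < e"
        by (meson le_less_trans)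
    qed
    then show ?thesis using Cauchy_convergent convergent_def by blast
  qed
  then obtain g where g: "\<And>k. (\<lambda>n. s n k) \<longlonglongrightarrow> g k" by metis
  have main: "\<exists>N. \<forall>n\<ge>N. (\<lambda>x. s n x - g x) \<in> l2 \<and> l2_norm (\<lambda>x. s n x - g x) \<le> e" if "e > 0" for e
  proof -
    obtain N where N: "\<forall>m\<ge>N. \<forall>n\<ge>N. l2_norm (\<lambda>x. s m x - s n x) < e" using cauchy \<open>e > 0\<close> by blast
    have "(\<lambda>x. s n x - g x) \<in> l2 \<and> l2_norm (\<lambda>x. s n x - g x) \<le> e" if "n \<ge> N" for n
    proof -
      \<comment> \<open>With \<open>n\<close> fixed and \<open>m\<close> tending to infinity,
        \<open>l2_fatou\<close> gives both membership of \<open>s n - g\<close> in \<open>l2\<close>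
        and the norm bound.\<close>
      have lim: "(\<lambda>m. s n k - s m k) \<longlonglongrightarrow> s n k - g k" for k
        by (intro tendsto_intros g)
      have "eventually (\<lambda>m. (\<lambda>k. s n k - s m k) \<in> l2 \<and> l2_norm (\<lambda>k. s n k - s m k) \<le> e) sequentially"
        using eventually_ge_at_top[of N] by eventually_elim (use N that diff s less_imp_le in blast)
      from l2_fatou[OF lim _ this] show ?thesis by simp
    qed
    then show ?thesis by blast
  qed
  obtain n where "(\<lambda>x. s n x - g x) \<in> l2" using main[of 1] by auto
  from diff[OF s[of n] this] have gl2: "g \<in> l2" by simp
  have "(\<lambda>n. l2_norm (\<lambda>x. s n x - g x)) \<longlonglongrightarrow> 0"
  proof (rule LIMSEQ_I)
    fix r :: real assume "0 < r"
    then obtain N where "\<forall>n\<ge>N. (\<lambda>x. s n x - g x) \<in> l2 \<and> l2_norm (\<lambda>x. s n x - g x) \<le> r/2"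
      using main[of "r/2"] by auto
    then have "\<forall>n\<ge>N. norm (l2_norm (\<lambda>x. s n x - g x) - 0) < r"
      using l2_norm_nonneg \<open>0 < r\<close> by fastforce
    then show "\<exists>N. \<forall>n\<ge>N. norm (l2_norm (\<lambda>x. s n x - g x) - 0) < r" by blast
  qed
  with gl2 show "\<exists>f\<in>l2. (\<lambda>n. l2_norm (\<lambda>x. s n x - f x)) \<longlonglongrightarrow> 0" by blast
next
  fix f g :: "nat \<Rightarrow> complex" assume fg: "f \<in> l2" "g \<in> l2"
  have "(\<lambda>n. cnj (f n * cnj (g n))) sums cnj (l2_ip f g)"
    using l2_ip_sums[OF fg] by (rule iffD2[OF sums_cnj])
  moreover have "(\<lambda>n. cnj (f n * cnj (g n))) sums l2_ip g f"
    using l2_ip_sums[OF fg(2,1)] by (simp add: mult.commute)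
  ultimately show "l2_ip g f = cnj (l2_ip f g)" using sums_unique2 by blast
next
  fix f g h :: "nat \<Rightarrow> complex" assume fgh: "f \<in> l2" "g \<in> l2" "h \<in> l2"
  show "l2_ip (\<lambda>x. f x + g x) h = l2_ip f h + l2_ip g h"
    unfolding l2_ip_def by (simp add: distrib_right suminf_add l2_ip_summable fgh)
next
  fix f h :: "nat \<Rightarrow> complex" and c assume fh: "f \<in> l2" "h \<in> l2"
  show "l2_ip (\<lambda>x. c * f x) h = c * l2_ip f h"
    unfolding l2_ip_def using suminf_mult[OF l2_ip_summable[OF fh], of c] by (simp add: mult.assoc)
next
  fix f :: "nat \<Rightarrow> complex" assume f: "f \<in> l2"
  then have *: "summable (\<lambda>n. (cmod (f n))\<^sup>2)" by (simp add: l2_def)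
  show "0 \<le> Re (l2_ip f f)" using l2_ip_self[OF f] suminf_nonneg[OF *] by simp
  show "(l2_ip f f = 0) = (\<forall>x\<in>UNIV. f x = 0)"
    using l2_ip_self[OF f] suminf_eq_zero_iff[OF *] by simp
qed (auto simp: l2_add l2_scale fun_eq_iff, auto simp: l2_def)

section \<open>Truncations, weak convergence and weak compactness in \<open>l2\<close>\<close>

definition truncate :: "nat \<Rightarrow> (nat \<Rightarrow> complex) \<Rightarrow> nat \<Rightarrow> complex" where
  "truncate N f n = (if n < N then f n else 0)"

lemma truncate_l2 [simp]: "truncate N f \<in> l2"
  unfolding l2_def mem_Collect_eq by (rule summable_finite[of "{..<N}"]) (auto simp: truncate_def)

lemma l2_ip_truncate: "l2_ip f (truncate N g) = (\<Sum>n<N. f n * cnj (g n))"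
  unfolding l2_ip_def by (subst suminf_finite[of "{..<N}"]) (auto simp: truncate_def)

lemma tendsto_truncate:
  assumes "f \<in> l2"
  shows "(\<lambda>N. l2_norm (\<lambda>n. truncate N f n - f n)) \<longlonglongrightarrow> 0"
proof -
  have s: "summable (\<lambda>n. (cmod (f n))\<^sup>2)" using assms by (simp add: l2_def)
  have "(l2_norm (\<lambda>n. truncate N f n - f n))\<^sup>2 = (\<Sum>n. (cmod (f n))\<^sup>2) - (\<Sum>n<N. (cmod (f n))\<^sup>2)" for N
  proof -
    have "(l2_norm (\<lambda>n. truncate N f n - f n))\<^sup>2 = (\<Sum>n. (cmod (truncate N f n - f n))\<^sup>2)"
      using assms by (intro l2_norm_sq l2.diff_closed) auto
    also have "(\<lambda>n. (cmod (truncate N f n - f n))\<^sup>2) =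
        (\<lambda>n. (cmod (f n))\<^sup>2 - (if n < N then (cmod (f n))\<^sup>2 else 0))"
      by (auto simp: truncate_def fun_eq_iff)
    also have "(\<Sum>n. (cmod (f n))\<^sup>2 - (if n < N then (cmod (f n))\<^sup>2 else 0)) =
        (\<Sum>n. (cmod (f n))\<^sup>2) - (\<Sum>n. if n < N then (cmod (f n))\<^sup>2 else 0)"
      by (intro suminf_diff[symmetric] s summable_finite[of "{..<N}"]) auto
    also have "(\<Sum>n. if n < N then (cmod (f n))\<^sup>2 else 0) = (\<Sum>n<N. (cmod (f n))\<^sup>2)"
      by (subst suminf_finite[of "{..<N}"]) auto
    finally show ?thesis .
  qed
  moreover have "(\<lambda>N. (\<Sum>n. (cmod (f n))\<^sup>2) - (\<Sum>n<N. (cmod (f n))\<^sup>2)) \<longlonglongrightarrow> 0"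
    using tendsto_diff[OF tendsto_const[of "\<Sum>n. (cmod (f n))\<^sup>2"] summable_LIMSEQ[OF s]] by simp
  ultimately have "(\<lambda>N. (l2_norm (\<lambda>n. truncate N f n - f n))\<^sup>2) \<longlonglongrightarrow> 0" by simp
  from tendsto_real_sqrt[OF this] show ?thesis
    using assms by (simp add: l2.norm_nonneg l2.diff_closed)
qed

text \<open>Against a truncation of \<open>y\<close> the inner product is a finite sum of
  coordinates. The remaining tail of \<open>y\<close> is small, uniformly in \<open>n\<close>
  because the \<open>s n\<close> are bounded.\<close>

lemma l2_weak_convergence:
  assumes lim: "\<And>k. ((\<lambda>n. s n k) \<longlongrightarrow> g k) F"
    and bound: "eventually (\<lambda>n. s n \<in> l2 \<and> l2_norm (s n) \<le> C) F" and g: "g \<in> l2" and y: "y \<in> l2"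
  shows "((\<lambda>n. l2_ip (s n) y) \<longlongrightarrow> l2_ip g y) F"
proof (rule tendstoI)
  fix e :: real assume e: "e > 0"
  \<comment> \<open>Bounds the norm of \<open>s n - g\<close>; the summand 1 makes it positive so
    that \<open>e / (2 * D)\<close> is admissible.\<close>
  define D where "D = \<bar>C\<bar> + l2_norm g + 1"
  have D: "D > 0" using l2.norm_nonneg[OF g] by (simp add: D_def)
  obtain N where N: "l2_norm (\<lambda>n. truncate N y n - y n) < e / (2 * D)"
    using order_tendstoD(2)[OF tendsto_truncate[OF y], of "e / (2*D)"] e D
    by (auto simp: eventually_sequentially)
  define z where "z = (\<lambda>n. truncate N y n - y n)"
  have z: "z \<in> l2" unfolding z_def by (intro l2.diff_closed y) simp
  have "((\<lambda>n. l2_ip (s n) (truncate N y)) \<longlongrightarrow> l2_ip g (truncate N y)) F"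
    unfolding l2_ip_truncate by (intro tendsto_intros lim)
  then have "eventually (\<lambda>n. dist (l2_ip (s n) (truncate N y)) (l2_ip g (truncate N y)) < e/2) F"
    using e by (intro tendstoD) auto
  then show "eventually (\<lambda>n. dist (l2_ip (s n) y) (l2_ip g y) < e) F"
    using bound
  proof eventually_elim
    case (elim n)
    have d: "(\<lambda>k. s n k - g k) \<in> l2" using elim g l2.diff_closed by blast
    have "l2_norm (\<lambda>k. s n k - g k) \<le> l2_norm (s n) + l2_norm g"
      using l2.norm_diff_triangle[of "s n" "\<lambda>_. 0" g] l2.norm_diff_commute[of "\<lambda>_. 0" g] elim g l2.zero_closed
      by simp
    also have "\<dots> \<le> D" using elim abs_ge_self[of C] unfolding D_def by linarith
    finally have "cmod (l2_ip (\<lambda>k. s n k - g k) z) \<le> D * l2_norm z"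
      using l2.cauchy_schwarz[OF d z] l2.norm_nonneg[OF z] by (meson mult_right_mono order_trans)
    also have "\<dots> < e / 2" using N D by (simp add: z_def field_simps)
    finally have "cmod (l2_ip (\<lambda>k. s n k - g k) z) < e / 2" .
    moreover have "l2_ip (\<lambda>k. s n k - g k) z =
       (l2_ip (s n) (truncate N y) - l2_ip g (truncate N y)) - (l2_ip (s n) y - l2_ip g y)"
      using elim g y d unfolding z_def by (simp add: l2.ip_diff l2.ip_diff_right)
    ultimately show ?case using elim(1) unfolding dist_norm
      by (smt (verit, best) norm_triangle_ineq2 norm_minus_commute field_sum_of_halves)
  qed
qed

text \<open>The upper bound is assumed. The lower bound expands the squared norm of
  \<open>s n - g\<close>, which is nonnegative, and uses weak convergence tested against
  \<open>g\<close> itself.\<close>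

lemma l2_norm_convergence:
  assumes lim: "\<And>k. ((\<lambda>n. s n k) \<longlongrightarrow> g k) F"
    and bound: "eventually (\<lambda>n. s n \<in> l2 \<and> l2_norm (s n) \<le> l2_norm g) F" and g: "g \<in> l2"
  shows "((\<lambda>n. (l2_norm (s n))\<^sup>2) \<longlongrightarrow> (l2_norm g)\<^sup>2) F"
proof (rule tendsto_sandwich)
  show "eventually (\<lambda>n. (l2_norm (s n))\<^sup>2 \<le> (l2_norm g)\<^sup>2) F"
    using bound by eventually_elim (auto intro!: power_mono l2.norm_nonneg)
  show "eventually (\<lambda>n. 2 * Re (l2_ip (s n) g) - (l2_norm g)\<^sup>2 \<le> (l2_norm (s n))\<^sup>2) F"
    using bound
  proof eventually_elim
    case (elim n)
    have "0 \<le> (l2_norm (\<lambda>k. s n k - 1 * g k))\<^sup>2" by simp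
    also have "\<dots> = (l2_norm (s n))\<^sup>2 - 2 * Re (l2_ip (s n) g) + (l2_norm g)\<^sup>2"
      using l2.norm_sq_diff[of "s n" g 1] elim g by simp
    finally show ?case by linarith
  qed
  have "((\<lambda>n. 2 * Re (l2_ip (s n) g) - (l2_norm g)\<^sup>2) \<longlongrightarrow> 2 * Re (l2_ip g g) - (l2_norm g)\<^sup>2) F"
    by (intro tendsto_intros l2_weak_convergence[OF lim bound g g])
  then show "((\<lambda>n. 2 * Re (l2_ip (s n) g) - (l2_norm g)\<^sup>2) \<longlongrightarrow> (l2_norm g)\<^sup>2) F"
    using l2.norm_sq[OF g] by simp
qed simp

text \<open>Every coordinate is a bounded sequence, so a diagonal subsequence converges in all
  coordinates; \<open>l2_fatou\<close> puts the limit in \<open>l2\<close>.\<close>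

lemma l2_bounded_subseq:
  assumes s: "\<And>n. s n \<in> l2" and bound: "\<And>n. l2_norm (s n) \<le> C"
  obtains r g where "strict_mono (r :: nat \<Rightarrow> nat)" "g \<in> l2" "\<And>k. (\<lambda>n. s (r n) k) \<longlonglongrightarrow> g k"
proof -
  have bdd: "cmod (s n k) \<le> C" for n k
    using coeff_le_l2_norm[OF s] bound order_trans by blast
  interpret subseqs "\<lambda>k r. convergent (\<lambda>n. s (r n) k)"
  proof
    fix k and r :: "nat \<Rightarrow> nat"
    have "bounded (range (\<lambda>n. s (r n) k))" using bdd by (intro boundedI) auto
    then obtain l r' where "strict_mono r'" "((\<lambda>n. s (r n) k) \<circ> r') \<longlonglongrightarrow> l"
      using bounded_imp_convergent_subsequence by blast
    then show "\<exists>r'. strict_mono r' \<and> convergent (\<lambda>n. s ((r \<circ> r') n) k)"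
      by (auto simp: convergent_def o_def)
  qed
  have "convergent (\<lambda>n. s (diagseq n) k)" for k
  proof -
    \<comment> \<open>Only from index \<open>Suc k\<close> on is the diagonal sequence guaranteed to
      be a subsequence of the one chosen for coordinate \<open>k\<close>; a finite initial segment
      is then ignored.\<close>
    have "convergent (\<lambda>n. s ((diagseq \<circ> (+) (Suc k)) n) k)"
    proof (rule diagseq_holds)
      fix r t :: "nat \<Rightarrow> nat" and k
      assume "strict_mono t" "convergent (\<lambda>n. s (r n) k)"
      then show "convergent (\<lambda>n. s ((r \<circ> t) n) k)"
        using convergent_subseq_convergent[of "\<lambda>n. s (r n) k" t] by (simp add: o_def)
    qed
    then show ?thesis
      using convergent_ignore_initial_segment[of "\<lambda>n. s (diagseq n) k" "Suc k"]
      by (simp add: o_def add.commute)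
  qed
  then have "\<forall>k. \<exists>l. (\<lambda>n. s (diagseq n) k) \<longlonglongrightarrow> l" by (simp add: convergent_def)
  from choice[OF this] obtain g where g: "\<And>k. (\<lambda>n. s (diagseq n) k) \<longlonglongrightarrow> g k" by blast
  have "g \<in> l2" by (rule l2_fatou[OF g, where C = C]) (simp_all add: s bound)
  with g show ?thesis using that[OF subseq_diagseq] by blast
qed

section \<open>Co-analytic Toeplitz operators on coefficient sequences\<close>

definition shift :: "nat \<Rightarrow> (nat \<Rightarrow> complex) \<Rightarrow> nat \<Rightarrow> complex" where
  "shift m f n = f (m + n)"

text \<open>For \<open>u\<close> the Taylor coefficients of a bounded function, this is the co-analytic Toeplitz
  operator whose symbol is the conjugate of that function.\<close>

definition toeplitz :: "(nat \<Rightarrow> complex) \<Rightarrow> (nat \<Rightarrow> complex) \<Rightarrow> nat \<Rightarrow> complex" where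
  "toeplitz u f m = (\<Sum>n. cnj (u n) * f (m + n))"

text \<open>Multiplication by the function with coefficients \<open>u\<close>, in coefficient form.
  Its adjoint is \<open>toeplitz u\<close>.\<close>

definition conv :: "(nat \<Rightarrow> complex) \<Rightarrow> (nat \<Rightarrow> complex) \<Rightarrow> nat \<Rightarrow> complex" where
  "conv u h n = (\<Sum>i\<le>n. h i * u (n - i))"

text \<open>Boundedness of a symbol enters only through this operator bound on \<open>l2\<close>, so
  that the Toeplitz estimates follow by duality without function theory.\<close>

definition multiplier :: "(nat \<Rightarrow> complex) \<Rightarrow> real \<Rightarrow> bool" where
  "multiplier u M \<longleftrightarrow> 0 \<le> M \<and> u \<in> l2 \<and> (\<forall>h\<in>l2. conv u h \<in> l2 \<and> l2_norm (conv u h) \<le> M * l2_norm h)"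

lemma shift_l2 [simp]: "f \<in> l2 \<Longrightarrow> shift m f \<in> l2"
  unfolding l2_def shift_def mem_Collect_eq
  using summable_ignore_initial_segment[of "\<lambda>n. (cmod (f n))\<^sup>2" m] by (simp add: add.commute)

lemma shift_norm: "f \<in> l2 \<Longrightarrow> l2_norm (shift m f) \<le> l2_norm f"
proof -
  assume f: "f \<in> l2"
  then have s: "summable (\<lambda>n. (cmod (f n))\<^sup>2)" by (simp add: l2_def)
  have "(\<Sum>n. (cmod (f (n + m)))\<^sup>2) \<le> (\<Sum>n. (cmod (f n))\<^sup>2)"
    using suminf_split_initial_segment[OF s, of m] sum_nonneg[of "{..<m}" "\<lambda>n. (cmod (f n))\<^sup>2"] by simp
  then have "(l2_norm (shift m f))\<^sup>2 \<le> (l2_norm f)\<^sup>2"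
    using f by (simp add: l2_norm_sq) (simp add: shift_def add.commute)
  then show ?thesis by (rule power2_le_imp_le) (use f l2.norm_nonneg in auto)
qed

lemma toeplitz_shift: "toeplitz u f m = l2_ip (shift m f) u"
  by (simp add: toeplitz_def l2_ip_def shift_def mult.commute)

lemma shift_toeplitz: "shift m (toeplitz u f) = toeplitz u (shift m f)"
  by (simp add: fun_eq_iff shift_def toeplitz_def add.assoc)

lemma toeplitz_summable: "u \<in> l2 \<Longrightarrow> f \<in> l2 \<Longrightarrow> summable (\<lambda>n. cnj (u n) * f (m + n))"
  using l2_ip_summable[OF shift_l2[of f m], of u] by (simp add: shift_def mult.commute)

text \<open>A finite sum may be exchanged with a convergent series, so this duality is available for
  every \<open>u\<close> in \<open>l2\<close>, before any bound on \<open>toeplitz u\<close> is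
  known.\<close>

lemma toeplitz_adjoint_finite:
  assumes u: "u \<in> l2" and f: "f \<in> l2"
  shows "(\<Sum>m<N. toeplitz u f m * cnj (h m)) = l2_ip f (conv u (truncate N h))"
proof -
  \<comment> \<open>Re-indexes the series by \<open>k = m + n\<close>, padded with zeros for
    \<open>k < m\<close>, so that the series for different \<open>m\<close> can be added
    termwise.\<close>
  define G where "G m k = (if m \<le> k then f k * cnj (h m * u (k - m)) else 0)" for m k
  have "G m sums (toeplitz u f m * cnj (h m))" for m
  proof -
    have "(\<lambda>n. shift m f n * cnj (u n) * cnj (h m)) sums (toeplitz u f m * cnj (h m))"
      using l2_ip_sums[OF shift_l2[OF f, of m] u] unfolding toeplitz_shift by (rule sums_mult2)
    then have "(\<lambda>n. G m (n + m)) sums (toeplitz u f m * cnj (h m))"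
      by (simp add: G_def shift_def add.commute mult_ac)
    then show ?thesis unfolding sums_iff_shift by (simp add: G_def)
  qed
  then have "(\<lambda>k. \<Sum>m<N. G m k) sums (\<Sum>m<N. toeplitz u f m * cnj (h m))"
    by (intro sums_sum)
  moreover have "(\<Sum>m<N. G m k) = f k * cnj (conv u (truncate N h) k)" for k
  proof -
    have "(\<Sum>m<N. G m k) = (\<Sum>m\<in>{..<N} \<inter> {..k}. f k * cnj (h m * u (k - m)))"
      by (rule sum.mono_neutral_cong_right) (auto simp: G_def)
    also have "\<dots> = (\<Sum>m\<le>k. f k * cnj (truncate N h m * u (k - m)))"
      by (rule sum.mono_neutral_cong_left) (auto simp: truncate_def)
    finally show ?thesis by (simp add: conv_def sum_distrib_left)
  qed
  ultimately show ?thesis unfolding l2_ip_def by (simp add: sums_iff)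
qed

text \<open>Duality with a truncation \<open>?h\<close> of the image: its squared norm is the inner
  product of \<open>f\<close> with \<open>conv u ?h\<close>, at most \<open>M\<close> times the
  norms of \<open>f\<close> and \<open>?h\<close>, and one factor cancels. Truncating first makes
  the norm finite; \<open>l2_fatou\<close> removes the truncation.\<close>

lemma toeplitz_bounded:
  assumes u: "multiplier u M" and f: "f \<in> l2"
  shows "toeplitz u f \<in> l2" "l2_norm (toeplitz u f) \<le> M * l2_norm f"
proof -
  have ul2: "u \<in> l2" and M: "M \<ge> 0"
    and b: "\<And>h. h \<in> l2 \<Longrightarrow> conv u h \<in> l2 \<and> l2_norm (conv u h) \<le> M * l2_norm h"
    using u by (auto simp: multiplier_def)
  have bound: "l2_norm (truncate N (toeplitz u f)) \<le> M * l2_norm f" for N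
  proof -
    let ?h = "truncate N (toeplitz u f)"
    have "(l2_norm ?h)\<^sup>2 = Re (l2_ip ?h ?h)" by (simp add: l2.norm_sq)
    also have "l2_ip ?h ?h = (\<Sum>m<N. toeplitz u f m * cnj (toeplitz u f m))"
      unfolding l2_ip_truncate by (simp add: truncate_def)
    also have "\<dots> = l2_ip f (conv u ?h)" by (rule toeplitz_adjoint_finite[OF ul2 f])
    also have "Re \<dots> \<le> l2_norm f * l2_norm (conv u ?h)"
      using complex_Re_le_cmod l2.cauchy_schwarz[OF f, of "conv u ?h"] b[of ?h]
      by (meson order_trans truncate_l2)
    also have "\<dots> \<le> l2_norm f * (M * l2_norm ?h)"
      using b[of ?h] f by (intro mult_left_mono l2.norm_nonneg) auto
    finally have *: "l2_norm ?h * l2_norm ?h \<le> (M * l2_norm f) * l2_norm ?h"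
      by (simp add: power2_eq_square mult_ac)
    show ?thesis
    proof (cases "l2_norm ?h = 0")
      case True
      then show ?thesis using M f by (simp add: l2.norm_nonneg)
    next
      case False
      then have "l2_norm ?h > 0" using l2.norm_nonneg[of ?h] by simp
      then show ?thesis using * by simp
    qed
  qed
  have lim: "(\<lambda>N. truncate N (toeplitz u f) k) \<longlonglongrightarrow> toeplitz u f k" for k
    by (rule tendsto_eventually)
       (use eventually_gt_at_top[of k] in \<open>eventually_elim, simp add: truncate_def\<close>)
  show "toeplitz u f \<in> l2" "l2_norm (toeplitz u f) \<le> M * l2_norm f"
    by (rule l2_fatou[OF lim, where C = "M * l2_norm f"], auto simp: bound)+
qed

text \<open>The finite duality holds for the truncations of \<open>h\<close>, and both sides are
  continuous in \<open>h\<close> since \<open>conv u\<close> is bounded.\<close>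

lemma toeplitz_adjoint:
  assumes u: "multiplier u M" and f: "f \<in> l2" and h: "h \<in> l2"
  shows "l2_ip (toeplitz u f) h = l2_ip f (conv u h)"
proof (rule LIMSEQ_unique)
  have ul2: "u \<in> l2" and M: "M \<ge> 0"
    and b: "\<And>h. h \<in> l2 \<Longrightarrow> conv u h \<in> l2 \<and> l2_norm (conv u h) \<le> M * l2_norm h"
    using u by (auto simp: multiplier_def)
  show "(\<lambda>N. l2_ip (toeplitz u f) (truncate N h)) \<longlonglongrightarrow> l2_ip (toeplitz u f) h"
    by (rule l2.tendsto_ip_right[OF _ h toeplitz_bounded(1)[OF u f] tendsto_truncate[OF h]]) simp
  have "(\<lambda>N. l2_ip f (conv u (truncate N h))) \<longlonglongrightarrow> l2_ip f (conv u h)"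
  proof (rule l2.tendsto_ip_right[OF _ _ f])
    have "l2_norm (\<lambda>x. conv u (truncate N h) x - conv u h x) \<le> M * l2_norm (\<lambda>n. truncate N h n - h n)" for N
    proof -
      have "(\<lambda>x. conv u (truncate N h) x - conv u h x) = conv u (\<lambda>n. truncate N h n - h n)"
        by (simp add: fun_eq_iff conv_def sum_subtractf left_diff_distrib)
      then show ?thesis using b[OF l2.diff_closed[OF truncate_l2 h]] by simp
    qed
    moreover have "0 \<le> l2_norm (\<lambda>x. conv u (truncate N h) x - conv u h x)" for N
      using b[OF truncate_l2, of N h] b[OF h] by (intro l2.norm_nonneg l2.diff_closed) auto
    moreover have "(\<lambda>N. M * l2_norm (\<lambda>n. truncate N h n - h n)) \<longlonglongrightarrow> 0"
      using tendsto_mult_left[OF tendsto_truncate[OF h], of M] by simp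
    ultimately show "(\<lambda>N. l2_norm (\<lambda>x. conv u (truncate N h) x - conv u h x)) \<longlonglongrightarrow> 0"
      using tendsto_sandwich[OF _ _ tendsto_const] always_eventually by (metis (no_types, lifting))
  qed (use b h in auto)
  then show "(\<lambda>N. l2_ip (toeplitz u f) (truncate N h)) \<longlonglongrightarrow> l2_ip f (conv u h)"
    unfolding l2_ip_truncate toeplitz_adjoint_finite[OF ul2 f] .
qed

text \<open>The coefficient at \<open>m\<close> is an inner product of a shifted sequence with
  \<open>u\<close>. Shifts commute with \<open>toeplitz v\<close>, and its adjoint turns
  \<open>u\<close> into the product of \<open>v\<close> and \<open>u\<close>.\<close>

lemma toeplitz_toeplitz:
  assumes "multiplier v M" "u \<in> l2" "f \<in> l2"
  shows "toeplitz u (toeplitz v f) = toeplitz (conv v u) f"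
proof
  fix m
  have "toeplitz u (toeplitz v f) m = l2_ip (toeplitz v (shift m f)) u"
    unfolding toeplitz_shift[of u] shift_toeplitz ..
  also have "\<dots> = l2_ip (shift m f) (conv v u)"
    by (rule toeplitz_adjoint[OF assms(1) _ assms(2)]) (simp add: assms(3))
  finally show "toeplitz u (toeplitz v f) m = toeplitz (conv v u) f m"
    by (simp only: toeplitz_shift)
qed

subsection \<open>Taylor coefficients\<close>

lemma taylor_sums:
  "f holomorphic_on ball 0 1 \<Longrightarrow> z \<in> ball 0 1 \<Longrightarrow> (\<lambda>n. taylor_coeff f n * z ^ n) sums f z"
  using holomorphic_power_series[of f 0 1 z] by (simp add: taylor_coeff_def fps_expansion_def)

lemma taylor_has_fps_expansion:
  assumes "f holomorphic_on ball 0 1"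
  shows "f has_fps_expansion fps_expansion f 0"
  by (rule has_fps_expansion_fps_expansion[of "ball 0 1"]) (use assms in auto)

lemma taylor_coeff_eqI: "f has_fps_expansion F \<Longrightarrow> taylor_coeff f = fps_nth F"
  unfolding taylor_coeff_def using fps_expansion_eqI by auto

lemma taylor_coeff_cong:
  assumes "\<And>z. z \<in> ball 0 1 \<Longrightarrow> f z = g z"
  shows "taylor_coeff f = taylor_coeff g"
proof -
  have "eventually (\<lambda>z. f z = g z) (nhds 0)"
    unfolding eventually_nhds by (rule exI[of _ "ball 0 1"]) (use assms in auto)
  from fps_expansion_cong[OF this] show ?thesis by (simp add: taylor_coeff_def fun_eq_iff)
qed

lemma taylor_coeff_mult:
  assumes "f holomorphic_on ball 0 1" "g holomorphic_on ball 0 1"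
  shows "taylor_coeff (\<lambda>z. f z * g z) = conv (taylor_coeff f) (taylor_coeff g)"
proof -
  have "(\<lambda>z. g z * f z) has_fps_expansion fps_expansion g 0 * fps_expansion f 0"
    by (intro fps_expansion_intros taylor_has_fps_expansion assms)
  from taylor_coeff_eqI[OF this] show ?thesis
    by (simp add: mult.commute[of "f _"] fun_eq_iff fps_mult_nth conv_def taylor_coeff_def atLeast0AtMost)
qed

lemma taylor_coeff_diff:
  assumes "f holomorphic_on ball 0 1" "g holomorphic_on ball 0 1"
  shows "taylor_coeff (\<lambda>z. f z - g z) = (\<lambda>n. taylor_coeff f n - taylor_coeff g n)"
  using taylor_coeff_eqI[OF has_fps_expansion_diff[OF taylor_has_fps_expansion taylor_has_fps_expansion, OF assms]]
  by (simp add: fun_eq_iff taylor_coeff_def)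

lemma taylor_coeff_add:
  assumes "f holomorphic_on ball 0 1" "g holomorphic_on ball 0 1"
  shows "taylor_coeff (\<lambda>z. f z + g z) = (\<lambda>n. taylor_coeff f n + taylor_coeff g n)"
  using taylor_coeff_eqI[OF has_fps_expansion_add[OF taylor_has_fps_expansion taylor_has_fps_expansion, OF assms]]
  by (simp add: fun_eq_iff taylor_coeff_def)

lemma taylor_coeff_const: "taylor_coeff (\<lambda>z. c) = (\<lambda>n. if n = 0 then c else 0)"
  using taylor_coeff_eqI[OF has_fps_expansion_const] by (simp add: fun_eq_iff)

lemma taylor_coeff_scale:
  assumes "f holomorphic_on ball 0 1"
  shows "taylor_coeff (\<lambda>z. c * f z) = (\<lambda>n. c * taylor_coeff f n)"
  using taylor_coeff_eqI[OF has_fps_expansion_cmult_left[OF taylor_has_fps_expansion[OF assms]]]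
  by (simp add: fun_eq_iff taylor_coeff_def)

lemma taylor_coeff_power: "taylor_coeff (\<lambda>z. z ^ m) = (\<lambda>n. if n = m then 1 else 0)"
  using taylor_coeff_eqI[OF has_fps_expansion_fps_X_power] by (simp add: fun_eq_iff)

lemma taylor_coeff_0: "f holomorphic_on ball 0 1 \<Longrightarrow> taylor_coeff f 0 = f 0"
  by (simp add: taylor_coeff_def fps_expansion_def)

lemma power_series_taylor:
  assumes "\<And>z. z \<in> ball 0 1 \<Longrightarrow> (\<lambda>n. c n * z ^ n) sums f z"
  shows "f holomorphic_on ball 0 1" "taylor_coeff f = c"
proof -
  show hol: "f holomorphic_on ball 0 1"
    by (rule power_series_holomorphic[of 0 1 c]) (use assms in auto)
  have "conv_radius c \<ge> 1"
  proof (rule conv_radius_geI_ex)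
    fix r :: real assume "0 < r" "ereal r < 1"
    then have "(of_real r :: complex) \<in> ball 0 1" by simp
    from assms[OF this] \<open>0 < r\<close> show "\<exists>z. norm z = r \<and> summable (\<lambda>n. c n * z ^ n)"
      by (intro exI[of _ "of_real r"]) (auto simp: sums_iff)
  qed
  then have "f has_fps_expansion Abs_fps c"
    unfolding has_fps_expansion_def fps_conv_radius_def
  proof safe
    assume "1 \<le> conv_radius c"
    moreover have "(0 :: ereal) < 1" by simp
    ultimately have "0 < conv_radius c" by (rule order_less_le_trans[rotated])
    then show "0 < conv_radius (fps_nth (Abs_fps c))" by simp
    show "eventually (\<lambda>z. eval_fps (Abs_fps c) z = f z) (nhds 0)"
      unfolding eventually_nhds
      by (rule exI[of _ "ball 0 1"]) (use assms in \<open>auto simp: eval_fps_def sums_iff\<close>)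
  qed
  from taylor_coeff_eqI[OF this] show "taylor_coeff f = c" by (simp add: fun_eq_iff)
qed

lemma l2_holomorphic_extension:
  assumes "h \<in> l2"
  obtains f where "f holomorphic_on ball 0 1" "taylor_coeff f = h"
proof -
  have "(\<lambda>n. h n * z ^ n) sums (\<Sum>n. h n * z ^ n)" if "z \<in> ball 0 1" for z
  proof (rule summable_sums, rule summable_norm_cancel, rule summable_comparison_test'[where N = 0])
    show "summable (\<lambda>n. l2_norm h * cmod z ^ n)"
      using that by (intro summable_mult summable_geometric) auto
    show "norm (norm (h n * z ^ n)) \<le> l2_norm h * cmod z ^ n" for n
      using coeff_le_l2_norm[OF assms, of n] by (simp add: norm_mult norm_power mult_right_mono)
  qed
  from power_series_taylor[OF this] show ?thesis using that by blast
qed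

lemma taylor_summable_norm:
  assumes "f holomorphic_on ball 0 1" "0 \<le> r" "r < 1"
  shows "summable (\<lambda>n. cmod (taylor_coeff f n) * r ^ n)"
proof -
  \<comment> \<open>The point \<open>(1 + r) / 2\<close> lies strictly between \<open>r\<close> and
    1; convergence there implies absolute convergence at \<open>r\<close>.\<close>
  have "summable (\<lambda>n. taylor_coeff f n * of_real ((1 + r) / 2) ^ n)"
    using taylor_sums[OF assms(1), of "of_real ((1 + r) / 2)"] assms(2,3)
    by (simp add: sums_iff del: of_real_divide of_real_add)
  then have "summable (\<lambda>n. norm (taylor_coeff f n * of_real r ^ n))"
    by (rule powser_insidea) (use assms in \<open>simp del: of_real_divide of_real_add\<close>)
  then show ?thesis using assms by (simp add: norm_mult norm_power)
qed

subsection \<open>Integration over circles\<close>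

lemma finite_circle_measure: "finite_measure circle_measure"
  by (rule finite_measure_lebesgue_on) simp

interpretation circle: finite_measure circle_measure
  by (rule finite_circle_measure)

lemma measure_circle [simp]: "measure circle_measure {0..2*pi} = 2 * pi"
  by (simp add: measure_restrict_space)

lemma circle_measurable [measurable (raw)]:
  "q \<in> measurable borel N \<Longrightarrow> q \<in> measurable circle_measure N"
  by (intro measurable_restrict_space1) (simp add: measurable_completion)

lemma continuous_circle_measurable:
  fixes q :: "real \<Rightarrow> 'a :: topological_space"
  shows "continuous_on UNIV q \<Longrightarrow> q \<in> borel_measurable circle_measure"
  by (intro circle_measurable borel_measurable_continuous_onI)

lemma continuous_on_cis' [continuous_intros]:
  fixes f :: "'a :: topological_space \<Rightarrow> real"
  shows "continuous_on A f \<Longrightarrow> continuous_on A (\<lambda>x. cis (f x))"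
  unfolding cis_conv_exp by (intro continuous_intros)

lemma cis_integrable: "integrable circle_measure (\<lambda>t. cis (a * t))"
  by (rule circle.integrable_const_bound[of _ 1])
    (auto intro!: continuous_circle_measurable continuous_intros)

lemma integral_cis:
  "(LINT t|circle_measure. cis (of_int k * t)) = (if k = 0 then 2 * of_real pi else 0)"
proof (cases "k = 0")
  case True
  then show ?thesis by (simp add: scaleR_conv_of_real)
next
  case False
  have "(LINT t|circle_measure. cis (of_int k * t)) = integral {0..2*pi} (\<lambda>t. cis (of_int k * t))"
    by (rule lebesgue_integral_eq_integral) (use cis_integrable in auto)
  also have "\<dots> = 0"
  proof (rule integral_unique)
    define F where "F t = cis (of_int k * t) / (\<i> * of_int k)" for t :: real
    have "((\<lambda>t. cis (of_int k * t)) has_integral (F (2*pi) - F 0)) {0..2*pi}"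
    proof (rule fundamental_theorem_of_calculus)
      fix t :: real
      have "((\<lambda>z. exp (c * z) / c) has_field_derivative exp (c * w)) (at w)"
        if "c \<noteq> 0" for c w :: complex
        using that by (auto intro!: derivative_eq_intros)
      from has_vector_derivative_real_field[OF this, of "\<i> * of_int k" t "{0..2*pi}"] False
      show "(F has_vector_derivative cis (of_int k * t)) (at t within {0..2*pi})"
        by (simp add: F_def[abs_def] cis_conv_exp mult.assoc)
    qed simp
    moreover have "F (2*pi) = F 0"
      using cis_multiple_2pi[of "of_int k"] by (simp add: F_def mult.commute mult.left_commute)
    ultimately show "((\<lambda>t. cis (of_int k * t)) has_integral 0) {0..2*pi}" by simp
  qed
  finally show ?thesis using False by simp
qed

lemma circle_point_in_ball: "0 \<le> r \<Longrightarrow> r < 1 \<Longrightarrow> of_real r * cis t \<in> ball 0 1"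
  by (simp add: norm_mult)

lemma continuous_on_circle:
  assumes "f holomorphic_on ball 0 1" "0 \<le> r" "r < 1"
  shows "continuous_on UNIV (\<lambda>t. f (of_real r * cis t))"
  by (rule continuous_on_compose2[OF holomorphic_on_imp_continuous_on[OF assms(1)]])
    (use assms circle_point_in_ball in \<open>auto intro!: continuous_intros\<close>)

lemma continuous_circle_integrable:
  fixes q :: "real \<Rightarrow> 'a :: euclidean_space"
  assumes "continuous_on UNIV q"
  shows "integrable circle_measure q"
  by (rule continuous_imp_integrable_real) (use assms continuous_on_subset in blast)

text \<open>On a circle of radius below 1 the Taylor series is absolutely summable, uniformly in
  \<open>t\<close>, so it may be integrated termwise against \<open>q\<close>. Conjugate
  exponentials as \<open>q\<close> extract coefficients, a conjugate function as \<open>q\<close>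
  gives Parseval.\<close>

lemma circle_series:
  assumes f: "f holomorphic_on ball 0 1" and r: "0 \<le> r" "r < 1" and q: "integrable circle_measure q"
  shows "(\<lambda>n. taylor_coeff f n * of_real r ^ n * (LINT t|circle_measure. cis (real n * t) * q t))
     sums (LINT t|circle_measure. f (of_real r * cis t) * q t)"
proof -
  define F where "F n t = taylor_coeff f n * of_real r ^ n * (cis (real n * t) * q t)" for n t
  have sm: "summable (\<lambda>n. cmod (taylor_coeff f n) * r ^ n)" by (rule taylor_summable_norm[OF f r])
  have nF: "cmod (F n t) = cmod (taylor_coeff f n) * r ^ n * cmod (q t)" for n t
    using r by (simp add: F_def norm_mult norm_power)
  have qm [measurable]: "q \<in> borel_measurable circle_measure" using q by simp
  have int: "integrable circle_measure (\<lambda>t. cis (real n * t) * q t)" for n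
    by (rule Bochner_Integration.integrable_bound[OF q])
      (auto simp: norm_mult intro!: borel_measurable_times[OF continuous_circle_measurable qm] continuous_intros)
  have "(\<lambda>n. integral\<^sup>L circle_measure (F n)) sums (LINT t|circle_measure. (\<Sum>n. F n t))"
  proof (rule sums_integral)
    show "integrable circle_measure (F n)" for n
      unfolding F_def by (intro integrable_mult_right int)
    show "AE t in circle_measure. summable (\<lambda>n. cmod (F n t))"
      unfolding nF by (intro always_eventually allI summable_mult2 sm)
    show "summable (\<lambda>n. LINT t|circle_measure. cmod (F n t))"
      unfolding nF by (simp add: summable_mult2 sm)
  qed
  moreover have "(\<Sum>n. F n t) = f (of_real r * cis t) * q t" for t
  proof -
    have "(\<lambda>n. taylor_coeff f n * (of_real r * cis t) ^ n * q t) sums (f (of_real r * cis t) * q t)"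
      by (intro sums_mult2 taylor_sums f circle_point_in_ball r)
    moreover have "F n t = taylor_coeff f n * (of_real r * cis t) ^ n * q t" for n
      by (simp add: F_def power_mult_distrib Complex.DeMoivre mult.assoc)
    ultimately show ?thesis by (simp add: sums_iff)
  qed
  moreover have "integral\<^sup>L circle_measure (F n) =
      taylor_coeff f n * of_real r ^ n * (LINT t|circle_measure. cis (real n * t) * q t)" for n
    unfolding F_def by simp
  ultimately show ?thesis by simp
qed

lemma circle_coeff:
  assumes f: "f holomorphic_on ball 0 1" and r: "0 \<le> r" "r < 1"
  shows "(LINT t|circle_measure. f (of_real r * cis t) * cnj (cis (real m * t))) =
     2 * of_real pi * (taylor_coeff f m * of_real r ^ m)"
proof -
  have "(LINT t|circle_measure. cis (real n * t) * cnj (cis (real m * t))) =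
      (if n = m then 2 * of_real pi else 0)" for n
  proof -
    have "cis (real n * t) * cnj (cis (real m * t)) = cis (of_int (int n - int m) * t)" for t
      by (simp add: cis_cnj cis_mult algebra_simps)
    then show ?thesis using integral_cis[of "int n - int m"] by simp
  qed
  moreover have "integrable circle_measure (\<lambda>t. cnj (cis (real m * t)))"
    by (intro continuous_circle_integrable continuous_intros)
  ultimately have "(\<lambda>n. taylor_coeff f n * of_real r ^ n * (if n = m then 2 * of_real pi else 0))
     sums (LINT t|circle_measure. f (of_real r * cis t) * cnj (cis (real m * t)))"
    using circle_series[OF f r, of "\<lambda>t. cnj (cis (real m * t))"] by simp
  moreover have "(\<lambda>n. taylor_coeff f n * of_real r ^ n * (if n = m then 2 * of_real pi else 0))
     = (\<lambda>n. if n = m then 2 * of_real pi * (taylor_coeff f n * of_real r ^ n) else 0)"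
    by auto
  ultimately have "(\<lambda>n. if n = m then 2 * of_real pi * (taylor_coeff f n * of_real r ^ n) else 0)
     sums (LINT t|circle_measure. f (of_real r * cis t) * cnj (cis (real m * t)))" by simp
  from sums_unique2[OF this sums_single] show ?thesis .
qed

lemma circle_parseval:
  assumes f: "f holomorphic_on ball 0 1" and g: "g holomorphic_on ball 0 1" and r: "0 \<le> r" "r < 1"
  shows "(\<lambda>n. taylor_coeff f n * cnj (taylor_coeff g n) * of_real (r ^ (2 * n))) sums
     ((LINT t|circle_measure. f (of_real r * cis t) * cnj (g (of_real r * cis t))) / (2 * of_real pi))"
proof -
  have "(LINT t|circle_measure. cis (real n * t) * cnj (g (of_real r * cis t))) =
     2 * of_real pi * (cnj (taylor_coeff g n) * of_real r ^ n)" for n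
  proof -
    have "(LINT t|circle_measure. cis (real n * t) * cnj (g (of_real r * cis t))) =
       (LINT t|circle_measure. cnj (g (of_real r * cis t) * cnj (cis (real n * t))))"
      by (simp add: mult.commute)
    also have "\<dots> = cnj (LINT t|circle_measure. g (of_real r * cis t) * cnj (cis (real n * t)))"
      by (rule Bochner_Integration.integral_cnj)
    finally show ?thesis unfolding circle_coeff[OF g r] by simp
  qed
  moreover have "integrable circle_measure (\<lambda>t. cnj (g (of_real r * cis t)))"
    by (intro continuous_circle_integrable continuous_on_cnj continuous_on_circle g r)
  ultimately have "(\<lambda>n. taylor_coeff f n * of_real r ^ n * (2 * of_real pi * (cnj (taylor_coeff g n) * of_real r ^ n)))
    sums (LINT t|circle_measure. f (of_real r * cis t) * cnj (g (of_real r * cis t)))"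
    using circle_series[OF f r, of "\<lambda>t. cnj (g (of_real r * cis t))"] by simp
  from sums_divide[OF this, of "2 * of_real pi"] show ?thesis
    by (simp add: power_mult power2_eq_square power_mult_distrib mult_ac)
qed

lemma circle_parseval_norm:
  assumes f: "f holomorphic_on ball 0 1" and r: "0 \<le> r" "r < 1"
  shows "(\<lambda>n. (cmod (taylor_coeff f n))\<^sup>2 * r ^ (2 * n)) sums
     (1 / (2 * pi) * (LINT t|circle_measure. (cmod (f (of_real r * cis t)))\<^sup>2))"
proof -
  have "(LINT t|circle_measure. f (of_real r * cis t) * cnj (f (of_real r * cis t)))
      = of_real (LINT t|circle_measure. (cmod (f (of_real r * cis t)))\<^sup>2)"
    unfolding complex_norm_square[symmetric]
    by (intro integral_complex_of_real)
  with circle_parseval[OF f f r]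
  have "(\<lambda>n. of_real ((cmod (taylor_coeff f n))\<^sup>2 * r ^ (2 * n)) :: complex) sums
     of_real (1 / (2 * pi) * (LINT t|circle_measure. (cmod (f (of_real r * cis t)))\<^sup>2))"
    unfolding complex_norm_square[symmetric] by simp
  then show ?thesis unfolding sums_of_real_iff .
qed

text \<open>By Parseval the mean over the circle of radius \<open>r\<close> is the squared norm of
  the coefficients damped by \<open>r ^ n\<close>; Fatou is then applied as \<open>r\<close> tends
  to 1.\<close>

lemma l2_if_circle_bounded:
  assumes f: "f holomorphic_on ball 0 1" and C: "0 \<le> C"
    and bound: "\<And>r. 0 \<le> r \<Longrightarrow> r < 1 \<Longrightarrow>
      1 / (2 * pi) * (LINT t|circle_measure. (cmod (f (of_real r * cis t)))\<^sup>2) \<le> C\<^sup>2"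
  shows "taylor_coeff f \<in> l2" "l2_norm (taylor_coeff f) \<le> C"
proof -
  define s where "s r n = taylor_coeff f n * of_real r ^ n" for r :: real and n
  have lim: "((\<lambda>r. s r n) \<longlongrightarrow> taylor_coeff f n) (at_left 1)" for n
    unfolding s_def by (auto intro!: tendsto_eq_intros)
  have ev: "eventually (\<lambda>r. r \<in> {0<..<1::real}) (at_left 1)"
    by (rule eventually_at_left_field[THEN iffD2]) (auto intro!: exI[of _ 0])
  have "eventually (\<lambda>r. s r \<in> l2 \<and> l2_norm (s r) \<le> C) (at_left 1)"
    using ev
  proof eventually_elim
    case (elim r)
    then have r: "0 \<le> r" "r < 1" by auto
    have sq: "(cmod (s r n))\<^sup>2 = (cmod (taylor_coeff f n))\<^sup>2 * r ^ (2 * n)" for n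
      using r by (simp add: s_def norm_mult norm_power power_mult_distrib power_mult mult.commute)
    have S: "(\<lambda>n. (cmod (s r n))\<^sup>2) sums
       (1 / (2 * pi) * (LINT t|circle_measure. (cmod (f (of_real r * cis t)))\<^sup>2))"
      unfolding sq by (rule circle_parseval_norm[OF f r])
    then have "s r \<in> l2" by (simp add: l2_def sums_iff)
    moreover from this have "(l2_norm (s r))\<^sup>2 \<le> C\<^sup>2"
      using S bound[OF r] by (simp add: l2_norm_sq sums_iff)
    ultimately show ?case using C power2_le_imp_le by blast
  qed
  from l2_fatou[OF lim _ this] show "taylor_coeff f \<in> l2" "l2_norm (taylor_coeff f) \<le> C" by auto
qed

lemma circle_bounded_if_l2:
  assumes f: "f holomorphic_on ball 0 1" and l: "taylor_coeff f \<in> l2" and r: "0 \<le> r" "r < 1"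
  shows "1 / (2 * pi) * (LINT t|circle_measure. (cmod (f (of_real r * cis t)))\<^sup>2) \<le> (l2_norm (taylor_coeff f))\<^sup>2"
proof -
  have "(cmod (taylor_coeff f n))\<^sup>2 * r ^ (2 * n) \<le> (cmod (taylor_coeff f n))\<^sup>2" for n
    using r by (simp add: mult_left_le power_le_one)
  moreover have "(\<lambda>n. (cmod (taylor_coeff f n))\<^sup>2) sums (l2_norm (taylor_coeff f))\<^sup>2"
    using l by (simp add: l2_norm_sq) (simp add: l2_def summable_sums)
  ultimately show ?thesis by (rule sums_le[OF _ circle_parseval_norm[OF f r]])
qed

text \<open>For \<open>f\<close> with coefficients \<open>h\<close>, the sequence
  \<open>conv (taylor_coeff u) h\<close> belongs to the product \<open>u f\<close>. The bound is
  immediate for means over circles, and these are equivalent to \<open>l2\<close> norms.\<close>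

lemma multiplier_bounded:
  assumes u: "u holomorphic_on ball 0 1" and M: "\<And>z. z \<in> ball 0 1 \<Longrightarrow> cmod (u z) \<le> M"
  shows "multiplier (taylor_coeff u) M"
proof -
  have M0: "0 \<le> M" using M[of 0] by (simp add: order_trans[OF norm_ge_zero])
  have "conv (taylor_coeff u) h \<in> l2 \<and> l2_norm (conv (taylor_coeff u) h) \<le> M * l2_norm h" if h: "h \<in> l2" for h
  proof -
    obtain f where f: "f holomorphic_on ball 0 1" and fh: "taylor_coeff f = h"
      using l2_holomorphic_extension[OF h] .
    have uf: "(\<lambda>z. u z * f z) holomorphic_on ball 0 1" by (intro holomorphic_intros u f)
    have "1 / (2 * pi) * (LINT t|circle_measure. (cmod (u (of_real r * cis t) * f (of_real r * cis t)))\<^sup>2)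
        \<le> (M * l2_norm h)\<^sup>2" if r: "0 \<le> r" "r < 1" for r
    proof -
      have "(LINT t|circle_measure. (cmod (u (of_real r * cis t) * f (of_real r * cis t)))\<^sup>2)
         \<le> (LINT t|circle_measure. M\<^sup>2 * (cmod (f (of_real r * cis t)))\<^sup>2)"
      proof (rule integral_mono)
        show "integrable circle_measure (\<lambda>t. (cmod (u (of_real r * cis t) * f (of_real r * cis t)))\<^sup>2)"
          "integrable circle_measure (\<lambda>t. M\<^sup>2 * (cmod (f (of_real r * cis t)))\<^sup>2)"
          by (intro continuous_circle_integrable continuous_intros continuous_on_circle u f r)+
        show "(cmod (u (of_real r * cis t) * f (of_real r * cis t)))\<^sup>2 \<le> M\<^sup>2 * (cmod (f (of_real r * cis t)))\<^sup>2" for t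
          unfolding norm_mult power_mult_distrib
          by (intro mult_right_mono power_mono M circle_point_in_ball r) auto
      qed
      also have "\<dots> = M\<^sup>2 * (LINT t|circle_measure. (cmod (f (of_real r * cis t)))\<^sup>2)" by simp
      finally have "1 / (2 * pi) * (LINT t|circle_measure. (cmod (u (of_real r * cis t) * f (of_real r * cis t)))\<^sup>2)
          \<le> M\<^sup>2 * (1 / (2 * pi) * (LINT t|circle_measure. (cmod (f (of_real r * cis t)))\<^sup>2))"
        by (simp add: divide_right_mono)
      also have "\<dots> \<le> M\<^sup>2 * (l2_norm h)\<^sup>2"
        using circle_bounded_if_l2[OF f _ r] h fh by (intro mult_left_mono) auto
      finally show ?thesis by (simp add: power_mult_distrib)
    qed
    from l2_if_circle_bounded[OF uf _ this] show ?thesis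
      using M0 l2.norm_nonneg[OF h] taylor_coeff_mult[OF u f] fh by auto
  qed
  moreover have "taylor_coeff u \<in> l2"
  proof (rule l2_if_circle_bounded(1)[OF u M0])
    fix r :: real assume r: "0 \<le> r" "r < 1"
    have "(LINT t|circle_measure. (cmod (u (of_real r * cis t)))\<^sup>2) \<le> (LINT t|circle_measure. M\<^sup>2)"
      by (intro integral_mono continuous_circle_integrable continuous_intros continuous_on_circle u r
          power_mono M circle_point_in_ball) auto
    also have "\<dots> = (2 * pi) * M\<^sup>2" by simp
    finally show "1 / (2 * pi) * (LINT t|circle_measure. (cmod (u (of_real r * cis t)))\<^sup>2) \<le> M\<^sup>2"
      by (simp add: pos_divide_le_eq mult_ac)
  qed
  ultimately show ?thesis using M0 by (simp add: multiplier_def)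
qed

text \<open>Parseval at radius \<open>r n\<close> damps the term of index \<open>k\<close> by
  \<open>r n ^ (2 * k)\<close>; Tannery's theorem applies with the undamped absolutely convergent
  series as majorant.\<close>

lemma circle_ip_limit:
  assumes f: "f holomorphic_on ball 0 1" "taylor_coeff f \<in> l2"
    and g: "g holomorphic_on ball 0 1" "taylor_coeff g \<in> l2"
    and r: "\<And>n. 0 \<le> r n" "\<And>n. r n < 1" "r \<longlonglongrightarrow> 1"
  shows "(\<lambda>n::nat. LINT t|circle_measure. f (of_real (r n) * cis t) * cnj (g (of_real (r n) * cis t)))
     \<longlonglongrightarrow> 2 * of_real pi * l2_ip (taylor_coeff f) (taylor_coeff g)"
proof -
  define a where "a k n = taylor_coeff f k * cnj (taylor_coeff g k) * of_real (r n ^ (2 * k))" for k n :: nat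
  have "(\<lambda>n. \<Sum>k. a k n) \<longlonglongrightarrow> (\<Sum>k. taylor_coeff f k * cnj (taylor_coeff g k))"
  proof (rule tannerys_theorem[THEN conjunct2, THEN conjunct2])
    show "(\<lambda>n. a k n) \<longlonglongrightarrow> taylor_coeff f k * cnj (taylor_coeff g k)" for k
      unfolding a_def using r(3) by (auto intro!: tendsto_eq_intros)
    show "summable (\<lambda>k. norm (taylor_coeff f k * cnj (taylor_coeff g k)))"
      by (rule l2_ip_summable_norm[OF f(2) g(2)])
    have "norm (a k n) \<le> norm (taylor_coeff f k * cnj (taylor_coeff g k))" for k n
      using r(1)[of n] r(2)[of n] unfolding a_def norm_mult
      by (simp add: norm_power mult_left_le power_le_one)
    then show "eventually (\<lambda>(k, n). norm (a k n) \<le> norm (taylor_coeff f k * cnj (taylor_coeff g k))) (at_top \<times>\<^sub>F sequentially)"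
      by (intro always_eventually) auto
  qed simp
  moreover have "(\<Sum>k. a k n) = (LINT t|circle_measure. f (of_real (r n) * cis t) * cnj (g (of_real (r n) * cis t))) / (2 * of_real pi)" for n
    unfolding a_def by (rule sums_unique[symmetric, OF circle_parseval[OF f(1) g(1) r(1,2)]])
  ultimately have "(\<lambda>n. (LINT t|circle_measure. f (of_real (r n) * cis t) * cnj (g (of_real (r n) * cis t))) / (2 * of_real pi))
     \<longlonglongrightarrow> l2_ip (taylor_coeff f) (taylor_coeff g)" by (simp add: l2_ip_def)
  from tendsto_mult_left[OF this, of "2 * of_real pi"] show ?thesis by simp
qed

lemma hardy_2_l2:
  assumes "f \<in> hardy 2"
  shows "f holomorphic_on ball 0 1" "taylor_coeff f \<in> l2"
proof -
  show f: "f holomorphic_on ball 0 1" using assms by (simp add: hardy_def)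
  obtain C where C: "\<And>r. 0 \<le> r \<Longrightarrow> r < 1 \<Longrightarrow>
     1 / (2*pi) * (LINT t|circle_measure. cmod (f (complex_of_real r * cis t)) powr 2) \<le> C"
    using assms unfolding hardy_def bdd_above_def by fastforce
  have "C \<ge> 0" by (rule order_trans[OF _ C[of 0]]) auto
  show "taylor_coeff f \<in> l2"
    by (rule l2_if_circle_bounded(1)[OF f, of "sqrt C"]) (use C \<open>C \<ge> 0\<close> in auto)
qed

subsection \<open>Poisson integrals\<close>

text \<open>Written as the real part of the Herglotz kernel because that kernel occurs in
  \<open>outer\<close>: the logarithm of the modulus of an outer function is then a Poisson
  integral.\<close>

definition poisson :: "complex \<Rightarrow> real \<Rightarrow> real" where
  "poisson z t = Re ((cis t + z) / (cis t - z))"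

definition poisson_integral :: "(real \<Rightarrow> real) \<Rightarrow> complex \<Rightarrow> real" where
  "poisson_integral k z = 1 / (2 * pi) * (LINT t|circle_measure. poisson z t * k t)"

lemma cis_minus_bound: "1 - cmod z \<le> cmod (cis t - z)"
  using norm_triangle_ineq2[of "cis t" z] by simp

lemma cis_minus_nonzero: "z \<in> ball 0 1 \<Longrightarrow> cis t - z \<noteq> 0"
  using cis_minus_bound[of z t] by auto

lemma poisson_eq: "z \<in> ball 0 1 \<Longrightarrow> poisson z t = (1 - (cmod z)\<^sup>2) / (cmod (cis t - z))\<^sup>2"
proof -
  have "(cis t + z) / (cis t - z) = (cis t + z) * cnj (cis t - z) / of_real ((cmod (cis t - z))\<^sup>2)"
    by (subst complex_div_cnj) simp
  then have "poisson z t = Re ((cis t + z) * cnj (cis t - z)) / (cmod (cis t - z))\<^sup>2"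
    unfolding poisson_def by (simp only: Re_divide_of_real)
  also have "Re ((cis t + z) * cnj (cis t - z)) = ((cos t)\<^sup>2 + (sin t)\<^sup>2) - (cmod z)\<^sup>2"
    unfolding cmod_power2 by (simp add: algebra_simps power2_eq_square)
  finally show ?thesis by simp
qed

lemma poisson_pos: "z \<in> ball 0 1 \<Longrightarrow> 0 < poisson z t"
  using cis_minus_nonzero[of z t] by (simp add: poisson_eq power_less_one_iff abs_square_less_1)

lemma herglotz_bound:
  assumes "z \<in> ball 0 1"
  shows "cmod ((cis t + z) / (cis t - z)) \<le> 2 / (1 - cmod z)"
  unfolding norm_divide
proof (rule frac_le)
  show "cmod (cis t + z) \<le> 2" using norm_triangle_ineq[of "cis t" z] assms by simp
qed (use cis_minus_bound[of z t] assms in auto)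

lemma herglotz_continuous: "z \<in> ball 0 1 \<Longrightarrow> continuous_on UNIV (\<lambda>t. (cis t + z) / (cis t - z))"
  using cis_minus_nonzero by (intro continuous_intros) auto

lemma poisson_continuous: "z \<in> ball 0 1 \<Longrightarrow> continuous_on UNIV (poisson z)"
  unfolding poisson_def[abs_def] by (intro continuous_on_Re herglotz_continuous)

lemma herglotz_integrable:
  assumes "z \<in> ball 0 1" and k: "integrable circle_measure k"
  shows "integrable circle_measure (\<lambda>t. (cis t + z) / (cis t - z) * complex_of_real (k t))"
proof (rule Bochner_Integration.integrable_bound)
  show "integrable circle_measure (\<lambda>t. 2 / (1 - cmod z) * k t)" using k by simp
  show "(\<lambda>t. (cis t + z) / (cis t - z) * complex_of_real (k t)) \<in> borel_measurable circle_measure"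
    using k by (intro borel_measurable_times continuous_circle_measurable[OF herglotz_continuous] assms) simp
  show "AE t in circle_measure. norm ((cis t + z) / (cis t - z) * complex_of_real (k t)) \<le> norm (2 / (1 - cmod z) * k t)"
  proof (rule AE_I2)
    fix t
    have "cmod ((cis t + z) / (cis t - z)) * \<bar>k t\<bar> \<le> 2 / (1 - cmod z) * \<bar>k t\<bar>"
      by (intro mult_right_mono herglotz_bound assms) simp
    also have "2 / (1 - cmod z) = \<bar>2 / (1 - cmod z)\<bar>" using assms by simp
    finally show "norm ((cis t + z) / (cis t - z) * complex_of_real (k t)) \<le> norm (2 / (1 - cmod z) * k t)"
      unfolding norm_mult norm_of_real real_norm_def abs_mult .
  qed
qed

lemma herglotz_Re: "poisson z t * k t = Re ((cis t + z) / (cis t - z) * complex_of_real (k t))"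
  unfolding poisson_def by (simp del: times_divide_eq_left)

lemma poisson_integrable:
  "z \<in> ball 0 1 \<Longrightarrow> integrable circle_measure k \<Longrightarrow> integrable circle_measure (\<lambda>t. poisson z t * k t)"
  unfolding herglotz_Re by (intro integrable_Re herglotz_integrable)

text \<open>With \<open>w = z * cis (-t)\<close> the kernel is
  \<open>(1 + w) / (1 - w) = 2 / (1 - w) - 1\<close>, twice a geometric series with the constant
  term corrected.\<close>

lemma herglotz_series: "z \<in> ball 0 1 \<Longrightarrow>
  (\<lambda>n. (if n = 0 then 1 else 2) * z ^ n * cis (- real n * t)) sums ((cis t + z) / (cis t - z))"
proof -
  assume z: "z \<in> ball 0 1"
  define w where "w = z * cis (-t)"
  have w: "cmod w < 1" using z by (simp add: w_def norm_mult)
  then have w1: "1 - w \<noteq> 0" by auto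
  have cw: "cis t * w = z" by (simp add: w_def cis_mult mult.left_commute)
  have "(\<lambda>n. 2 * w ^ n - (if n = 0 then 1 else 0)) sums (2 * (1 / (1 - w)) - 1)"
    by (intro sums_diff sums_mult geometric_sums sums_single[of 0 "\<lambda>_. 1", simplified]) (use w in auto)
  moreover have "2 * (1 / (1 - w)) - 1 = (cis t + z) / (cis t - z)"
  proof -
    have "(cis t + z) / (cis t - z) = (cis t * (1 + w)) / (cis t * (1 - w))"
      by (simp only: distrib_left right_diff_distrib mult_1_right cw)
    also have "\<dots> = (1 + w) / (1 - w)" by simp
    finally show ?thesis using w1 by (simp add: field_simps)
  qed
  moreover have "2 * w ^ n - (if n = 0 then 1 else 0) = (if n = 0 then 1 else 2) * z ^ n * cis (- real n * t)" for n
    by (simp add: w_def power_mult_distrib Complex.DeMoivre)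
  ultimately show ?thesis by simp
qed

text \<open>Termwise integration of the kernel's expansion in powers of \<open>z\<close> exhibits
  the integral as a power series that converges on the disk.\<close>

lemma herglotz_holomorphic:
  assumes k: "integrable circle_measure k"
  shows "(\<lambda>z. LINT t|circle_measure. (cis t + z) / (cis t - z) * complex_of_real (k t)) holomorphic_on ball 0 1"
proof (rule power_series_taylor(1))
  fix z :: complex assume z: "z \<in> ball 0 1"
  define d :: "nat \<Rightarrow> complex" where "d n = (if n = 0 then 1 else 2)" for n
  define F where "F n t = d n * z ^ n * (cis (- real n * t) * complex_of_real (k t))" for n t
  have km [measurable]: "k \<in> borel_measurable circle_measure" using k by simp
  have int: "integrable circle_measure (\<lambda>t. cis (- real n * t) * complex_of_real (k t))" for n
    by (rule Bochner_Integration.integrable_bound[OF k])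
      (auto simp: norm_mult intro!: borel_measurable_times[OF continuous_circle_measurable] continuous_intros)
  have nF: "cmod (F n t) = cmod (d n) * cmod z ^ n * \<bar>k t\<bar>" for n t
    by (simp add: F_def norm_mult norm_power)
  have sm: "summable (\<lambda>n. cmod (d n) * cmod z ^ n)"
  proof (rule summable_comparison_test'[where N = 0])
    show "summable (\<lambda>n. 2 * cmod z ^ n)" using z by (intro summable_mult summable_geometric) auto
  qed (auto simp: d_def)
  have "(\<lambda>n. integral\<^sup>L circle_measure (F n)) sums (LINT t|circle_measure. (\<Sum>n. F n t))"
  proof (rule sums_integral)
    show "integrable circle_measure (F n)" for n
      unfolding F_def by (intro integrable_mult_right int)
    show "AE t in circle_measure. summable (\<lambda>n. cmod (F n t))"
      unfolding nF by (intro always_eventually allI summable_mult2 sm)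
    show "summable (\<lambda>n. LINT t|circle_measure. cmod (F n t))"
      unfolding nF by (simp add: summable_mult2 sm)
  qed
  moreover have "(\<Sum>n. F n t) = (cis t + z) / (cis t - z) * complex_of_real (k t)" for t
    using sums_mult2[OF herglotz_series[OF z], of t "complex_of_real (k t)"]
    unfolding F_def d_def by (simp add: sums_iff mult.assoc)
  moreover have "integral\<^sup>L circle_measure (F n) =
      d n * (LINT t|circle_measure. cis (- real n * t) * complex_of_real (k t)) * z ^ n" for n
    unfolding F_def by simp
  ultimately show "(\<lambda>n. ((if n = 0 then 1 else 2) * (LINT t|circle_measure. cis (- real n * t) * complex_of_real (k t))) * z ^ n)
     sums (LINT t|circle_measure. (cis t + z) / (cis t - z) * complex_of_real (k t))"
    unfolding d_def by simp
qed

lemma outer_holomorphic: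
  assumes "outer f"
  shows "f holomorphic_on ball 0 1"
proof -
  obtain c k where k: "integrable circle_measure (k :: real \<Rightarrow> real)" and
    f: "\<forall>z\<in>ball 0 1. f z = c * exp (1 / (2 * complex_of_real pi) *
        (LINT t|circle_measure. (cis t + z) / (cis t - z) * complex_of_real (k t)))"
    using assms unfolding outer_def by blast
  have "(\<lambda>z. c * exp (1 / (2 * complex_of_real pi) *
        (LINT t|circle_measure. (cis t + z) / (cis t - z) * complex_of_real (k t)))) holomorphic_on ball 0 1"
    by (intro holomorphic_intros herglotz_holomorphic[OF k])
  then show ?thesis by (rule holomorphic_transform) (use f in auto)
qed

lemma outer_modulus:
  assumes "outer f"
  obtains k where "integrable circle_measure (k :: real \<Rightarrow> real)"
    "\<And>z. z \<in> ball 0 1 \<Longrightarrow> cmod (f z) = exp (poisson_integral k z)"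
proof -
  obtain c k where c: "cmod c = 1" and k: "integrable circle_measure (k :: real \<Rightarrow> real)" and
    f: "\<forall>z\<in>ball 0 1. f z = c * exp (1 / (2 * complex_of_real pi) *
        (LINT t|circle_measure. (cis t + z) / (cis t - z) * complex_of_real (k t)))"
    using assms unfolding outer_def by blast
  have "cmod (f z) = exp (poisson_integral k z)" if z: "z \<in> ball 0 1" for z
  proof -
    let ?I = "LINT t|circle_measure. (cis t + z) / (cis t - z) * complex_of_real (k t)"
    have "1 / (2 * complex_of_real pi) * ?I = of_real (1 / (2 * pi)) * ?I" by simp
    then have "Re (1 / (2 * complex_of_real pi) * ?I) = 1 / (2 * pi) * Re ?I"
      by (simp only: times_complex.sel Re_complex_of_real Im_complex_of_real mult_zero_left diff_zero)
    also have "Re ?I = (LINT t|circle_measure. poisson z t * k t)"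
      unfolding herglotz_Re by (rule integral_Re[symmetric, OF herglotz_integrable[OF z k]])
    finally show ?thesis using f z c by (simp add: norm_mult poisson_integral_def)
  qed
  with k show ?thesis using that by blast
qed

text \<open>The distance from \<open>cis t\<close> to \<open>r * cis s\<close> is symmetric in
  \<open>s\<close> and \<open>t\<close>. This lets averages over the point be exchanged with
  averages over the boundary variable.\<close>

lemma poisson_commute:
  assumes "0 \<le> r" "r < 1"
  shows "poisson (of_real r * cis s) t = poisson (of_real r * cis t) s"
proof -
  have *: "(cmod (cis x - of_real r * cis y))\<^sup>2 = 1 + r\<^sup>2 - 2 * r * (cos x * cos y + sin x * sin y)" for x y
  proof -
    have "(cmod (cis x - of_real r * cis y))\<^sup>2 = (cos x - r * cos y)\<^sup>2 + (sin x - r * sin y)\<^sup>2"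
      by (simp add: cmod_power2)
    also have "\<dots> = ((cos x)\<^sup>2 + (sin x)\<^sup>2) + r\<^sup>2 * ((cos y)\<^sup>2 + (sin y)\<^sup>2) - 2 * r * (cos x * cos y + sin x * sin y)"
      by (simp only: power2_diff power_mult_distrib) (simp add: algebra_simps del: sin_cos_squared_add sin_cos_squared_add2)
    finally show ?thesis by simp
  qed
  show ?thesis using assms unfolding poisson_eq[OF circle_point_in_ball[OF assms]] * 
    by (simp add: norm_mult mult.commute)
qed

text \<open>As a function of the point, the Herglotz kernel is holomorphic with value 1 at the
  origin, so the mean value property applies on the circle of radius \<open>r\<close>.\<close>

lemma poisson_mean:
  assumes "0 \<le> r" "r < 1"
  shows "(LINT s|circle_measure. poisson (of_real r * cis s) t) = 2 * pi"
proof -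
  have hol: "(\<lambda>z. (cis t + z) / (cis t - z)) holomorphic_on ball 0 1"
    by (intro holomorphic_intros) (use cis_minus_nonzero in auto)
  have "(LINT s|circle_measure. (cis t + of_real r * cis s) / (cis t - of_real r * cis s)) = 2 * of_real pi"
    using circle_coeff[OF hol assms, of 0] by (simp add: taylor_coeff_0[OF hol])
  moreover have "integrable circle_measure (\<lambda>s. (cis t + of_real r * cis s) / (cis t - of_real r * cis s))"
    using continuous_on_circle[OF hol assms] by (rule continuous_circle_integrable)
  ultimately show ?thesis
    unfolding poisson_def using integral_Re by fastforce
qed

lemma poisson_mean': "0 \<le> r \<Longrightarrow> r < 1 \<Longrightarrow> (LINT t|circle_measure. poisson (of_real r * cis s) t) = 2 * pi"
  by (subst poisson_commute) (auto simp: poisson_mean)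

lemma poisson_mean_ball:
  assumes "z \<in> ball 0 1"
  shows "(LINT t|circle_measure. poisson z t) = 2 * pi"
proof -
  have "z = of_real (cmod z) * cis (Arg z)" by (metis rcis_cmod_Arg rcis_def)
  then show ?thesis using poisson_mean'[of "cmod z" "Arg z"] assms by simp
qed

lemma poisson_integral_const: "z \<in> ball 0 1 \<Longrightarrow> poisson_integral (\<lambda>t. c) z = c"
  by (simp add: poisson_integral_def poisson_mean_ball)

lemma poisson_integral_mono:
  assumes "z \<in> ball 0 1" "integrable circle_measure k" "integrable circle_measure l"
    and "AE t in circle_measure. k t \<le> l t"
  shows "poisson_integral k z \<le> poisson_integral l z"
  unfolding poisson_integral_def
proof (intro mult_left_mono integral_mono_AE poisson_integrable assms)
  show "AE t in circle_measure. poisson z t * k t \<le> poisson z t * l t"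
    using assms(4) by eventually_elim (intro mult_left_mono less_imp_le[OF poisson_pos[OF assms(1)]])
qed simp

lemma poisson_integral_diff:
  assumes "z \<in> ball 0 1" "integrable circle_measure k" "integrable circle_measure l"
  shows "poisson_integral (\<lambda>t. k t - l t) z = poisson_integral k z - poisson_integral l z"
  unfolding poisson_integral_def using poisson_integrable[OF assms(1)] assms(2,3)
  by (simp add: right_diff_distrib diff_divide_distrib)

lemma poisson_integral_add:
  assumes "z \<in> ball 0 1" "integrable circle_measure k" "integrable circle_measure l"
  shows "poisson_integral (\<lambda>t. k t + l t) z = poisson_integral k z + poisson_integral l z"
  unfolding poisson_integral_def using poisson_integrable[OF assms(1)] assms(2,3)
  by (simp add: distrib_left add_divide_distrib)

lemma poisson_integral_scale: "poisson_integral (\<lambda>t. k t * c) z = poisson_integral k z * c"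
  unfolding poisson_integral_def by (simp add: mult.assoc[symmetric])

lemma poisson_integral_0: "poisson_integral k 0 = 1 / (2 * pi) * (LINT t|circle_measure. k t)"
  by (simp add: poisson_integral_def poisson_def)

section \<open>Averages of Poisson integrals over circles\<close>

interpretation circle_pair: pair_sigma_finite circle_measure circle_measure ..

lemma cis_measurable_circle [measurable]: "cis \<in> borel_measurable circle_measure"
  by (intro continuous_circle_measurable continuous_on_cis' continuous_on_id)

text \<open>The kernel is positive, so integrating the absolute value over \<open>s\<close> leaves
  \<open>2 * pi * \<bar>k t\<bar>\<close>, which is integrable in \<open>t\<close>.\<close>

lemma poisson_product_integrable:
  assumes r: "0 \<le> r" "r < 1" and k: "integrable circle_measure k"
  shows "integrable (circle_measure \<Otimes>\<^sub>M circle_measure) (\<lambda>(t, s). poisson (of_real r * cis s) t * k t)"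
proof (rule circle_pair.Fubini_integrable)
  have [measurable]: "k \<in> borel_measurable circle_measure" using k by simp
  show "(\<lambda>(t, s). poisson (of_real r * cis s) t * k t) \<in> borel_measurable (circle_measure \<Otimes>\<^sub>M circle_measure)"
    unfolding poisson_def by measurable
  have "(LINT s|circle_measure. norm (poisson (of_real r * cis s) t * k t)) = 2 * pi * \<bar>k t\<bar>" for t
  proof -
    have "(LINT s|circle_measure. norm (poisson (of_real r * cis s) t * k t))
        = (LINT s|circle_measure. poisson (of_real r * cis s) t * \<bar>k t\<bar>)"
      using poisson_pos[OF circle_point_in_ball[OF r]] by (simp add: abs_mult less_imp_le)
    then show ?thesis by (simp add: poisson_mean[OF r])
  qed
  then show "integrable circle_measure (\<lambda>t. LINT s|circle_measure. norm (case (t, s) of (t, s) \<Rightarrow> poisson (of_real r * cis s) t * k t))"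
    using k by simp
  have "integrable circle_measure (\<lambda>s. poisson (of_real r * cis s) t * k t)" for t
    unfolding poisson_commute[OF r, of _ t]
    by (intro integrable_mult_left continuous_circle_integrable poisson_continuous circle_point_in_ball r)
  then show "AE t in circle_measure. integrable circle_measure (\<lambda>s. case (t, s) of (t, s) \<Rightarrow> poisson (of_real r * cis s) t * k t)"
    by simp
qed

lemma poisson_integral_circle:
  assumes r: "0 \<le> r" "r < 1" and k: "integrable circle_measure k"
  shows "integrable circle_measure (\<lambda>s. poisson_integral k (of_real r * cis s))"
    and "(LINT s|circle_measure. poisson_integral k (of_real r * cis s)) = (LINT t|circle_measure. k t)"
proof -
  note P = poisson_product_integrable[OF r k]
  show "integrable circle_measure (\<lambda>s. poisson_integral k (of_real r * cis s))"
    unfolding poisson_integral_def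
    by (intro integrable_mult_right circle_pair.integrable_snd[OF P])
  have "(LINT s|circle_measure. (LINT t|circle_measure. poisson (of_real r * cis s) t * k t))
     = (LINT t|circle_measure. (LINT s|circle_measure. poisson (of_real r * cis s) t * k t))"
    by (rule circle_pair.Fubini_integral[OF P])
  also have "\<dots> = 2 * pi * (LINT t|circle_measure. k t)" by (simp add: poisson_mean[OF r])
  finally show "(LINT s|circle_measure. poisson_integral k (of_real r * cis s)) = (LINT t|circle_measure. k t)"
    by (simp add: poisson_integral_def)
qed

text \<open>Positivity of the kernel bounds the modulus of the Poisson integral by that of
  \<open>\<bar>k\<bar>\<close>, whose integral over a circle equals the integral of
  \<open>\<bar>k\<bar>\<close>.\<close>

lemma poisson_integral_L1:
  assumes r: "0 \<le> r" "r < 1" and k: "integrable circle_measure k"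
  shows "(LINT s|circle_measure. \<bar>poisson_integral k (of_real r * cis s)\<bar>) \<le> (LINT t|circle_measure. \<bar>k t\<bar>)"
proof -
  have ak: "integrable circle_measure (\<lambda>t. \<bar>k t\<bar>)" using k by simp
  have "\<bar>poisson_integral k z\<bar> \<le> poisson_integral (\<lambda>t. \<bar>k t\<bar>) z" if "z \<in> ball 0 1" for z
  proof -
    have "\<bar>LINT t|circle_measure. poisson z t * k t\<bar> \<le> (LINT t|circle_measure. \<bar>poisson z t * k t\<bar>)"
      using integral_norm_bound[of circle_measure "\<lambda>t. poisson z t * k t"] by simp
    also have "\<dots> = (LINT t|circle_measure. poisson z t * \<bar>k t\<bar>)"
      using poisson_pos[OF that] by (simp add: abs_mult less_imp_le)
    finally show ?thesis by (simp add: poisson_integral_def abs_mult divide_right_mono)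
  qed
  then have b: "\<bar>poisson_integral k (of_real r * cis s)\<bar> \<le> poisson_integral (\<lambda>t. \<bar>k t\<bar>) (of_real r * cis s)" for s
    using circle_point_in_ball[OF r] by blast
  have "(LINT s|circle_measure. \<bar>poisson_integral k (of_real r * cis s)\<bar>)
      \<le> (LINT s|circle_measure. poisson_integral (\<lambda>t. \<bar>k t\<bar>) (of_real r * cis s))"
    by (intro integral_mono integrable_abs poisson_integral_circle(1) r k ak b)
  also have "\<dots> = (LINT t|circle_measure. \<bar>k t\<bar>)" by (rule poisson_integral_circle(2)[OF r ak])
  finally show ?thesis .
qed

subsection \<open>Boundary values of outer functions\<close>

text \<open>Fixed radii tending to 1, taken as a sequence so that dominated convergence and the
  extraction of a.e. convergent subsequences apply.\<close>

definition rad :: "nat \<Rightarrow> real" where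
  "rad n = 1 - 1 / real (Suc n)"

lemma rad_bounds: "0 \<le> rad n" "rad n < 1"
  by (auto simp: rad_def field_simps)

lemma rad_tendsto: "rad \<longlonglongrightarrow> 1"
  unfolding rad_def[abs_def]
  using tendsto_diff[OF tendsto_const LIMSEQ_inverse_real_of_nat, of 1] by (simp add: inverse_eq_divide)

lemma rad_filterlim: "filterlim rad (at_left 1) sequentially"
  using rad_tendsto rad_bounds(2) unfolding filterlim_at by (auto intro!: always_eventually less_imp_neq)

lemma rad_ball: "of_real (rad n) * cis s \<in> ball 0 1"
  by (rule circle_point_in_ball[OF rad_bounds])

text \<open>The property propagated from open sets to measurable sets and then to all integrable
  functions.\<close>

definition poisson_L1 :: "(real \<Rightarrow> real) \<Rightarrow> bool" where
  "poisson_L1 k \<longleftrightarrow> integrable circle_measure k \<and>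
     (\<lambda>n. LINT s|circle_measure. \<bar>poisson_integral k (of_real (rad n) * cis s) - k s\<bar>) \<longlonglongrightarrow> 0"

text \<open>Replacing \<open>cis s\<close> by \<open>r * cis s\<close> costs \<open>1 - r\<close>,
  which is itself at most the distance from \<open>cis t\<close> to \<open>r * cis s\<close>. That
  distance is therefore at least \<open>d / 2\<close>, whence the factor 4.\<close>

lemma poisson_away:
  assumes d: "d > 0" "d \<le> cmod (cis t - cis s)" and r: "0 \<le> r" "r < 1"
  shows "poisson (of_real r * cis s) t \<le> 4 * (1 - r\<^sup>2) / d\<^sup>2"
proof -
  let ?D = "cmod (cis t - of_real r * cis s)"
  have "cis t - cis s = (cis t - of_real r * cis s) - of_real (1 - r) * cis s"
    by (simp add: algebra_simps)
  then have "cmod (cis t - cis s) \<le> ?D + cmod (of_real (1 - r) * cis s)"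
    using norm_triangle_ineq4 by metis
  also have "cmod (of_real (1 - r) * cis s) = 1 - r" using r by (simp add: norm_mult del: of_real_diff)
  also have "1 - r \<le> ?D" using cis_minus_bound[of "of_real r * cis s" t] r by (simp add: norm_mult)
  finally have "d / 2 \<le> ?D" using d by simp
  then have "(d / 2)\<^sup>2 \<le> ?D\<^sup>2" using d by (intro power_mono) auto
  then have "(1 - r\<^sup>2) / ?D\<^sup>2 \<le> (1 - r\<^sup>2) / (d / 2)\<^sup>2"
    using d r by (intro divide_left_mono) (auto simp: power_le_one zero_less_power2 intro!: mult_pos_pos elim: order_less_le_trans[rotated])
  then show ?thesis
    unfolding poisson_eq[OF circle_point_in_ball[OF r]] using r by (simp add: norm_mult power_divide mult.commute)
qed

text \<open>The parameters 0 and \<open>2 * pi\<close> name the same point of the circle, so one of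
  the two parameters is kept off the endpoints.\<close>

lemma cis_inj_interior:
  assumes "s \<in> {0<..<2*pi}" "t \<in> {0..2*pi}" "cis t = cis s"
  shows "t = s"
proof -
  have "sin t = sin s" "cos t = cos s" using assms(3) by (auto simp: complex_eq_iff)
  then obtain m :: int where "t = s + 2 * pi * m" using sin_cos_eq_iff by metis
  then have e: "2 * pi * of_int m = t - s" by simp
  have "2 * pi * of_int m < 2 * pi * 1"
    unfolding e using assms(1,2) by auto
  then have "of_int m < (1::real)" by (rule mult_left_less_imp_less) simp
  moreover have "2 * pi * (-1) < 2 * pi * of_int m"
    unfolding e using assms(1,2) by auto
  then have "-1 < (of_int m :: real)" by (rule mult_left_less_imp_less) simp
  ultimately have "m = 0" by linarith
  then show ?thesis using \<open>t = s + 2 * pi * m\<close> by simp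
qed

text \<open>The part of the parameter interval outside \<open>T\<close> is compact, so its image
  keeps a positive distance \<open>d\<close> from \<open>cis s\<close>. There the kernel tends to
  zero uniformly, hence so does the mass that it puts outside \<open>T\<close>.\<close>

lemma open_set_poisson_tendsto:
  assumes T: "open T" and s: "s \<in> T" "s \<in> {0<..<2*pi}"
  shows "(\<lambda>n. poisson_integral (indicator T) (of_real (rad n) * cis s)) \<longlonglongrightarrow> 1"
proof -
  define B where "B = {0..2*pi} - T"
  have intT: "integrable circle_measure (indicator T :: real \<Rightarrow> real)"
    by (rule circle.integrable_const_bound[of _ 1]) (use T in \<open>auto simp: indicator_def\<close>)
  obtain d where d: "d > 0" "\<And>t. t \<in> B \<Longrightarrow> d \<le> cmod (cis t - cis s)"
  proof (cases "B = {}")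
    case True
    then show ?thesis using that[of 1] by simp
  next
    case False
    have "compact B" unfolding B_def using T by (intro compact_diff) auto
    moreover have "continuous_on B (\<lambda>t. cmod (cis t - cis s))" by (intro continuous_intros)
    ultimately obtain t0 where t0: "t0 \<in> B" "\<And>t. t \<in> B \<Longrightarrow> cmod (cis t0 - cis s) \<le> cmod (cis t - cis s)"
      using continuous_attains_inf[of B] False by blast
    have "cis t0 \<noteq> cis s" using cis_inj_interior[OF s(2), of t0] t0(1) s(1) by (auto simp: B_def)
    then show ?thesis using that[of "cmod (cis t0 - cis s)"] t0 by simp
  qed
  have b: "\<bar>poisson_integral (indicator T) (of_real (rad n) * cis s) - 1\<bar> \<le> 4 * (1 - (rad n)\<^sup>2) / d\<^sup>2" for n
  proof -
    let ?z = "of_real (rad n) * cis s"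
    let ?C = "4 * (1 - (rad n)\<^sup>2) / d\<^sup>2"
    have z: "?z \<in> ball 0 1" by (rule rad_ball)
    have C: "?C \<ge> 0" using rad_bounds[of n] by (simp add: power_le_one)
    have intC: "integrable circle_measure (\<lambda>t. 1 - indicator T t :: real)"
      using intT by (intro Bochner_Integration.integrable_diff) auto
    have "1 - poisson_integral (indicator T) ?z = poisson_integral (\<lambda>t. 1 - indicator T t) ?z"
      using z intT by (simp add: poisson_integral_diff poisson_integral_const)
    moreover have "poisson_integral (\<lambda>t. 0) ?z \<le> poisson_integral (\<lambda>t. 1 - indicator T t) ?z"
      by (rule poisson_integral_mono[OF z _ intC]) (auto simp: indicator_def)
    moreover have "(LINT t|circle_measure. poisson ?z t * (1 - indicator T t)) \<le> (LINT t|circle_measure. ?C)"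
    proof (rule integral_mono)
      show "integrable circle_measure (\<lambda>t. poisson ?z t * (1 - indicator T t))"
        using intT by (intro poisson_integrable z) simp
      fix t assume "t \<in> space circle_measure"
      then show "poisson ?z t * (1 - indicator T t) \<le> ?C"
        using poisson_away[OF d(1) d(2)[of t] rad_bounds, of n] C by (auto simp: B_def indicator_def)
    qed simp
    then have le: "(LINT t|circle_measure. poisson ?z t * (1 - indicator T t)) \<le> 2 * pi * ?C"
      by simp
    have "poisson_integral (\<lambda>t. 1 - indicator T t) ?z \<le> ?C"
      using mult_left_mono[OF le, of "1 / (2 * pi)"] unfolding poisson_integral_def by simp
    ultimately show ?thesis using poisson_integral_const[OF z, of 0] by simp
  qed
  have "(\<lambda>n. 4 * (1 - (rad n)\<^sup>2) / d\<^sup>2) \<longlonglongrightarrow> 4 * (1 - 1\<^sup>2) / d\<^sup>2"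
    using d by (intro tendsto_intros rad_tendsto) auto
  then have "(\<lambda>n. 4 * (1 - (rad n)\<^sup>2) / d\<^sup>2) \<longlonglongrightarrow> 0" by simp
  then have "(\<lambda>n. poisson_integral (indicator T) (of_real (rad n) * cis s) - 1) \<longlonglongrightarrow> 0"
    by (rule Lim_null_comparison[rotated]) (use b in auto)
  then show ?thesis using Lim_null by blast
qed

section \<open>L1 convergence of Poisson integrals, from open sets to integrable functions\<close>

lemma AE_circle_interior: "AE s in circle_measure. s \<in> {0<..<2*pi}"
proof -
  have "AE s in lebesgue. s \<notin> {0, 2*pi}"
    by (rule AE_not_in) (simp add: negligible_iff_null_sets[symmetric])
  then have "AE s in lebesgue. s \<in> {0..2*pi} \<longrightarrow> s \<in> {0<..<2*pi}"
    by eventually_elim auto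
  then show ?thesis by (rule iffD2[OF AE_restrict_space_iff, rotated]) simp
qed

text \<open>For an indicator \<open>A\<close> with Poisson integral \<open>P\<close> one has \<open>\<bar>P - A\<bar> = P - A + 2 A (1 - P)\<close>, where
  \<open>P - A\<close> has integral zero. So it suffices that \<open>P\<close> tends to \<open>1\<close> at the points of the open set.\<close>

lemma poisson_L1_open:
  assumes T: "open T"
  shows "poisson_L1 (indicator T)"
proof -
  let ?A = "indicator T :: real \<Rightarrow> real"
  let ?P = "\<lambda>n s. poisson_integral ?A (of_real (rad n) * cis s)"
  have intT: "integrable circle_measure ?A"
    by (rule circle.integrable_const_bound[of _ 1]) (use T in \<open>auto simp: indicator_def\<close>)
  have intP: "integrable circle_measure (?P n)" for n
    by (rule poisson_integral_circle(1)[OF rad_bounds intT])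
  have P01: "0 \<le> ?P n s" "?P n s \<le> 1" for n s
    using poisson_integral_mono[OF rad_ball, of "\<lambda>_. 0" ?A n s] poisson_integral_mono[OF rad_ball, of ?A "\<lambda>_. 1" n s]
      intT by (auto simp: poisson_integral_const[OF rad_ball] indicator_def)
  have intAP: "integrable circle_measure (\<lambda>s. ?A s * (1 - ?P n s))" for n
  proof (rule circle.integrable_const_bound[of _ 1])
    show "AE s in circle_measure. norm (?A s * (1 - ?P n s)) \<le> 1"
      using P01 by (auto simp: indicator_def)
    show "(\<lambda>s. ?A s * (1 - ?P n s)) \<in> borel_measurable circle_measure"
      using borel_measurable_integrable[OF intT] borel_measurable_integrable[OF intP[of n]] by simp
  qed
  have "(\<lambda>n. LINT s|circle_measure. ?A s * (1 - ?P n s)) \<longlonglongrightarrow> (LINT s|circle_measure. 0)"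
  proof (rule integral_dominated_convergence[where w = "\<lambda>_. 1"])
    show "AE s in circle_measure. (\<lambda>n. ?A s * (1 - ?P n s)) \<longlonglongrightarrow> 0"
      using AE_circle_interior
    proof eventually_elim
      case (elim s)
      then have "(\<lambda>n. 1 - ?P n s) \<longlonglongrightarrow> 1 - 1" if "s \<in> T"
        by (intro tendsto_intros open_set_poisson_tendsto T that)
      then show ?case by (cases "s \<in> T") auto
    qed
    show "AE s in circle_measure. norm (?A s * (1 - ?P n s)) \<le> 1" for n
      using P01 by (auto simp: indicator_def)
  qed (use intAP in \<open>auto simp: borel_measurable_integrable\<close>)
  moreover have "(LINT s|circle_measure. \<bar>?P n s - ?A s\<bar>) = 2 * (LINT s|circle_measure. ?A s * (1 - ?P n s))" for n
  proof -
    have "\<bar>?P n s - ?A s\<bar> = (?P n s - ?A s) + 2 * (?A s * (1 - ?P n s))" for s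
      using P01[of n s] by (cases "s \<in> T") auto
    then have "(LINT s|circle_measure. \<bar>?P n s - ?A s\<bar>) =
       (LINT s|circle_measure. (?P n s - ?A s) + 2 * (?A s * (1 - ?P n s)))" by (rule Bochner_Integration.integral_cong[OF refl])
    also have "\<dots> = ((LINT s|circle_measure. ?P n s) - (LINT s|circle_measure. ?A s)) + 2 * (LINT s|circle_measure. ?A s * (1 - ?P n s))"
      using intP intT intAP by (simp only: Bochner_Integration.integral_add Bochner_Integration.integral_diff
        Bochner_Integration.integrable_diff integrable_mult_right integral_mult_right_zero)
    also have "(LINT s|circle_measure. ?P n s) = (LINT s|circle_measure. ?A s)"
      by (rule poisson_integral_circle(2)[OF rad_bounds intT])
    finally show ?thesis by simp
  qed
  ultimately show ?thesis unfolding poisson_L1_def using intT tendsto_mult_left[of _ 0 sequentially 2] by simp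
qed

text \<open>The usual three-part estimate. The error for \<open>k\<close> is at most the error for
  \<open>g\<close>, plus the L1 distance from \<open>k\<close> to \<open>g\<close>, plus the Poisson
  integral of \<open>k - g\<close>, which the L1 contraction bounds by that same distance.\<close>

lemma poisson_L1_approx:
  assumes k: "integrable circle_measure k"
    and ap: "\<And>e. e > 0 \<Longrightarrow> \<exists>g. poisson_L1 g \<and> (LINT s|circle_measure. \<bar>k s - g s\<bar>) < e"
  shows "poisson_L1 k"
  unfolding poisson_L1_def
proof (intro conjI k LIMSEQ_I)
  fix e :: real assume e: "e > 0"
  obtain g where g: "poisson_L1 g" and kg: "(LINT s|circle_measure. \<bar>k s - g s\<bar>) < e / 3"
    using ap[of "e/3"] e by auto
  have gi: "integrable circle_measure g" using g by (simp add: poisson_L1_def)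
  let ?P = "\<lambda>h n s. poisson_integral h (of_real (rad n) * cis s)"
  have I: "integrable circle_measure (?P h n)" if "integrable circle_measure h" for h n
    by (rule poisson_integral_circle(1)[OF rad_bounds that])
  have kgi: "integrable circle_measure (\<lambda>s. k s - g s)" using k gi by simp
  have ineq: "(LINT s|circle_measure. \<bar>?P k n s - k s\<bar>) \<le>
     (LINT s|circle_measure. \<bar>?P g n s - g s\<bar>) + 2 * (LINT s|circle_measure. \<bar>k s - g s\<bar>)" for n
  proof -
    have "(LINT s|circle_measure. \<bar>?P k n s - k s\<bar>) \<le>
      (LINT s|circle_measure. \<bar>?P (\<lambda>t. k t - g t) n s\<bar> + \<bar>?P g n s - g s\<bar> + \<bar>k s - g s\<bar>)"
    proof (rule integral_mono)
      show "\<bar>?P k n s - k s\<bar> \<le> \<bar>?P (\<lambda>t. k t - g t) n s\<bar> + \<bar>?P g n s - g s\<bar> + \<bar>k s - g s\<bar>" for s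
        unfolding poisson_integral_diff[OF rad_ball k gi] by linarith
    qed (intro Bochner_Integration.integrable_add Bochner_Integration.integrable_diff integrable_abs I k gi kgi)+
    also have "\<dots> = (LINT s|circle_measure. \<bar>?P (\<lambda>t. k t - g t) n s\<bar>) + (LINT s|circle_measure. \<bar>?P g n s - g s\<bar>)
        + (LINT s|circle_measure. \<bar>k s - g s\<bar>)"
      by (simp only: Bochner_Integration.integral_add Bochner_Integration.integrable_add Bochner_Integration.integrable_diff integrable_abs I k gi kgi)
    also have "(LINT s|circle_measure. \<bar>?P (\<lambda>t. k t - g t) n s\<bar>) \<le> (LINT s|circle_measure. \<bar>k s - g s\<bar>)"
      by (rule poisson_integral_L1[OF rad_bounds kgi])
    finally show ?thesis by simp
  qed
  obtain N where N: "\<And>n. n \<ge> N \<Longrightarrow> (LINT s|circle_measure. \<bar>?P g n s - g s\<bar>) < e / 3"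
    using order_tendstoD(2)[of _ 0 sequentially "e/3"] g e unfolding poisson_L1_def eventually_sequentially by auto
  have "(LINT s|circle_measure. \<bar>?P k n s - k s\<bar>) < e" if "n \<ge> N" for n
    using ineq[of n] N[OF that] kg by linarith
  then show "\<exists>N. \<forall>n\<ge>N. norm ((LINT s|circle_measure. \<bar>?P k n s - k s\<bar>) - 0) < e"
    by auto
qed

lemma poisson_L1_scale: "poisson_L1 k \<Longrightarrow> poisson_L1 (\<lambda>t. k t * c)"
proof -
  assume k: "poisson_L1 k"
  have "\<bar>poisson_integral (\<lambda>t. k t * c) z - k s * c\<bar> = \<bar>poisson_integral k z - k s\<bar> * \<bar>c\<bar>" for z s
    by (simp add: poisson_integral_scale abs_mult[symmetric] left_diff_distrib)
  then show ?thesis using k tendsto_mult_right[of _ 0 sequentially "\<bar>c\<bar>"] unfolding poisson_L1_def by simp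
qed

text \<open>Outer regularity: an open superset \<open>T\<close> with small excess has an indicator
  that is L1-close to that of \<open>A\<close>.\<close>

lemma poisson_L1_measurable_set:
  assumes A: "A \<in> sets circle_measure"
  shows "poisson_L1 (indicator A)"
proof (rule poisson_L1_approx)
  show "integrable circle_measure (indicator A :: real \<Rightarrow> real)"
    by (rule circle.integrable_const_bound[of _ 1]) (use A in \<open>auto simp: indicator_def\<close>)
  fix e :: real assume e: "e > 0"
  have "A \<in> sets lebesgue" using A by (simp add: sets_restrict_space_iff)
  then obtain T where T: "open T" "A \<subseteq> T" "T - A \<in> lmeasurable" "emeasure lebesgue (T - A) < ennreal e"
    using sets_lebesgue_outer_open[OF _ e] by blast
  have "(LINT s|circle_measure. \<bar>indicator A s - indicator T s :: real\<bar>) = (LINT s|circle_measure. indicator ((T - A) \<inter> {0..2*pi}) s)"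
    by (rule Bochner_Integration.integral_cong) (use T in \<open>auto simp: indicator_def\<close>)
  also have "\<dots> = measure circle_measure ((T - A) \<inter> {0..2*pi})"
    by simp
  also have "\<dots> = measure lebesgue ((T - A) \<inter> {0..2*pi})"
    by (rule measure_restrict_space) auto
  also have "\<dots> \<le> measure lebesgue (T - A)"
    using T(3) by (intro measure_mono_fmeasurable) (auto simp: fmeasurable_def)
  also have "\<dots> < e" using T(3,4) e by (simp add: emeasure_eq_measure2 ennreal_less_iff)
  finally show "\<exists>g. poisson_L1 g \<and> (LINT s|circle_measure. \<bar>indicator A s - g s\<bar>) < e"
    using poisson_L1_open[OF T(1)] by blast
qed

lemma poisson_L1_integrable:
  assumes "integrable circle_measure k"
  shows "poisson_L1 k"
  using assms
proof (induct k rule: integrable_induct)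
  case (base A c)
  then show ?case using poisson_L1_scale[OF poisson_L1_measurable_set[OF base(1)], of c] by simp
next
  case (add f g)
  let ?P = "\<lambda>h n s. poisson_integral h (of_real (rad n) * cis s)"
  have I: "integrable circle_measure (?P h n)" if "integrable circle_measure h" for h n
    by (rule poisson_integral_circle(1)[OF rad_bounds that])
  have fg: "integrable circle_measure (\<lambda>x. f x + g x)" using add by simp
  have "(\<lambda>n. LINT s|circle_measure. \<bar>?P (\<lambda>x. f x + g x) n s - (f s + g s)\<bar>) \<longlonglongrightarrow> 0"
  proof (rule tendsto_sandwich[OF _ _ tendsto_const])
    show "eventually (\<lambda>n. (LINT s|circle_measure. \<bar>?P (\<lambda>x. f x + g x) n s - (f s + g s)\<bar>) \<le>
      (LINT s|circle_measure. \<bar>?P f n s - f s\<bar>) + (LINT s|circle_measure. \<bar>?P g n s - g s\<bar>)) sequentially"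
    proof (intro always_eventually allI)
      fix n
      have "(LINT s|circle_measure. \<bar>?P (\<lambda>x. f x + g x) n s - (f s + g s)\<bar>) \<le>
        (LINT s|circle_measure. \<bar>?P f n s - f s\<bar> + \<bar>?P g n s - g s\<bar>)"
      proof (rule integral_mono)
        show "\<bar>?P (\<lambda>x. f x + g x) n s - (f s + g s)\<bar> \<le> \<bar>?P f n s - f s\<bar> + \<bar>?P g n s - g s\<bar>" for s
          unfolding poisson_integral_add[OF rad_ball add(1,3)] by linarith
      qed (intro Bochner_Integration.integrable_add Bochner_Integration.integrable_diff integrable_abs I add fg)+
      also have "\<dots> = (LINT s|circle_measure. \<bar>?P f n s - f s\<bar>) + (LINT s|circle_measure. \<bar>?P g n s - g s\<bar>)"
        by (intro Bochner_Integration.integral_add Bochner_Integration.integrable_diff integrable_abs I add)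
      finally show "(LINT s|circle_measure. \<bar>?P (\<lambda>x. f x + g x) n s - (f s + g s)\<bar>) \<le>
        (LINT s|circle_measure. \<bar>?P f n s - f s\<bar>) + (LINT s|circle_measure. \<bar>?P g n s - g s\<bar>)" .
    qed
    show "(\<lambda>n. (LINT s|circle_measure. \<bar>?P f n s - f s\<bar>) + (LINT s|circle_measure. \<bar>?P g n s - g s\<bar>)) \<longlonglongrightarrow> 0"
      using add(2,4) unfolding poisson_L1_def by (intro tendsto_add_zero) auto
  qed simp
  then show ?case using fg by (simp add: poisson_L1_def)
next
  case (lim f s)
  have "(\<lambda>i. LINT x|circle_measure. \<bar>f x - s i x\<bar>) \<longlonglongrightarrow> (LINT x|circle_measure. 0)"
  \<comment> \<open>The induction rule provides approximants with \<open>\<bar>s i x\<bar>\<close>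
    at most twice \<open>\<bar>f x\<bar>\<close>, which accounts for the factor 3.\<close>
  proof (rule integral_dominated_convergence[where w = "\<lambda>x. 3 * \<bar>f x\<bar>"])
    show "integrable circle_measure (\<lambda>x. 3 * \<bar>f x\<bar>)" using lim by simp
    show "AE x in circle_measure. (\<lambda>i. \<bar>f x - s i x\<bar>) \<longlonglongrightarrow> 0"
    proof (rule AE_I2)
      fix x assume "x \<in> space circle_measure"
      from tendsto_rabs[OF tendsto_diff[OF tendsto_const[of "f x"] lim(3)[OF this]]]
      show "(\<lambda>i. \<bar>f x - s i x\<bar>) \<longlonglongrightarrow> 0" by simp
    qed
    show "AE x in circle_measure. norm \<bar>f x - s i x\<bar> \<le> 3 * \<bar>f x\<bar>" for i
    proof (rule AE_I2)
      fix x assume "x \<in> space circle_measure"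
      from lim(4)[OF this, of i] show "norm \<bar>f x - s i x\<bar> \<le> 3 * \<bar>f x\<bar>" by simp
    qed
  qed (use lim in \<open>auto intro!: borel_measurable_integrable\<close>)
  then have *: "(\<lambda>i. LINT x|circle_measure. \<bar>f x - s i x\<bar>) \<longlonglongrightarrow> 0" by simp
  show ?case
  proof (rule poisson_L1_approx[OF lim(5)])
    fix e :: real assume "e > 0"
    then obtain i where "(LINT x|circle_measure. \<bar>f x - s i x\<bar>) < e"
      using order_tendstoD(2)[OF *, of e] eventually_happens' sequentially_bot by blast
    with lim(2) show "\<exists>g. poisson_L1 g \<and> (LINT x|circle_measure. \<bar>f x - g x\<bar>) < e" by blast
  qed
qed

text \<open>L1 convergence yields a subsequence of radii along which the Poisson integrals tend to
  \<open>k\<close> a.e. Where a radial limit exists, its modulus must agree with the limit along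
  that subsequence.\<close>

lemma boundary_modulus:
  assumes k: "integrable circle_measure k"
    and f: "\<And>z. z \<in> ball 0 1 \<Longrightarrow> cmod (f z) = exp (poisson_integral k z)"
  shows "AE s in circle_measure. \<forall>l. radial_limit f s l \<longrightarrow> cmod l = exp (k s)"
proof -
  have "poisson_L1 k" by (rule poisson_L1_integrable[OF k])
  then have "\<exists>r. strict_mono (r::nat\<Rightarrow>nat) \<and> (AE s in circle_measure.
      (\<lambda>n. poisson_integral k (of_real (rad (r n)) * cis s) - k s) \<longlonglongrightarrow> 0)"
    unfolding poisson_L1_def
    by (intro tendsto_L1_AE_subseq) (auto intro!: Bochner_Integration.integrable_diff poisson_integral_circle rad_bounds)
  then obtain r where r: "strict_mono (r::nat\<Rightarrow>nat)" and
    ae: "AE s in circle_measure. (\<lambda>n. poisson_integral k (of_real (rad (r n)) * cis s) - k s) \<longlonglongrightarrow> 0"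
    by blast
  from ae show ?thesis
  proof eventually_elim
    case (elim s)
    show ?case
    proof (intro allI impI)
      fix l assume l: "radial_limit f s l"
      have "filterlim (\<lambda>n. rad (r n)) (at_left 1) sequentially"
        by (rule filterlim_compose[OF rad_filterlim filterlim_subseq[OF r]])
      then have "(\<lambda>n. cmod (f (of_real (rad (r n)) * cis s))) \<longlonglongrightarrow> cmod l"
        using filterlim_compose l unfolding radial_limit_def by (intro tendsto_norm) blast
      moreover have "(\<lambda>n. cmod (f (of_real (rad (r n)) * cis s))) \<longlonglongrightarrow> exp (k s)"
        unfolding f[OF rad_ball] using elim Lim_null by (intro tendsto_exp) blast
      ultimately show "cmod l = exp (k s)" by (rule LIMSEQ_unique)
    qed
  qed
qed

text \<open>The integrand is the logarithm of \<open>max (exp (k t)) \<epsilon> / exp (k t)\<close>.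
  It vanishes once \<open>ln \<epsilon>\<close> is at most \<open>k t\<close>, and for \<epsilon>
  below 1 the logarithm is negative, so \<open>\<bar>k t\<bar>\<close> dominates.\<close>

lemma integral_log_excess_tendsto:
  fixes k :: "real \<Rightarrow> real"
  assumes k: "integrable circle_measure k"
  shows "((\<lambda>\<epsilon>. LINT t|circle_measure. max 0 (ln \<epsilon> - k t)) \<longlongrightarrow> 0) (at_right 0)"
proof (rule tendsto_at_right_sequentially[OF zero_less_one])
  fix S :: "nat \<Rightarrow> real"
  assume S: "\<And>n. 0 < S n" "\<And>n. S n < 1" "decseq S" "S \<longlonglongrightarrow> 0"
  have [measurable]: "k \<in> borel_measurable circle_measure" using k by simp
  have "filterlim S (at_right 0) sequentially"
    using S(1,4) unfolding filterlim_at
    by (auto intro!: always_eventually simp: less_imp_neq[symmetric] less_imp_le)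
  then have lnS: "filterlim (\<lambda>n. ln (S n)) at_bot sequentially"
    by (rule filterlim_compose[OF ln_at_0])
  have "(\<lambda>n. LINT t|circle_measure. max 0 (ln (S n) - k t)) \<longlonglongrightarrow> (LINT t|circle_measure. 0)"
  proof (rule integral_dominated_convergence[where w = "\<lambda>t. \<bar>k t\<bar>"])
    show "AE t in circle_measure. (\<lambda>n. max 0 (ln (S n) - k t)) \<longlonglongrightarrow> 0"
    proof (rule AE_I2)
      fix t
      have "eventually (\<lambda>n. ln (S n) \<le> k t) sequentially"
        using lnS by (simp add: filterlim_at_bot)
      then show "(\<lambda>n. max 0 (ln (S n) - k t)) \<longlonglongrightarrow> 0"
        by (intro tendsto_eventually) (auto elim!: eventually_mono)
    qed
    show "AE t in circle_measure. norm (max 0 (ln (S n) - k t)) \<le> \<bar>k t\<bar>" for n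
    proof (rule AE_I2)
      fix t
      have "ln (S n) < 0" using S by simp
      then show "norm (max 0 (ln (S n) - k t)) \<le> \<bar>k t\<bar>" by simp
    qed
  qed (use k in auto)
  then show "(\<lambda>n. LINT t|circle_measure. max 0 (ln (S n) - k t)) \<longlonglongrightarrow> 0" by simp
qed

text \<open>The density of \<open>g \<epsilon>\<close> is a.e. the maximum of \<open>k\<close> and
  \<open>ln \<epsilon>\<close>. Monotonicity of Poisson integrals carries the two lower bounds into
  the disk; at the origin the Poisson integral is the mean, so the ratio there is the exponential of
  minus the mean excess of \<open>ln \<epsilon>\<close> over \<open>k\<close>.\<close>

lemma outer_truncation_estimates:
  assumes a: "outer a" "a 0 \<in> \<real>" "Re (a 0) > 0"
    and g: "\<And>\<epsilon>. \<epsilon> > 0 \<Longrightarrow> outer_truncation a \<epsilon> (g \<epsilon>)"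
  shows "\<And>\<epsilon> z. \<epsilon> > 0 \<Longrightarrow> z \<in> ball 0 1 \<Longrightarrow> \<epsilon> \<le> cmod (g \<epsilon> z)"
    and "\<And>\<epsilon> z. \<epsilon> > 0 \<Longrightarrow> z \<in> ball 0 1 \<Longrightarrow> cmod (a z) \<le> cmod (g \<epsilon> z)"
    and "((\<lambda>\<epsilon>. a 0 / g \<epsilon> 0) \<longlongrightarrow> 1) (at_right 0)"
proof -
  obtain k where k: "integrable circle_measure (k :: real \<Rightarrow> real)"
    and ak: "\<And>z. z \<in> ball 0 1 \<Longrightarrow> cmod (a z) = exp (poisson_integral k z)"
    using outer_modulus[OF a(1)] by blast
  have "\<exists>l. integrable circle_measure (l :: real \<Rightarrow> real) \<and> (\<forall>z\<in>ball 0 1. cmod (g \<epsilon> z) = exp (poisson_integral l z))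
      \<and> (AE t in circle_measure. l t = max (k t) (ln \<epsilon>))" if e: "\<epsilon> > 0" for \<epsilon>
  proof -
    have "outer (g \<epsilon>)" using g[OF e] by (simp add: outer_truncation_def)
    then obtain l where l: "integrable circle_measure (l :: real \<Rightarrow> real)"
      and gl: "\<And>z. z \<in> ball 0 1 \<Longrightarrow> cmod (g \<epsilon> z) = exp (poisson_integral l z)"
      using outer_modulus by blast
    have "AE t in circle_measure. \<exists>\<gamma> \<alpha>. radial_limit (g \<epsilon>) t \<gamma> \<and> radial_limit a t \<alpha> \<and> cmod \<gamma> = max (cmod \<alpha>) \<epsilon>"
      using g[OF e] by (simp add: outer_truncation_def)
    moreover have "AE t in circle_measure. \<forall>\<alpha>. radial_limit a t \<alpha> \<longrightarrow> cmod \<alpha> = exp (k t)"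
      by (rule boundary_modulus[OF k ak])
    moreover have "AE t in circle_measure. \<forall>\<gamma>. radial_limit (g \<epsilon>) t \<gamma> \<longrightarrow> cmod \<gamma> = exp (l t)"
      by (rule boundary_modulus[OF l gl])
    ultimately have "AE t in circle_measure. l t = max (k t) (ln \<epsilon>)"
    proof eventually_elim
      case (elim t)
      then have "exp (l t) = max (exp (k t)) \<epsilon>" by metis
      also have "\<dots> = exp (max (k t) (ln \<epsilon>))" using e by (simp add: max_def)  (metis exp_le_cancel_iff exp_ln)
      finally show ?case by simp
    qed
    with l gl show ?thesis by blast
  qed
  then have "\<forall>\<epsilon>. \<exists>l. \<epsilon> > 0 \<longrightarrow> integrable circle_measure (l :: real \<Rightarrow> real) \<and>
      (\<forall>z\<in>ball 0 1. cmod (g \<epsilon> z) = exp (poisson_integral l z))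
      \<and> (AE t in circle_measure. l t = max (k t) (ln \<epsilon>))" by blast
  from choice[OF this] obtain l where l: "\<And>\<epsilon>. \<epsilon> > 0 \<Longrightarrow> integrable circle_measure (l \<epsilon>)"
    and gl: "\<And>\<epsilon> z. \<epsilon> > 0 \<Longrightarrow> z \<in> ball 0 1 \<Longrightarrow> cmod (g \<epsilon> z) = exp (poisson_integral (l \<epsilon>) z)"
    and lk: "\<And>\<epsilon>. \<epsilon> > 0 \<Longrightarrow> AE t in circle_measure. l \<epsilon> t = max (k t) (ln \<epsilon>)" by blast
  show "\<epsilon> \<le> cmod (g \<epsilon> z)" if e: "\<epsilon> > 0" and z: "z \<in> ball 0 1" for \<epsilon> z
  proof -
    have "poisson_integral (\<lambda>t. ln \<epsilon>) z \<le> poisson_integral (l \<epsilon>) z"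
    proof (rule poisson_integral_mono[OF z _ l[OF e]])
      show "AE t in circle_measure. ln \<epsilon> \<le> l \<epsilon> t" using lk[OF e] by eventually_elim simp
    qed simp
    then have "ln \<epsilon> \<le> poisson_integral (l \<epsilon>) z" by (simp add: poisson_integral_const[OF z])
    then show ?thesis using gl[OF e z] e by (metis exp_le_cancel_iff exp_ln)
  qed
  show "cmod (a z) \<le> cmod (g \<epsilon> z)" if e: "\<epsilon> > 0" and z: "z \<in> ball 0 1" for \<epsilon> z
  proof -
    have "poisson_integral k z \<le> poisson_integral (l \<epsilon>) z"
    proof (rule poisson_integral_mono[OF z k l[OF e]])
      show "AE t in circle_measure. k t \<le> l \<epsilon> t" using lk[OF e] by eventually_elim simp
    qed
    then show ?thesis using gl[OF e z] ak[OF z] by simp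
  qed
  \<comment> \<open>Moduli determine the values at the origin because both are normalised to be
    positive; only this turns the limit of moduli into a limit of
    \<open>a 0 / g \<epsilon> 0\<close>.\<close>
  have pos: "x = of_real (cmod x)" if "x \<in> \<real>" "Re x > 0" for x :: complex
    using that by (auto elim!: Reals_cases)
  have "a 0 / g \<epsilon> 0 = of_real (exp (- (1 / (2 * pi) * (LINT t|circle_measure. max 0 (ln \<epsilon> - k t)))))" if e: "\<epsilon> > 0" for \<epsilon>
  proof -
    have g0: "g \<epsilon> 0 \<in> \<real>" "Re (g \<epsilon> 0) > 0" using g[OF e] by (auto simp: outer_truncation_def)
    have "(LINT t|circle_measure. max 0 (ln \<epsilon> - k t)) = (LINT t|circle_measure. l \<epsilon> t - k t)"
    proof (rule integral_cong_AE)
      show "AE t in circle_measure. max 0 (ln \<epsilon> - k t) = l \<epsilon> t - k t"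
        using lk[OF e] by eventually_elim simp
    qed (use k l[OF e] in auto)
    also have "\<dots> = (LINT t|circle_measure. l \<epsilon> t) - (LINT t|circle_measure. k t)"
      using k l[OF e] by simp
    finally have "exp (- (1 / (2 * pi) * (LINT t|circle_measure. max 0 (ln \<epsilon> - k t)))) = cmod (a 0) / cmod (g \<epsilon> 0)"
      using ak[of 0] gl[OF e, of 0] by (simp add: poisson_integral_0 exp_diff[symmetric] diff_divide_distrib)
    moreover have "a 0 / g \<epsilon> 0 = of_real (cmod (a 0) / cmod (g \<epsilon> 0))"
      using pos[OF a(2,3)] pos[OF g0] by simp
    ultimately show ?thesis by simp
  qed
  then have "eventually (\<lambda>\<epsilon>. of_real (exp (- (1 / (2 * pi) * (LINT t|circle_measure. max 0 (ln \<epsilon> - k t))))) = a 0 / g \<epsilon> 0) (at_right 0)"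
    unfolding eventually_at_right_field by (intro exI[of _ 1]) auto
  moreover have "((\<lambda>\<epsilon>. complex_of_real (exp (- (1 / (2 * pi) * (LINT t|circle_measure. max 0 (ln \<epsilon> - k t))))))
      \<longlongrightarrow> of_real (exp (- (1 / (2 * pi) * 0)))) (at_right 0)"
    by (intro tendsto_intros integral_log_excess_tendsto k)
  ultimately show "((\<lambda>\<epsilon>. a 0 / g \<epsilon> 0) \<longlongrightarrow> 1) (at_right 0)"
    by (simp add: tendsto_cong)
qed

subsection \<open>The de Branges--Rovnyak space of a Pythagorean pair\<close>

lemma toeplitz_add:
  "u \<in> l2 \<Longrightarrow> f \<in> l2 \<Longrightarrow> g \<in> l2 \<Longrightarrow> toeplitz u (\<lambda>n. f n + g n) = (\<lambda>m. toeplitz u f m + toeplitz u g m)"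
  unfolding toeplitz_def by (simp add: fun_eq_iff distrib_left suminf_add toeplitz_summable)

lemma toeplitz_scale:
  "u \<in> l2 \<Longrightarrow> f \<in> l2 \<Longrightarrow> toeplitz u (\<lambda>n. c * f n) = (\<lambda>m. c * toeplitz u f m)"
  unfolding toeplitz_def fun_eq_iff
  using suminf_mult[OF toeplitz_summable, of u f c] by (simp add: mult.left_commute)

lemma toeplitz_diff:
  "u \<in> l2 \<Longrightarrow> f \<in> l2 \<Longrightarrow> g \<in> l2 \<Longrightarrow> toeplitz u (\<lambda>n. f n - g n) = (\<lambda>m. toeplitz u f m - toeplitz u g m)"
  unfolding toeplitz_def by (simp add: fun_eq_iff right_diff_distrib suminf_diff toeplitz_summable)

lemma toeplitz_weak_convergence:
  assumes "u \<in> l2" "\<And>k. ((\<lambda>n. s n k) \<longlongrightarrow> g k) F"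
    and bound: "eventually (\<lambda>n. s n \<in> l2 \<and> l2_norm (s n) \<le> C) F" and "g \<in> l2"
  shows "((\<lambda>n. toeplitz u (s n) m) \<longlongrightarrow> toeplitz u g m) F"
  unfolding toeplitz_shift
proof (rule l2_weak_convergence)
  show "((\<lambda>n. shift m (s n) k) \<longlongrightarrow> shift m g k) F" for k
    unfolding shift_def by (rule assms(2))
  show "eventually (\<lambda>n. shift m (s n) \<in> l2 \<and> l2_norm (shift m (s n)) \<le> C) F"
    using bound by eventually_elim (auto intro: order_trans[OF shift_norm])
qed (use assms in auto)

section \<open>Bounded functions, Szego kernels and the isometry given by a Pythagorean pair\<close>

lemma bounded_taylor_l2:
  assumes "u holomorphic_on ball 0 1" "\<And>z. z \<in> ball 0 1 \<Longrightarrow> cmod (u z) \<le> M"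
  shows "taylor_coeff u \<in> l2"
  using multiplier_bounded[OF assms] by (simp add: multiplier_def)

lemma hardy_infinity_bounded:
  assumes "u \<in> hardy_infinity"
  obtains M where "u holomorphic_on ball 0 1" "\<And>z. z \<in> ball 0 1 \<Longrightarrow> cmod (u z) \<le> M" "M > 0"
proof -
  have "u holomorphic_on ball 0 1" "bounded (u ` ball 0 1)"
    using assms by (auto simp: hardy_infinity_def)
  moreover from this(2) obtain M where "M > 0" "\<And>z. z \<in> ball 0 1 \<Longrightarrow> cmod (u z) \<le> M"
    unfolding bounded_pos by blast
  ultimately show ?thesis using that by blast
qed

text \<open>The adjoint relation tested on the monomial of degree \<open>m\<close>. It expresses
  Toeplitz coefficients by products of functions, the form in which the isometry of the pair can be
  used.\<close>

lemma toeplitz_coeff: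
  assumes u: "u holomorphic_on ball 0 1" "multiplier (taylor_coeff u) M" and f: "f \<in> l2"
  shows "toeplitz (taylor_coeff u) f m = l2_ip f (taylor_coeff (\<lambda>z. u z * z ^ m))"
proof -
  define e :: "nat \<Rightarrow> complex" where "e = taylor_coeff (\<lambda>z. z ^ m)"
  have e: "e = (\<lambda>n. if n = m then 1 else 0)" by (simp add: e_def taylor_coeff_power)
  have "e \<in> l2" unfolding l2_def mem_Collect_eq by (rule summable_finite[of "{m}"]) (auto simp: e)
  from toeplitz_adjoint[OF u(2) f this]
  have "l2_ip (toeplitz (taylor_coeff u) f) e = l2_ip f (conv (taylor_coeff u) e)" .
  moreover have "l2_ip (toeplitz (taylor_coeff u) f) e = toeplitz (taylor_coeff u) f m"
    unfolding l2_ip_def by (subst suminf_finite[of "{m}"]) (auto simp: e)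
  moreover have "conv (taylor_coeff u) e = taylor_coeff (\<lambda>z. u z * z ^ m)"
    unfolding e_def by (rule taylor_coeff_mult[symmetric]) (intro u holomorphic_intros)+
  ultimately show ?thesis by simp
qed

text \<open>The reproducing kernel of H^2 at the point \<open>w\<close>, as a function of
  \<open>z\<close>.\<close>

definition szego :: "complex \<Rightarrow> complex \<Rightarrow> complex" where
  "szego w z = 1 / (1 - cnj w * z)"

lemma szego_denominator:
  assumes "w \<in> ball 0 1" "z \<in> ball 0 1"
  shows "cmod (cnj w * z) < 1" "1 - cnj w * z \<noteq> 0"
proof -
  have "cmod w * cmod z < 1 * 1" using assms by (intro mult_strict_mono') auto
  then show "cmod (cnj w * z) < 1" by (simp add: norm_mult)
  then show "1 - cnj w * z \<noteq> 0" by auto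
qed

lemma szego_taylor:
  assumes w: "w \<in> ball 0 1"
  shows "szego w holomorphic_on ball 0 1" "taylor_coeff (szego w) = (\<lambda>n. cnj w ^ n)"
proof -
  have "(\<lambda>n. cnj w ^ n * z ^ n) sums szego w z" if "z \<in> ball 0 1" for z
    unfolding szego_def power_mult_distrib[symmetric]
    by (rule geometric_sums) (rule szego_denominator[OF w that])
  from power_series_taylor[OF this]
  show "szego w holomorphic_on ball 0 1" "taylor_coeff (szego w) = (\<lambda>n. cnj w ^ n)" by auto
qed

lemma szego_bound:
  assumes "w \<in> ball 0 1" "z \<in> ball 0 1"
  shows "cmod (szego w z) \<le> 1 / (1 - cmod w)"
proof -
  have "1 - cmod w \<le> 1 - cmod (cnj w * z)"
    using assms by (simp add: norm_mult mult_left_le)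
  also have "\<dots> \<le> cmod (1 - cnj w * z)" using norm_triangle_ineq2[of 1 "cnj w * z"] by simp
  finally show ?thesis using assms unfolding szego_def norm_divide by (intro frac_le) auto
qed

lemma szego_reproducing:
  assumes f: "f holomorphic_on ball 0 1" "taylor_coeff f \<in> l2" and w: "w \<in> ball 0 1"
  shows "taylor_coeff (szego w) \<in> l2" "l2_ip (taylor_coeff f) (taylor_coeff (szego w)) = f w"
proof -
  show "taylor_coeff (szego w) \<in> l2"
    by (rule bounded_taylor_l2[OF szego_taylor(1)[OF w] szego_bound[OF w]])
  show "l2_ip (taylor_coeff f) (taylor_coeff (szego w)) = f w"
    using taylor_sums[OF f(1) w] unfolding l2_ip_def szego_taylor(2)[OF w] by (simp add: sums_iff)
qed

text \<open>Integrals over the circles of radius \<open>rad n\<close> tend to \<open>2 * pi\<close>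
  times the \<open>l2\<close> inner products. Their combination is the integral of \<open>D\<close>
  times \<open>f\<close> times the conjugate of \<open>g\<close>, and it tends to zero by bounded
  convergence.\<close>

lemma pythagorean_isometry:
  assumes pair: "pythagorean_pair b a"
    and f: "f holomorphic_on ball 0 1" "\<And>z. z \<in> ball 0 1 \<Longrightarrow> cmod (f z) \<le> M"
    and g: "g holomorphic_on ball 0 1" "\<And>z. z \<in> ball 0 1 \<Longrightarrow> cmod (g z) \<le> N"
  shows "l2_ip (taylor_coeff (\<lambda>z. b z * f z)) (taylor_coeff (\<lambda>z. b z * g z))
     + l2_ip (taylor_coeff (\<lambda>z. a z * f z)) (taylor_coeff (\<lambda>z. a z * g z))
     = l2_ip (taylor_coeff f) (taylor_coeff g)"
proof -
  obtain B where b: "b holomorphic_on ball 0 1" "\<And>z. z \<in> ball 0 1 \<Longrightarrow> cmod (b z) \<le> B" "B > 0"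
    using pair hardy_infinity_bounded unfolding pythagorean_pair_def by blast
  obtain A where a: "a holomorphic_on ball 0 1" "\<And>z. z \<in> ball 0 1 \<Longrightarrow> cmod (a z) \<le> A" "A > 0"
    using pair hardy_infinity_bounded unfolding pythagorean_pair_def by blast
  have M: "M \<ge> 0" using f(2)[of 0] by (simp add: order_trans[OF norm_ge_zero])
  have N: "N \<ge> 0" using g(2)[of 0] by (simp add: order_trans[OF norm_ge_zero])
  have prod: "(\<lambda>z. u z * v z) holomorphic_on ball 0 1" "taylor_coeff (\<lambda>z. u z * v z) \<in> l2"
    if "u holomorphic_on ball 0 1" "\<And>z. z \<in> ball 0 1 \<Longrightarrow> cmod (u z) \<le> U"
      "v holomorphic_on ball 0 1" "\<And>z. z \<in> ball 0 1 \<Longrightarrow> cmod (v z) \<le> V" for u v U V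
  proof -
    show "(\<lambda>z. u z * v z) holomorphic_on ball 0 1" using that by (intro holomorphic_intros)
    then show "taylor_coeff (\<lambda>z. u z * v z) \<in> l2"
    proof (rule bounded_taylor_l2)
      fix z :: complex assume "z \<in> ball 0 1"
      then show "cmod (u z * v z) \<le> U * V"
        unfolding norm_mult using that(2,4) by (intro mult_mono) (auto intro: order_trans[OF norm_ge_zero])
    qed
  qed
  define z where "z n t = complex_of_real (rad n) * cis t" for n t
  \<comment> \<open>The defect of the Pythagorean identity inside the disk; it tends to zero along
    almost every radius.\<close>
  define D where "D w = b w * cnj (b w) + a w * cnj (a w) - 1" for w
  define I where "I u v n = (LINT t|circle_measure. u (z n t) * cnj (v (z n t)))" for u v n
  have zb: "z n t \<in> ball 0 1" for n t unfolding z_def by (rule rad_ball)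
  have lim: "(\<lambda>n. I u v n) \<longlonglongrightarrow> 2 * of_real pi * l2_ip (taylor_coeff u) (taylor_coeff v)"
    if "u holomorphic_on ball 0 1" "taylor_coeff u \<in> l2" "v holomorphic_on ball 0 1" "taylor_coeff v \<in> l2" for u v
    unfolding I_def z_def by (rule circle_ip_limit[OF that rad_bounds rad_tendsto])
  have cont: "continuous_on UNIV (\<lambda>t. u (z n t))" if "u holomorphic_on ball 0 1" for u n
    unfolding z_def by (rule continuous_on_circle[OF that rad_bounds])
  let ?L = "l2_ip (taylor_coeff (\<lambda>z. b z * f z)) (taylor_coeff (\<lambda>z. b z * g z))
     + l2_ip (taylor_coeff (\<lambda>z. a z * f z)) (taylor_coeff (\<lambda>z. a z * g z)) - l2_ip (taylor_coeff f) (taylor_coeff g)"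
  have "(\<lambda>n. I (\<lambda>z. b z * f z) (\<lambda>z. b z * g z) n + I (\<lambda>z. a z * f z) (\<lambda>z. a z * g z) n - I f g n)
    \<longlonglongrightarrow> 2 * of_real pi * l2_ip (taylor_coeff (\<lambda>z. b z * f z)) (taylor_coeff (\<lambda>z. b z * g z))
     + 2 * of_real pi * l2_ip (taylor_coeff (\<lambda>z. a z * f z)) (taylor_coeff (\<lambda>z. a z * g z))
     - 2 * of_real pi * l2_ip (taylor_coeff f) (taylor_coeff g)"
    by (intro tendsto_add tendsto_diff lim prod[OF b(1,2) f] prod[OF b(1,2) g] prod[OF a(1,2) f]
        prod[OF a(1,2) g] f(1) g(1) bounded_taylor_l2[OF f] bounded_taylor_l2[OF g])
  then have L1: "(\<lambda>n. I (\<lambda>z. b z * f z) (\<lambda>z. b z * g z) n + I (\<lambda>z. a z * f z) (\<lambda>z. a z * g z) n - I f g n)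
    \<longlonglongrightarrow> 2 * of_real pi * ?L"
    by (simp add: algebra_simps)
  have eq: "I (\<lambda>z. b z * f z) (\<lambda>z. b z * g z) n + I (\<lambda>z. a z * f z) (\<lambda>z. a z * g z) n - I f g n
     = (LINT t|circle_measure. D (z n t) * (f (z n t) * cnj (g (z n t))))" for n
  proof -
    have int: "integrable circle_measure (\<lambda>t. u (z n t) * v (z n t) * cnj (u (z n t) * w (z n t)))"
      if "u holomorphic_on ball 0 1" "v holomorphic_on ball 0 1" "w holomorphic_on ball 0 1" for u v w
      using that by (intro continuous_circle_integrable continuous_intros continuous_on_cnj cont)
    have int1: "integrable circle_measure (\<lambda>t. f (z n t) * cnj (g (z n t)))"
      by (intro continuous_circle_integrable continuous_intros continuous_on_cnj cont f g)
    have "(LINT t|circle_measure. D (z n t) * (f (z n t) * cnj (g (z n t)))) =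
      (LINT t|circle_measure. b (z n t) * f (z n t) * cnj (b (z n t) * g (z n t))
        + a (z n t) * f (z n t) * cnj (a (z n t) * g (z n t)) - f (z n t) * cnj (g (z n t)))"
      by (rule Bochner_Integration.integral_cong[OF refl]) (simp add: D_def algebra_simps)
    also have "\<dots> = I (\<lambda>z. b z * f z) (\<lambda>z. b z * g z) n + I (\<lambda>z. a z * f z) (\<lambda>z. a z * g z) n - I f g n"
      unfolding I_def
      by (simp only: Bochner_Integration.integral_add Bochner_Integration.integral_diff
        Bochner_Integration.integrable_add int[OF b(1) f(1) g(1)] int[OF a(1) f(1) g(1)] int1)
    finally show ?thesis by simp
  qed
  have "(\<lambda>n. LINT t|circle_measure. D (z n t) * (f (z n t) * cnj (g (z n t)))) \<longlonglongrightarrow> (LINT t|circle_measure. 0)"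
  proof (rule integral_dominated_convergence[where w = "\<lambda>_. (B * B + A * A + 1) * (M * N)"])
    have fg: "cmod (f (z n t) * cnj (g (z n t))) \<le> M * N" for n t
      unfolding norm_mult complex_mod_cnj by (intro mult_mono f g zb M) simp
    have Db: "cmod (D (z n t)) \<le> B * B + A * A + 1" for n t
    proof -
      have "cmod (D (z n t)) \<le> cmod (b (z n t) * cnj (b (z n t)) + a (z n t) * cnj (a (z n t))) + 1"
        unfolding D_def using norm_triangle_ineq4[of _ "1 :: complex"] by simp
      also have "\<dots> \<le> cmod (b (z n t)) * cmod (b (z n t)) + cmod (a (z n t)) * cmod (a (z n t)) + 1"
        using norm_triangle_ineq[of "b (z n t) * cnj (b (z n t))" "a (z n t) * cnj (a (z n t))"] by (simp add: norm_mult)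
      also have "\<dots> \<le> B * B + A * A + 1"
        using a(3) b(3) by (intro add_mono mult_mono a(2) b(2) zb) auto
      finally show ?thesis .
    qed
    show "AE t in circle_measure. (\<lambda>n. D (z n t) * (f (z n t) * cnj (g (z n t)))) \<longlonglongrightarrow> 0"
    proof -
      have "AE t in circle_measure. \<exists>\<beta> \<alpha>. radial_limit b t \<beta> \<and> radial_limit a t \<alpha> \<and> (cmod \<beta>)\<^sup>2 + (cmod \<alpha>)\<^sup>2 = 1"
        using pair by (simp add: pythagorean_pair_def)
      then show ?thesis
      proof eventually_elim
        case (elim t)
        then obtain \<beta> \<alpha> where *: "radial_limit b t \<beta>" "radial_limit a t \<alpha>" "(cmod \<beta>)\<^sup>2 + (cmod \<alpha>)\<^sup>2 = 1" by blast
        have "(\<lambda>n. b (z n t)) \<longlonglongrightarrow> \<beta>" "(\<lambda>n. a (z n t)) \<longlonglongrightarrow> \<alpha>"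
          using *(1,2) unfolding radial_limit_def z_def by (auto intro: filterlim_compose rad_filterlim)
        then have "(\<lambda>n. D (z n t)) \<longlonglongrightarrow> \<beta> * cnj \<beta> + \<alpha> * cnj \<alpha> - 1"
          unfolding D_def by (intro tendsto_intros)
        moreover have "\<beta> * cnj \<beta> + \<alpha> * cnj \<alpha> = of_real ((cmod \<beta>)\<^sup>2 + (cmod \<alpha>)\<^sup>2)"
          by (simp add: complex_norm_square[symmetric])
        ultimately have "(\<lambda>n. D (z n t)) \<longlonglongrightarrow> 0" using *(3) by simp
        from tendsto_mult_left[OF tendsto_norm[OF this], of "M * N"]
        have "(\<lambda>n. M * N * norm (D (z n t))) \<longlonglongrightarrow> 0" by simp
        then show ?case
        proof (rule Lim_null_comparison[rotated], intro always_eventually allI)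
          fix n
          show "norm (D (z n t) * (f (z n t) * cnj (g (z n t)))) \<le> M * N * norm (D (z n t))"
            unfolding norm_mult[of "D _"] by (subst mult.commute) (intro mult_right_mono fg norm_ge_zero)
        qed
      qed
    qed
    show "AE t in circle_measure. norm (D (z n t) * (f (z n t) * cnj (g (z n t)))) \<le> (B * B + A * A + 1) * (M * N)" for n
      unfolding norm_mult[of "D _"] using a(3) b(3) by (intro AE_I2 mult_mono Db fg) auto
    have "continuous_on UNIV (\<lambda>t. D (z n t) * (f (z n t) * cnj (g (z n t))))" for n
      unfolding D_def by (intro continuous_intros continuous_on_cnj cont a b f g)
    then show "(\<lambda>t. D (z n t) * (f (z n t) * cnj (g (z n t)))) \<in> borel_measurable circle_measure" for n
      by (rule continuous_circle_measurable)
  qed simp_all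
  then have "(\<lambda>n. I (\<lambda>z. b z * f z) (\<lambda>z. b z * g z) n + I (\<lambda>z. a z * f z) (\<lambda>z. a z * g z) n - I f g n) \<longlonglongrightarrow> 0"
    unfolding eq by simp
  from LIMSEQ_unique[OF L1 this] show ?thesis by simp
qed

text \<open>The injectivity assumption holds for every outer \<open>a\<close>. It makes companions unique.\<close>

locale injective_pythagorean_pair =
  fixes b a :: "complex \<Rightarrow> complex"
  assumes pair: "pythagorean_pair b a"
    and inj: "\<lbrakk>g \<in> l2; toeplitz (taylor_coeff a) g = (\<lambda>_. 0)\<rbrakk> \<Longrightarrow> g = (\<lambda>_. 0)"
begin

abbreviation "tb \<equiv> taylor_coeff b"
abbreviation "ta \<equiv> taylor_coeff a"

text \<open>Here \<open>g\<close> holds the coefficients of the function usually written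
  \<open>f^+\<close> in the theory of H(b) for a Pythagorean pair.\<close>

definition companion :: "(complex \<Rightarrow> complex) \<Rightarrow> (nat \<Rightarrow> complex) \<Rightarrow> bool" where
  "companion f g \<longleftrightarrow> f holomorphic_on ball 0 1 \<and> taylor_coeff f \<in> l2 \<and> g \<in> l2 \<and>
     toeplitz tb (taylor_coeff f) = toeplitz ta g"

definition dbr_space :: "(complex \<Rightarrow> complex) set" where
  "dbr_space = {f. \<exists>g. companion f g}"

definition dbr_plus :: "(complex \<Rightarrow> complex) \<Rightarrow> nat \<Rightarrow> complex" where
  "dbr_plus f = (SOME g. companion f g)"

text \<open>The inner product of the pairs consisting of a function and its companion, which
  identifies the space with a closed subspace of \<open>l2 \<times> l2\<close>.\<close>

definition inner_product :: "(complex \<Rightarrow> complex) \<Rightarrow> (complex \<Rightarrow> complex) \<Rightarrow> complex" where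
  "inner_product f h = l2_ip (taylor_coeff f) (taylor_coeff h) + l2_ip (dbr_plus f) (dbr_plus h)"

lemma b_props: "b holomorphic_on ball 0 1" "\<exists>M. multiplier tb M" "tb \<in> l2"
proof -
  obtain M where "b holomorphic_on ball 0 1" "multiplier tb M"
    using pair hardy_infinity_bounded multiplier_bounded unfolding pythagorean_pair_def by metis
  then show "b holomorphic_on ball 0 1" "\<exists>M. multiplier tb M" "tb \<in> l2" by (auto simp: multiplier_def)
qed

lemma a_props: "a holomorphic_on ball 0 1" "\<exists>M. multiplier ta M" "ta \<in> l2"
proof -
  obtain M where "a holomorphic_on ball 0 1" "multiplier ta M"
    using pair hardy_infinity_bounded multiplier_bounded unfolding pythagorean_pair_def by metis
  then show "a holomorphic_on ball 0 1" "\<exists>M. multiplier ta M" "ta \<in> l2" by (auto simp: multiplier_def)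
qed

lemma companion_unique:
  assumes "companion f g" "companion f h"
  shows "g = h"
proof -
  have gh: "g \<in> l2" "h \<in> l2" "toeplitz ta g = toeplitz ta h"
    using assms by (auto simp: companion_def)
  then have "toeplitz ta (\<lambda>n. g n - h n) = (\<lambda>_. 0)"
    by (simp add: toeplitz_diff a_props)
  from inj[OF l2.diff_closed[OF gh(1,2)] this] show ?thesis by (simp add: fun_eq_iff)
qed

lemma plus_eq: "companion f g \<Longrightarrow> dbr_plus f = g"
  unfolding dbr_plus_def by (rule some_equality) (auto intro: companion_unique)

lemma companion_plus: "f \<in> dbr_space \<Longrightarrow> companion f (dbr_plus f)"
  unfolding dbr_space_def using plus_eq by auto

lemma companion_space: "companion f g \<Longrightarrow> f \<in> dbr_space"
  unfolding dbr_space_def by blast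

lemma companion_zero: "companion (\<lambda>z. 0) (\<lambda>n. 0)"
  unfolding companion_def by (simp add: taylor_coeff_const toeplitz_def l2.zero_closed fun_eq_iff)

lemma companion_add:
  assumes "companion f g" "companion f' g'"
  shows "companion (\<lambda>z. f z + f' z) (\<lambda>n. g n + g' n)"
  using assms unfolding companion_def
  by (auto simp: taylor_coeff_add l2.add_closed toeplitz_add a_props b_props intro!: holomorphic_intros)

lemma companion_scale:
  assumes "companion f g"
  shows "companion (\<lambda>z. c * f z) (\<lambda>n. c * g n)"
  using assms unfolding companion_def
  by (auto simp: taylor_coeff_scale l2.scale_closed toeplitz_scale a_props b_props intro!: holomorphic_intros)

lemma companion_diff:
  assumes "companion f g" "companion f' g'"
  shows "companion (\<lambda>z. f z - f' z) (\<lambda>n. g n - g' n)"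
  using companion_add[OF assms(1) companion_scale[OF assms(2), of "-1"]] by simp

lemma companion_cong:
  assumes "companion f g" "\<And>z. z \<in> ball 0 1 \<Longrightarrow> h z = f z"
  shows "companion h g"
proof -
  have "taylor_coeff h = taylor_coeff f" by (rule taylor_coeff_cong[OF assms(2)])
  moreover have "h holomorphic_on ball 0 1"
    by (rule holomorphic_transform[of f]) (use assms in \<open>auto simp: companion_def\<close>)
  ultimately show ?thesis using assms(1) by (simp add: companion_def)
qed

lemma companion_l2: "companion f g \<Longrightarrow> taylor_coeff f \<in> l2" "companion f g \<Longrightarrow> g \<in> l2"
  by (auto simp: companion_def)

lemma dbr_space_l2: "f \<in> dbr_space \<Longrightarrow> taylor_coeff f \<in> l2" "f \<in> dbr_space \<Longrightarrow> dbr_plus f \<in> l2"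
  using companion_plus companion_l2 by blast+

lemma companion_norm:
  assumes "companion f g"
  shows "ip_norm inner_product f = sqrt ((l2_norm (taylor_coeff f))\<^sup>2 + (l2_norm g)\<^sup>2)"
  using plus_eq[OF assms] companion_l2[OF assms]
  by (simp add: ip_norm_def[of inner_product] inner_product_def l2.norm_sq)

text \<open>Each Toeplitz coefficient is an inner product with a fixed sequence, hence continuous in
  the \<open>l2\<close> norm, so the equation relating function and companion survives the
  limit.\<close>

lemma companion_limit:
  assumes c: "\<And>n :: nat. companion (s n) (g n)"
    and F: "F \<in> l2" "(\<lambda>n. l2_norm (\<lambda>k. taylor_coeff (s n) k - F k)) \<longlonglongrightarrow> 0"
    and G: "G \<in> l2" "(\<lambda>n. l2_norm (\<lambda>k. g n k - G k)) \<longlonglongrightarrow> 0"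
    and f: "f holomorphic_on ball 0 1" "taylor_coeff f = F"
  shows "companion f G"
proof -
  have lim: "(\<lambda>n. toeplitz u (x n) m) \<longlonglongrightarrow> toeplitz u y m"
    if "u \<in> l2" "\<And>n. x n \<in> l2" "y \<in> l2" "(\<lambda>n. l2_norm (\<lambda>k. x n k - y k)) \<longlonglongrightarrow> 0"
    for u m and x :: "nat \<Rightarrow> nat \<Rightarrow> complex" and y
    unfolding toeplitz_shift
  proof (rule l2.tendsto_ip)
    have "l2_norm (\<lambda>k. shift m (x n) k - shift m y k) \<le> l2_norm (\<lambda>k. x n k - y k)" for n
      using shift_norm[OF l2.diff_closed[OF that(2,3)], of m n] by (simp add: shift_def[abs_def])
    then show "(\<lambda>n. l2_norm (\<lambda>k. shift m (x n) k - shift m y k)) \<longlonglongrightarrow> 0"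
      by (intro Lim_null_comparison[OF _ that(4)] always_eventually allI)
        (simp add: l2.norm_nonneg l2.diff_closed that)
  qed (use that in auto)
  have "toeplitz tb F m = toeplitz ta G m" for m
  proof (rule LIMSEQ_unique)
    show "(\<lambda>n. toeplitz tb (taylor_coeff (s n)) m) \<longlonglongrightarrow> toeplitz tb F m"
      by (rule lim[OF b_props(3) _ F]) (use c in \<open>simp add: companion_def\<close>)
    have "(\<lambda>n. toeplitz ta (g n) m) \<longlonglongrightarrow> toeplitz ta G m"
      by (rule lim[OF a_props(3) _ G]) (use c in \<open>simp add: companion_def\<close>)
    moreover have "toeplitz tb (taylor_coeff (s n)) = toeplitz ta (g n)" for n
      using c by (simp add: companion_def)
    ultimately show "(\<lambda>n. toeplitz tb (taylor_coeff (s n)) m) \<longlonglongrightarrow> toeplitz ta G m" by simp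
  qed
  then show ?thesis using F(1) G(1) f by (auto simp: companion_def)
qed

text \<open>The kernel is \<open>k - cnj (b w) b k\<close> with \<open>k\<close> the Szego kernel at
  \<open>w\<close>. The coefficient of \<open>T_b k\<close> at \<open>m\<close> is
  \<open>cnj (b w) cnj (w ^ m)\<close>, and the isometry turns \<open>cnj (w ^ m)\<close> minus the
  inner product of \<open>b k\<close> with \<open>b z^m\<close> into the inner product of
  \<open>a k\<close> with \<open>a z^m\<close>. This is the coefficient of \<open>T_a (a k)\<close>,
  so the companion is \<open>cnj (b w) a k\<close>.\<close>

lemma companion_kernel:
  assumes w: "w \<in> ball 0 1"
  shows "companion (\<lambda>z. dbr_kernel b z w) (\<lambda>n. cnj (b w) * taylor_coeff (\<lambda>z. a z * szego w z) n)"
    and "taylor_coeff (\<lambda>z. dbr_kernel b z w) =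
      (\<lambda>n. taylor_coeff (szego w) n - cnj (b w) * taylor_coeff (\<lambda>z. b z * szego w z) n)"
proof -
  obtain B A where B: "multiplier tb B" and A: "multiplier ta A" using b_props a_props by blast
  note k = szego_taylor(1)[OF w] and kb = szego_bound[OF w]
  have kl2: "taylor_coeff (szego w) \<in> l2" by (rule bounded_taylor_l2[OF k kb])
  have bk: "(\<lambda>z. b z * szego w z) holomorphic_on ball 0 1" and ak: "(\<lambda>z. a z * szego w z) holomorphic_on ball 0 1"
    by (intro holomorphic_intros a_props b_props k)+
  have bkl2: "taylor_coeff (\<lambda>z. b z * szego w z) \<in> l2" and akl2: "taylor_coeff (\<lambda>z. a z * szego w z) \<in> l2"
    using A B kl2 unfolding taylor_coeff_mult[OF b_props(1) k] taylor_coeff_mult[OF a_props(1) k]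
    by (auto simp: multiplier_def)
  have K: "(\<lambda>z. dbr_kernel b z w) = (\<lambda>z. szego w z - cnj (b w) * (b z * szego w z))"
    by (simp add: fun_eq_iff dbr_kernel_def szego_def diff_divide_distrib)
  have cbk: "(\<lambda>z. cnj (b w) * (b z * szego w z)) holomorphic_on ball 0 1"
    by (intro holomorphic_intros bk b_props k)
  show T: "taylor_coeff (\<lambda>z. dbr_kernel b z w) =
      (\<lambda>n. taylor_coeff (szego w) n - cnj (b w) * taylor_coeff (\<lambda>z. b z * szego w z) n)"
    unfolding K taylor_coeff_diff[OF k cbk] taylor_coeff_scale[OF bk] ..
  have "toeplitz tb (taylor_coeff (\<lambda>z. dbr_kernel b z w)) m =
      toeplitz ta (\<lambda>n. cnj (b w) * taylor_coeff (\<lambda>z. a z * szego w z) n) m" for m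
  proof -
    have zm: "(\<lambda>z::complex. z ^ m) holomorphic_on ball 0 1" by (intro holomorphic_intros)
    have bz: "(\<lambda>z. b z * z ^ m) holomorphic_on ball 0 1" by (intro holomorphic_intros b_props)
    have zb: "cmod (z ^ m) \<le> 1" if "z \<in> ball 0 1" for z
      using that by (simp add: norm_power power_le_one)
    have zl2: "taylor_coeff (\<lambda>z. z ^ m) \<in> l2" by (rule bounded_taylor_l2[OF zm zb])
    have bzl2: "taylor_coeff (\<lambda>z. b z * z ^ m) \<in> l2"
      using B zl2 unfolding taylor_coeff_mult[OF b_props(1) zm] by (simp add: multiplier_def)
    have rep: "l2_ip (taylor_coeff (szego w)) (taylor_coeff h) = cnj (h w)"
      if "h holomorphic_on ball 0 1" "taylor_coeff h \<in> l2" for h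
      using szego_reproducing[OF that w] l2.ip_cnj[OF that(2) kl2] by simp
    let ?bb = "l2_ip (taylor_coeff (\<lambda>z. b z * szego w z)) (taylor_coeff (\<lambda>z. b z * z ^ m))"
    let ?aa = "l2_ip (taylor_coeff (\<lambda>z. a z * szego w z)) (taylor_coeff (\<lambda>z. a z * z ^ m))"
    have iso: "?bb + ?aa = cnj (w ^ m)"
      using pythagorean_isometry[OF pair k kb zm zb] rep[OF zm zl2] by simp
    have "toeplitz tb (taylor_coeff (\<lambda>z. dbr_kernel b z w)) m =
        toeplitz tb (taylor_coeff (szego w)) m - cnj (b w) * toeplitz tb (taylor_coeff (\<lambda>z. b z * szego w z)) m"
      unfolding T by (simp add: toeplitz_diff toeplitz_scale b_props kl2 bkl2 l2.scale_closed)
    also have "\<dots> = cnj (b w * w ^ m) - cnj (b w) * ?bb"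
      unfolding toeplitz_coeff[OF b_props(1) B kl2] toeplitz_coeff[OF b_props(1) B bkl2] rep[OF bz bzl2] ..
    also have "\<dots> = cnj (b w) * ?aa"
      unfolding complex_cnj_mult iso[symmetric] by (simp add: algebra_simps)
    also have "\<dots> = cnj (b w) * toeplitz ta (taylor_coeff (\<lambda>z. a z * szego w z)) m"
      unfolding toeplitz_coeff[OF a_props(1) A akl2] ..
    finally show ?thesis by (simp add: toeplitz_scale a_props akl2)
  qed
  moreover have "(\<lambda>z. dbr_kernel b z w) holomorphic_on ball 0 1"
    unfolding K by (intro holomorphic_intros k b_props)
  moreover have "taylor_coeff (\<lambda>z. dbr_kernel b z w) \<in> l2"
    unfolding T by (intro l2.diff_closed l2.scale_closed kl2 bkl2)
  ultimately show "companion (\<lambda>z. dbr_kernel b z w) (\<lambda>n. cnj (b w) * taylor_coeff (\<lambda>z. a z * szego w z) n)"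
    unfolding companion_def using l2.scale_closed[OF akl2] by (auto simp: fun_eq_iff)
qed

text \<open>By the adjoint relations and \<open>T_b f = T_a g\<close>, the inner product of
  \<open>f\<close> with \<open>b k\<close> equals that of \<open>g\<close> with \<open>a k\<close>.
  The two contributions with factor \<open>b w\<close> cancel and the Szego kernel evaluates
  \<open>f\<close> at \<open>w\<close>.\<close>

lemma inner_product_kernel:
  assumes f: "f \<in> dbr_space" and w: "w \<in> ball 0 1"
  shows "inner_product f (\<lambda>z. dbr_kernel b z w) = f w"
proof -
  obtain B A where B: "multiplier tb B" and A: "multiplier ta A" using b_props a_props by blast
  note k = szego_taylor(1)[OF w]
  have c: "companion f (dbr_plus f)" by (rule companion_plus[OF f])
  then have hol: "f holomorphic_on ball 0 1" and T: "toeplitz tb (taylor_coeff f) = toeplitz ta (dbr_plus f)"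
    by (auto simp: companion_def)
  note fl2 = dbr_space_l2(1)[OF f] and pl2 = dbr_space_l2(2)[OF f]
  have kl2: "taylor_coeff (szego w) \<in> l2" by (rule szego_reproducing(1)[OF hol fl2 w])
  have bk: "taylor_coeff (\<lambda>z. b z * szego w z) = conv tb (taylor_coeff (szego w))"
    and ak: "taylor_coeff (\<lambda>z. a z * szego w z) = conv ta (taylor_coeff (szego w))"
    by (rule taylor_coeff_mult[OF b_props(1) k], rule taylor_coeff_mult[OF a_props(1) k])
  have bkl2: "conv tb (taylor_coeff (szego w)) \<in> l2" and akl2: "conv ta (taylor_coeff (szego w)) \<in> l2"
    using A B kl2 by (auto simp: multiplier_def)
  have "inner_product f (\<lambda>z. dbr_kernel b z w) =
      l2_ip (taylor_coeff f) (taylor_coeff (szego w)) - b w * l2_ip (taylor_coeff f) (conv tb (taylor_coeff (szego w)))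
      + b w * l2_ip (dbr_plus f) (conv ta (taylor_coeff (szego w)))"
    unfolding inner_product_def plus_eq[OF companion_kernel(1)[OF w]] companion_kernel(2)[OF w] bk ak
    by (simp add: l2.ip_diff_right l2.ip_scale_right l2.scale_closed fl2 pl2 kl2 bkl2 akl2)
  also have "l2_ip (taylor_coeff f) (conv tb (taylor_coeff (szego w))) = l2_ip (dbr_plus f) (conv ta (taylor_coeff (szego w)))"
    using toeplitz_adjoint[OF B fl2 kl2] toeplitz_adjoint[OF A pl2 kl2] T by simp
  finally show ?thesis by (simp add: szego_reproducing(2)[OF hol fl2 w])
qed

text \<open>Coefficients and companions are separately Cauchy in \<open>l2\<close>; closedness of
  the defining equation keeps the pair of limits in the space.\<close>

lemma dbr_space_complete:
  assumes s: "\<And>n :: nat. s n \<in> dbr_space"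
    and cauchy: "\<forall>e>0. \<exists>N. \<forall>m\<ge>N. \<forall>n\<ge>N. ip_norm inner_product (\<lambda>x. s m x - s n x) < e"
  shows "\<exists>f\<in>dbr_space. (\<lambda>n. ip_norm inner_product (\<lambda>x. s n x - f x)) \<longlonglongrightarrow> 0"
proof -
  have c: "companion (s n) (dbr_plus (s n))" for n by (rule companion_plus[OF s])
  have hol: "s n holomorphic_on ball 0 1" for n using c by (simp add: companion_def)
  have N: "ip_norm inner_product (\<lambda>x. s m x - s n x) =
      sqrt ((l2_norm (\<lambda>k. taylor_coeff (s m) k - taylor_coeff (s n) k))\<^sup>2 + (l2_norm (\<lambda>k. dbr_plus (s m) k - dbr_plus (s n) k))\<^sup>2)" for m n
    using companion_norm[OF companion_diff[OF c[of m] c[of n]]] unfolding taylor_coeff_diff[OF hol hol] .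
  have le: "l2_norm (\<lambda>k. taylor_coeff (s m) k - taylor_coeff (s n) k) \<le> ip_norm inner_product (\<lambda>x. s m x - s n x)"
    "l2_norm (\<lambda>k. dbr_plus (s m) k - dbr_plus (s n) k) \<le> ip_norm inner_product (\<lambda>x. s m x - s n x)" for m n
    unfolding N by (intro real_le_rsqrt, simp)+
  have "\<exists>F\<in>l2. (\<lambda>n. l2_norm (\<lambda>k. taylor_coeff (s n) k - F k)) \<longlonglongrightarrow> 0"
    by (rule l2.complete[OF dbr_space_l2(1)[OF s]]) (use cauchy le(1) in \<open>meson le_less_trans\<close>)
  then obtain F where F: "F \<in> l2" "(\<lambda>n. l2_norm (\<lambda>k. taylor_coeff (s n) k - F k)) \<longlonglongrightarrow> 0" by blast
  have "\<exists>G\<in>l2. (\<lambda>n. l2_norm (\<lambda>k. dbr_plus (s n) k - G k)) \<longlonglongrightarrow> 0"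
    by (rule l2.complete[OF dbr_space_l2(2)[OF s]]) (use cauchy le(2) in \<open>meson le_less_trans\<close>)
  then obtain G where G: "G \<in> l2" "(\<lambda>n. l2_norm (\<lambda>k. dbr_plus (s n) k - G k)) \<longlonglongrightarrow> 0" by blast
  obtain f where f: "f holomorphic_on ball 0 1" "taylor_coeff f = F"
    using l2_holomorphic_extension[OF F(1)] .
  have cf: "companion f G" by (rule companion_limit[OF c F G f])
  have "ip_norm inner_product (\<lambda>x. s n x - f x) =
      sqrt ((l2_norm (\<lambda>k. taylor_coeff (s n) k - F k))\<^sup>2 + (l2_norm (\<lambda>k. dbr_plus (s n) k - G k))\<^sup>2)" for n
    using companion_norm[OF companion_diff[OF c[of n] cf]] unfolding taylor_coeff_diff[OF hol f(1)] f(2) .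
  moreover have "(\<lambda>n. sqrt ((l2_norm (\<lambda>k. taylor_coeff (s n) k - F k))\<^sup>2 + (l2_norm (\<lambda>k. dbr_plus (s n) k - G k))\<^sup>2))
      \<longlonglongrightarrow> sqrt (0\<^sup>2 + 0\<^sup>2)"
    by (intro tendsto_intros F G)
  ultimately have "(\<lambda>n. ip_norm inner_product (\<lambda>x. s n x - f x)) \<longlonglongrightarrow> 0" by simp
  with companion_space[OF cf] show ?thesis by blast
qed

lemma inner_product_self:
  assumes "f \<in> dbr_space"
  shows "inner_product f f = of_real ((l2_norm (taylor_coeff f))\<^sup>2 + (l2_norm (dbr_plus f))\<^sup>2)"
  unfolding inner_product_def using l2.ip_self dbr_space_l2[OF assms] by simp

lemma dbr_space_rkhs: "reproducing_kernel_hilbert_space (ball 0 1) dbr_space inner_product (dbr_kernel b)"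
proof
  show "\<And>f g. f \<in> dbr_space \<Longrightarrow> (\<And>x. x \<in> ball 0 1 \<Longrightarrow> g x = f x) \<Longrightarrow> g \<in> dbr_space"
    using companion_cong companion_plus companion_space by metis
  show "(\<lambda>x. 0) \<in> dbr_space" by (rule companion_space[OF companion_zero])
  show "\<And>f g. f \<in> dbr_space \<Longrightarrow> g \<in> dbr_space \<Longrightarrow> (\<lambda>x. f x + g x) \<in> dbr_space"
    by (rule companion_space[OF companion_add[OF companion_plus companion_plus]])
  show "\<And>f c. f \<in> dbr_space \<Longrightarrow> (\<lambda>x. c * f x) \<in> dbr_space"
    by (rule companion_space[OF companion_scale[OF companion_plus]])
next
  fix f g h assume fgh: "f \<in> dbr_space" "g \<in> dbr_space" "h \<in> dbr_space"
  have hol: "f holomorphic_on ball 0 1" "g holomorphic_on ball 0 1"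
    using companion_plus fgh by (auto simp: companion_def)
  show "inner_product (\<lambda>x. f x + g x) h = inner_product f h + inner_product g h"
    unfolding inner_product_def plus_eq[OF companion_add[OF companion_plus companion_plus, OF fgh(1,2)]]
      taylor_coeff_add[OF hol]
    by (simp add: l2.ip_add dbr_space_l2 fgh)
next
  fix f h c assume fh: "f \<in> dbr_space" "h \<in> dbr_space"
  have hol: "f holomorphic_on ball 0 1" using companion_plus fh by (auto simp: companion_def)
  show "inner_product (\<lambda>x. c * f x) h = c * inner_product f h"
    unfolding inner_product_def plus_eq[OF companion_scale[OF companion_plus, OF fh(1)]] taylor_coeff_scale[OF hol]
    by (simp add: l2.ip_scale dbr_space_l2 fh distrib_left)
next
  fix f g assume fg: "f \<in> dbr_space" "g \<in> dbr_space"
  show "inner_product g f = cnj (inner_product f g)"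
    unfolding inner_product_def complex_cnj_add
    by (intro arg_cong2[of _ _ _ _ "(+)"] l2.ip_cnj dbr_space_l2 fg)
next
  fix f assume f: "f \<in> dbr_space"
  show "0 \<le> Re (inner_product f f)" using inner_product_self[OF f] by simp
  have hol: "f holomorphic_on ball 0 1" using companion_plus f by (auto simp: companion_def)
  show "(inner_product f f = 0) = (\<forall>x\<in>ball 0 1. f x = 0)"
  proof
    assume "inner_product f f = 0"
    then have "(l2_norm (taylor_coeff f))\<^sup>2 + (l2_norm (dbr_plus f))\<^sup>2 = 0"
      unfolding inner_product_self[OF f] of_real_eq_0_iff .
    then have "l2_norm (taylor_coeff f) = 0" by (simp add: sum_power2_eq_zero_iff)
    then have "taylor_coeff f = (\<lambda>n. 0)" using l2.norm_eq_0_iff[OF dbr_space_l2(1)[OF f]] by auto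
    then show "\<forall>x\<in>ball 0 1. f x = 0" using taylor_sums[OF hol] by (simp add: sums_iff)
  next
    assume 0: "\<forall>x\<in>ball 0 1. f x = 0"
    have "companion f (\<lambda>n. 0)" by (rule companion_cong[OF companion_zero]) (use 0 in auto)
    then have "dbr_plus f = (\<lambda>n. 0)" by (rule plus_eq)
    moreover have "taylor_coeff f = (\<lambda>n. 0)"
      using taylor_coeff_cong[of f "\<lambda>_. 0"] 0 by (simp add: taylor_coeff_const)
    ultimately show "inner_product f f = 0" by (simp add: inner_product_def l2_ip_def)
  qed
next
  fix s :: "nat \<Rightarrow> complex \<Rightarrow> complex"
  assume "\<And>n. s n \<in> dbr_space"
    "\<forall>e>0. \<exists>N. \<forall>m\<ge>N. \<forall>n\<ge>N. ip_norm inner_product (\<lambda>x. s m x - s n x) < e"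
  then show "\<exists>f\<in>dbr_space. (\<lambda>n. ip_norm inner_product (\<lambda>x. s n x - f x)) \<longlonglongrightarrow> 0"
    by (rule dbr_space_complete)
next
  fix f w assume w: "w \<in> ball (0 :: complex) 1"
  show "(\<lambda>z. dbr_kernel b z w) \<in> dbr_space" by (rule companion_space[OF companion_kernel(1)[OF w]])
  show "inner_product f (\<lambda>z. dbr_kernel b z w) = f w" if "f \<in> dbr_space"
    by (rule inner_product_kernel[OF that w])
qed

end

subsection \<open>Truncation of the outer function\<close>

text \<open>With \<open>e\<close> the coefficients of the constant 1, the error is the inner product
  of \<open>shift m g\<close> with \<open>v \<epsilon> - e\<close>, and the squared norm of
  \<open>v \<epsilon> - e\<close> is at most \<open>2 - 2 * Re (v \<epsilon> 0)\<close>.\<close>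

lemma multiplier_one_tendsto:
  assumes v: "eventually (\<lambda>\<epsilon>. multiplier (v \<epsilon>) 1) F" and lim: "((\<lambda>\<epsilon>. v \<epsilon> 0) \<longlongrightarrow> 1) F" and g: "g \<in> l2"
  shows "((\<lambda>\<epsilon>. toeplitz (v \<epsilon>) g m) \<longlongrightarrow> g m) F"
proof -
  define e :: "nat \<Rightarrow> complex" where "e n = (if n = 0 then 1 else 0)" for n
  have e: "e \<in> l2" unfolding l2_def mem_Collect_eq by (rule summable_finite[of "{0}"]) (auto simp: e_def)
  have ip_e: "l2_ip x e = x 0" for x
    unfolding l2_ip_def by (subst suminf_finite[of "{0}"]) (auto simp: e_def)
  have ne: "(l2_norm e)\<^sup>2 = 1" by (simp add: l2.norm_sq[OF e] ip_e) (simp add: e_def)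
  have "((\<lambda>\<epsilon>. sqrt (2 - 2 * Re (v \<epsilon> 0))) \<longlongrightarrow> sqrt (2 - 2 * Re 1)) F"
    by (intro tendsto_intros lim)
  then have z: "((\<lambda>\<epsilon>. sqrt (2 - 2 * Re (v \<epsilon> 0)) * l2_norm g) \<longlongrightarrow> 0) F"
    by (intro tendsto_mult_left_zero) simp
  have "eventually (\<lambda>\<epsilon>. norm (toeplitz (v \<epsilon>) g m - g m) \<le> sqrt (2 - 2 * Re (v \<epsilon> 0)) * l2_norm g) F"
    using v
  proof eventually_elim
    case (elim \<epsilon>)
    then have vl2: "v \<epsilon> \<in> l2" by (simp add: multiplier_def)
    \<comment> \<open>Applying the multiplier bound to the constant 1 shows that
      \<open>v \<epsilon>\<close> has norm at most 1.\<close>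
    have "conv (v \<epsilon>) e n = v \<epsilon> n" for n
    proof -
      have "conv (v \<epsilon>) e n = (\<Sum>i\<le>n. if i = 0 then v \<epsilon> n else 0)"
        unfolding conv_def by (rule sum.cong) (auto simp: e_def)
      then show ?thesis by simp
    qed
    then have "l2_norm (v \<epsilon>) \<le> 1 * l2_norm e"
      using elim e unfolding multiplier_def by (metis ext)
    then have "(l2_norm (v \<epsilon>))\<^sup>2 \<le> (l2_norm e)\<^sup>2" by (intro power_mono l2.norm_nonneg vl2) simp
    then have "(l2_norm (\<lambda>n. v \<epsilon> n - e n))\<^sup>2 \<le> 2 - 2 * Re (v \<epsilon> 0)"
      using l2.norm_sq_diff[OF vl2 e, of 1] by (simp add: ne ip_e)
    then have le: "l2_norm (\<lambda>n. v \<epsilon> n - e n) \<le> sqrt (2 - 2 * Re (v \<epsilon> 0))" by (rule real_le_rsqrt)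
    have "toeplitz (v \<epsilon>) g m - g m = l2_ip (shift m g) (\<lambda>n. v \<epsilon> n - e n)"
      unfolding toeplitz_shift by (simp add: l2.ip_diff_right vl2 e g ip_e) (simp add: shift_def)
    also have "cmod \<dots> \<le> l2_norm (shift m g) * l2_norm (\<lambda>n. v \<epsilon> n - e n)"
      by (intro l2.cauchy_schwarz l2.diff_closed vl2 e shift_l2 g)
    also have "\<dots> \<le> l2_norm g * sqrt (2 - 2 * Re (v \<epsilon> 0))"
      by (intro mult_mono shift_norm g le l2.norm_nonneg l2.diff_closed vl2 e)
    finally show ?case by (simp add: mult.commute)
  qed
  from Lim_null_comparison[OF this z] show ?thesis using Lim_null by blast
qed

lemma outer_nonzero: "outer g \<Longrightarrow> z \<in> ball 0 1 \<Longrightarrow> g z \<noteq> 0"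
  using outer_modulus[of g] by (metis exp_not_eq_zero norm_eq_zero)

theorem theorem7p1:
  fixes a b f :: "complex \<Rightarrow> complex"
    and a_eps :: "real \<Rightarrow> complex \<Rightarrow> complex"
    and phi :: "real \<Rightarrow> complex \<Rightarrow> complex"
    and Hb :: "(complex \<Rightarrow> complex) set"
    and ip :: "(complex \<Rightarrow> complex) \<Rightarrow> (complex \<Rightarrow> complex) \<Rightarrow> complex"
  assumes pair: "pythagorean_pair b a"
    and Hb: "de_branges_rovnyak b Hb ip"
    and a_eps: "\<And>\<epsilon>. \<epsilon> > 0 \<Longrightarrow> outer_truncation a \<epsilon> (a_eps \<epsilon>)"
    and phi: "\<And>\<epsilon> z. \<epsilon> > 0 \<Longrightarrow> z \<in> ball 0 1 \<Longrightarrow> phi \<epsilon> z = b z / a_eps \<epsilon> z"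
  shows
    \<comment> \<open>for f in H(b) or in H^2, all the series involved converge\<close>
    "(f \<in> Hb \<or> f \<in> hardy 2 \<longrightarrow>
       summable (\<lambda>m. (cmod (taylor_coeff f m))\<^sup>2) \<and>
       (\<forall>\<epsilon>>0.
          (\<forall>m. summable (\<lambda>n. cnj (taylor_coeff (phi \<epsilon>) n) * taylor_coeff f (m + n))) \<and>
          summable (\<lambda>m. (cmod (\<Sum>n. cnj (taylor_coeff (phi \<epsilon>) n) * taylor_coeff f (m + n)))\<^sup>2)))
     \<and>
     (f \<in> Hb \<longrightarrow>
       (\<exists>L. ((\<lambda>\<epsilon>. \<Sum>m. (cmod (\<Sum>n. cnj (taylor_coeff (phi \<epsilon>) n) * taylor_coeff f (m + n)))\<^sup>2)
               \<longlongrightarrow> L) (at_right 0) \<and>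
            (ip_norm ip f)\<^sup>2 = (\<Sum>m. (cmod (taylor_coeff f m))\<^sup>2) + L))
     \<and>
     (f \<in> hardy 2 \<and> f \<notin> Hb \<longrightarrow>
       filterlim (\<lambda>\<epsilon>. \<Sum>m. (cmod (\<Sum>n. cnj (taylor_coeff (phi \<epsilon>) n) * taylor_coeff f (m + n)))\<^sup>2)
         at_top (at_right 0))"
proof -
  obtain B where b: "b holomorphic_on ball 0 1" "\<And>z. z \<in> ball 0 1 \<Longrightarrow> cmod (b z) \<le> B" "B > 0"
    using pair hardy_infinity_bounded unfolding pythagorean_pair_def by blast
  obtain A where a: "a holomorphic_on ball 0 1" "\<And>z. z \<in> ball 0 1 \<Longrightarrow> cmod (a z) \<le> A" "A > 0"
    using pair hardy_infinity_bounded unfolding pythagorean_pair_def by blast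
  have a_out: "outer a" "a 0 \<in> \<real>" "Re (a 0) > 0" using pair by (auto simp: pythagorean_pair_def)
  note est = outer_truncation_estimates[OF a_out a_eps]
  \<comment> \<open>The common factor of the other two symbols: \<open>p\<close> is the product of
    \<open>b\<close> and \<open>q\<close>, and \<open>v\<close> is that of \<open>a\<close> and
    \<open>q\<close>. Thus \<open>T_q\<close> maps \<open>T_b f\<close> to \<open>T_p f\<close> and
    \<open>T_a g\<close> to \<open>T_v g\<close>.\<close>
  define q where "q \<epsilon> = taylor_coeff (\<lambda>z. 1 / a_eps \<epsilon> z)" for \<epsilon>
  define v where "v \<epsilon> = taylor_coeff (\<lambda>z. a z * (1 / a_eps \<epsilon> z))" for \<epsilon>
  define p where "p \<epsilon> = taylor_coeff (phi \<epsilon>)" for \<epsilon>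
  let ?tb = "taylor_coeff b" and ?ta = "taylor_coeff a" and ?tf = "taylor_coeff f"
  have mb: "multiplier ?tb B" and ma: "multiplier ?ta A"
    by (rule multiplier_bounded[OF b(1,2)], assumption, rule multiplier_bounded[OF a(1,2)], assumption)
  have inv_hol: "(\<lambda>z. 1 / a_eps \<epsilon> z) holomorphic_on ball 0 1" if e: "\<epsilon> > 0" for \<epsilon>
  proof -
    have o: "outer (a_eps \<epsilon>)" using a_eps[OF e] by (simp add: outer_truncation_def)
    show ?thesis by (intro holomorphic_intros outer_holomorphic o outer_nonzero)
  qed
  have ge: "cmod (1 / a_eps \<epsilon> z) \<le> 1 / \<epsilon>" if "\<epsilon> > 0" "z \<in> ball 0 1" for \<epsilon> z
    using est(1)[OF _ that] that by (simp add: norm_divide frac_le)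
  have mq: "multiplier (q \<epsilon>) (1 / \<epsilon>)" if "\<epsilon> > 0" for \<epsilon>
    unfolding q_def by (rule multiplier_bounded[OF inv_hol[OF that] ge[OF that]])
  have mv: "multiplier (v \<epsilon>) 1" if e: "\<epsilon> > 0" for \<epsilon>
    unfolding v_def
  proof (rule multiplier_bounded)
    show "(\<lambda>z. a z * (1 / a_eps \<epsilon> z)) holomorphic_on ball 0 1" by (intro holomorphic_on_mult a inv_hol e)
    show "cmod (a z * (1 / a_eps \<epsilon> z)) \<le> 1" if "z \<in> ball 0 1" for z
      using est(2)[OF _ e that] by (simp add: norm_divide norm_mult divide_le_eq_1)
  qed
  have p_conv: "p \<epsilon> = conv ?tb (q \<epsilon>)" and v_conv: "v \<epsilon> = conv ?ta (q \<epsilon>)" if e: "\<epsilon> > 0" for \<epsilon>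
  proof -
    have "p \<epsilon> = taylor_coeff (\<lambda>z. b z * (1 / a_eps \<epsilon> z))"
      unfolding p_def by (rule taylor_coeff_cong) (simp add: phi[OF e])
    then show "p \<epsilon> = conv ?tb (q \<epsilon>)" unfolding q_def using taylor_coeff_mult[OF b(1) inv_hol[OF e]] by simp
    show "v \<epsilon> = conv ?ta (q \<epsilon>)" unfolding v_def q_def by (rule taylor_coeff_mult[OF a(1) inv_hol[OF e]])
  qed
  have mp: "multiplier (p \<epsilon>) (B * (1 / \<epsilon>))" if e: "\<epsilon> > 0" for \<epsilon>
  proof -
    have "p \<epsilon> = taylor_coeff (\<lambda>z. b z * (1 / a_eps \<epsilon> z))"
      unfolding p_def by (rule taylor_coeff_cong) (simp add: phi[OF e])
    moreover have "multiplier (taylor_coeff (\<lambda>z. b z * (1 / a_eps \<epsilon> z))) (B * (1 / \<epsilon>))"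
    proof (rule multiplier_bounded)
      show "(\<lambda>z. b z * (1 / a_eps \<epsilon> z)) holomorphic_on ball 0 1" by (intro holomorphic_on_mult b inv_hol e)
      show "cmod (b z * (1 / a_eps \<epsilon> z)) \<le> B * (1 / \<epsilon>)" if "z \<in> ball 0 1" for z
        unfolding norm_mult[of "b z"] using b(3) by (intro mult_mono b(2) ge e that) auto
    qed
    ultimately show ?thesis by simp
  qed
  \<comment> \<open>The products \<open>phi a\<close> and \<open>b v\<close> coincide. This yields
    \<open>T_a T_phi f = T_v T_b f\<close>, the relation that identifies the weak limit in the
    divergence part.\<close>
  have pa: "conv (p \<epsilon>) ?ta = conv ?tb (v \<epsilon>)" if e: "\<epsilon> > 0" for \<epsilon>
  proof -
    have h: "(\<lambda>z. b z * (1 / a_eps \<epsilon> z)) holomorphic_on ball 0 1" "(\<lambda>z. a z * (1 / a_eps \<epsilon> z)) holomorphic_on ball 0 1"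
      by (intro holomorphic_on_mult a b inv_hol e)+
    have "p \<epsilon> = taylor_coeff (\<lambda>z. b z * (1 / a_eps \<epsilon> z))"
      unfolding p_def by (rule taylor_coeff_cong) (simp add: phi[OF e])
    then have "conv (p \<epsilon>) ?ta = taylor_coeff (\<lambda>z. b z * (1 / a_eps \<epsilon> z) * a z)"
      using taylor_coeff_mult[OF h(1) a(1)] by simp
    also have "(\<lambda>z. b z * (1 / a_eps \<epsilon> z) * a z) = (\<lambda>z. b z * (a z * (1 / a_eps \<epsilon> z)))"
      by (simp add: fun_eq_iff)
    also have "taylor_coeff \<dots> = conv ?tb (v \<epsilon>)"
      unfolding v_def by (rule taylor_coeff_mult[OF b(1) h(2)])
    finally show ?thesis .
  qed
  have pos: "eventually (\<lambda>\<epsilon>::real. \<epsilon> > 0) (at_right 0)" by (rule eventually_at_right_less)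
  have v0: "((\<lambda>\<epsilon>. v \<epsilon> 0) \<longlongrightarrow> 1) (at_right 0)"
  proof (rule Lim_transform_eventually)
    show "((\<lambda>\<epsilon>. a 0 / a_eps \<epsilon> 0) \<longlongrightarrow> 1) (at_right 0)" by (rule est(3))
    show "eventually (\<lambda>\<epsilon>. a 0 / a_eps \<epsilon> 0 = v \<epsilon> 0) (at_right 0)"
      using pos
    proof eventually_elim
      case (elim \<epsilon>)
      show ?case unfolding v_def taylor_coeff_0[OF holomorphic_on_mult[OF a(1) inv_hol[OF elim]]] by simp
    qed
  qed
  have v_lim: "((\<lambda>\<epsilon>. toeplitz (v \<epsilon>) g m) \<longlongrightarrow> g m) (at_right 0)" if "g \<in> l2" for g m
    by (rule multiplier_one_tendsto[where v = v, OF _ v0 that]) (use pos mv in \<open>auto elim: eventually_mono\<close>)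
  have qa: "toeplitz (q \<epsilon>) (toeplitz ?ta g) = toeplitz (v \<epsilon>) g" if "\<epsilon> > 0" "g \<in> l2" for \<epsilon> g
    using toeplitz_toeplitz[OF ma _ that(2), of "q \<epsilon>"] mq[OF that(1)] v_conv[OF that(1)] by (simp add: multiplier_def)
  have qb: "toeplitz (q \<epsilon>) (toeplitz ?tb g) = toeplitz (p \<epsilon>) g" if "\<epsilon> > 0" "g \<in> l2" for \<epsilon> g
    using toeplitz_toeplitz[OF mb _ that(2), of "q \<epsilon>"] mq[OF that(1)] p_conv[OF that(1)] by (simp add: multiplier_def)
  interpret P: injective_pythagorean_pair b a
  proof
    show "pythagorean_pair b a" by (rule pair)
    fix g assume g: "g \<in> l2" "toeplitz ?ta g = (\<lambda>_. 0)"
    \<comment> \<open>If \<open>T_a g = 0\<close>, then \<open>T_v g = T_q T_a g\<close> vanishes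
      for every positive \<epsilon>, although it tends to \<open>g\<close> as \<epsilon> tends to
      0.\<close>
    have "g m = 0" for m
    proof (rule tendsto_unique[OF _ v_lim[OF g(1)]])
      show "((\<lambda>\<epsilon>. toeplitz (v \<epsilon>) g m) \<longlongrightarrow> 0) (at_right 0)"
      proof (rule tendsto_eventually)
        show "eventually (\<lambda>\<epsilon>. toeplitz (v \<epsilon>) g m = 0) (at_right 0)"
          using pos by eventually_elim (simp add: qa[OF _ g(1), symmetric] g(2) toeplitz_def)
      qed
    qed simp
    then show "g = (\<lambda>_. 0)" by auto
  qed
  have R: "reproducing_kernel_hilbert_space (ball 0 1) Hb ip (dbr_kernel b)"
    using Hb by (simp add: de_branges_rovnyak_def)
  have Hb_eq: "Hb = P.dbr_space" by (rule rkhs_unique(1)[OF R P.dbr_space_rkhs])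
  have N: "(\<Sum>m. (cmod (\<Sum>n. cnj (taylor_coeff (phi \<epsilon>) n) * ?tf (m + n)))\<^sup>2) = (l2_norm (toeplitz (p \<epsilon>) ?tf))\<^sup>2"
    if "\<epsilon> > 0" "?tf \<in> l2" for \<epsilon>
    using l2_norm_sq[OF toeplitz_bounded(1)[OF mp[OF that(1)] that(2)]] by (simp add: toeplitz_def p_def)
  show ?thesis
  proof (intro conjI impI allI)
    assume "f \<in> Hb \<or> f \<in> hardy 2"
    then have tf: "?tf \<in> l2" using P.dbr_space_l2(1) hardy_2_l2(2) unfolding Hb_eq by blast
    then show "summable (\<lambda>m. (cmod (?tf m))\<^sup>2)" by (simp add: l2_def)
    fix \<epsilon> :: real assume e: "\<epsilon> > 0"
    show "summable (\<lambda>n. cnj (taylor_coeff (phi \<epsilon>) n) * ?tf (m + n))" for m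
      using toeplitz_summable[of "p \<epsilon>" ?tf m] mp[OF e] tf by (simp add: multiplier_def p_def)
    show "summable (\<lambda>m. (cmod (\<Sum>n. cnj (taylor_coeff (phi \<epsilon>) n) * ?tf (m + n)))\<^sup>2)"
      using toeplitz_bounded(1)[OF mp[OF e] tf] by (simp add: l2_def toeplitz_def p_def)
  next
    assume f: "f \<in> Hb"
    then have fs: "f \<in> P.dbr_space" by (simp add: Hb_eq)
    let ?g = "P.dbr_plus f"
    have tf: "?tf \<in> l2" and g: "?g \<in> l2" using P.dbr_space_l2[OF fs] .
    have T: "toeplitz ?tb ?tf = toeplitz ?ta ?g" using P.companion_plus[OF fs] by (simp add: P.companion_def)
    \<comment> \<open>Apply \<open>T_q\<close> to both sides of \<open>T\<close>.\<close>
    have pv: "toeplitz (p \<epsilon>) ?tf = toeplitz (v \<epsilon>) ?g" if "\<epsilon> > 0" for \<epsilon>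
      using qa[OF that g] qb[OF that tf] T by simp
    have "((\<lambda>\<epsilon>. (l2_norm (toeplitz (v \<epsilon>) ?g))\<^sup>2) \<longlongrightarrow> (l2_norm ?g)\<^sup>2) (at_right 0)"
    proof (rule l2_norm_convergence[OF v_lim[OF g] _ g])
      show "eventually (\<lambda>\<epsilon>. toeplitz (v \<epsilon>) ?g \<in> l2 \<and> l2_norm (toeplitz (v \<epsilon>) ?g) \<le> l2_norm ?g) (at_right 0)"
        using pos by eventually_elim (use toeplitz_bounded[OF mv g] in auto)
    qed
    then have "((\<lambda>\<epsilon>. \<Sum>m. (cmod (\<Sum>n. cnj (taylor_coeff (phi \<epsilon>) n) * ?tf (m + n)))\<^sup>2) \<longlongrightarrow> (l2_norm ?g)\<^sup>2) (at_right 0)"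
      by (rule Lim_transform_eventually) (use pos in \<open>eventually_elim, simp add: N tf pv\<close>)
    moreover have "(ip_norm ip f)\<^sup>2 = (l2_norm ?tf)\<^sup>2 + (l2_norm ?g)\<^sup>2"
      using rkhs_unique(2)[OF R P.dbr_space_rkhs f] P.companion_norm[OF P.companion_plus[OF fs]]
      by simp
    then have "(ip_norm ip f)\<^sup>2 = (\<Sum>m. (cmod (?tf m))\<^sup>2) + (l2_norm ?g)\<^sup>2"
      by (simp only: l2_norm_sq[OF tf])
    ultimately show "\<exists>L. ((\<lambda>\<epsilon>. \<Sum>m. (cmod (\<Sum>n. cnj (taylor_coeff (phi \<epsilon>) n) * ?tf (m + n)))\<^sup>2) \<longlongrightarrow> L) (at_right 0) \<and>
       (ip_norm ip f)\<^sup>2 = (\<Sum>m. (cmod (?tf m))\<^sup>2) + L" by blast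
  next
    assume f: "f \<in> hardy 2 \<and> f \<notin> Hb"
    then have hol: "f holomorphic_on ball 0 1" and tf: "?tf \<in> l2" using hardy_2_l2 by auto
    let ?N = "\<lambda>\<epsilon>. \<Sum>m. (cmod (\<Sum>n. cnj (taylor_coeff (phi \<epsilon>) n) * ?tf (m + n)))\<^sup>2"
    show "filterlim ?N at_top (at_right 0)"
    proof (rule ccontr)
      assume "\<not> filterlim ?N at_top (at_right 0)"
      then obtain Z where Z: "\<not> eventually (\<lambda>\<epsilon>. Z \<le> ?N \<epsilon>) (at_right 0)"
        unfolding filterlim_at_top by blast
      \<comment> \<open>Otherwise \<open>Z\<close> would be a lower bound on the whole interval from
        0 to \<open>1 / real (Suc n)\<close>, that is, eventually at 0 from the right.\<close>
      have "\<exists>\<epsilon>. 0 < \<epsilon> \<and> \<epsilon> < 1 / real (Suc n) \<and> ?N \<epsilon> < Z" for n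
      proof (rule ccontr)
        assume neg: "\<not> (\<exists>\<epsilon>. 0 < \<epsilon> \<and> \<epsilon> < 1 / real (Suc n) \<and> ?N \<epsilon> < Z)"
        have "eventually (\<lambda>\<epsilon>. Z \<le> ?N \<epsilon>) (at_right 0)"
          unfolding eventually_at_right_field
          by (rule exI[of _ "1 / real (Suc n)"]) (use neg not_le in auto)
        then show False using Z by blast
      qed
      then have "\<forall>n. \<exists>\<epsilon>. 0 < \<epsilon> \<and> \<epsilon> < 1 / real (Suc n) \<and> ?N \<epsilon> < Z" by blast
      from choice[OF this] obtain e where e: "\<And>n. 0 < e n" "\<And>n. e n < 1 / real (Suc n)" "\<And>n. ?N (e n) < Z"
        by blast
      have "e \<longlonglongrightarrow> 0"
      proof (rule tendsto_sandwich[OF _ _ tendsto_const LIMSEQ_inverse_real_of_nat])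
        show "eventually (\<lambda>n. 0 \<le> e n) sequentially" using e(1) less_imp_le by (intro always_eventually) blast
        show "eventually (\<lambda>n. e n \<le> inverse (real (Suc n))) sequentially"
          using e(2) less_imp_le by (intro always_eventually allI) (simp add: inverse_eq_divide less_imp_le)
      qed
      then have e_lim: "filterlim e (at_right 0) sequentially"
        using e(1) unfolding filterlim_at
        by (auto intro!: always_eventually simp: less_imp_neq[symmetric] less_imp_le)
      define s where "s n = toeplitz (p (e n)) ?tf" for n
      have s: "s n \<in> l2" for n unfolding s_def by (rule toeplitz_bounded(1)[OF mp[OF e(1)] tf])
      have nb: "l2_norm (s n) \<le> sqrt Z" for n
        using e(3)[of n] N[OF e(1) tf, of n] unfolding s_def by (intro real_le_rsqrt) simp
      obtain r g where r: "strict_mono (r :: nat \<Rightarrow> nat)" and g: "g \<in> l2"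
        and lim: "\<And>k. (\<lambda>n. s (r n) k) \<longlonglongrightarrow> g k"
        using l2_bounded_subseq[where s = s, OF s nb] by metis
      have bound: "eventually (\<lambda>n. s (r n) \<in> l2 \<and> l2_norm (s (r n)) \<le> sqrt Z) sequentially"
        using s nb by simp
      have tbf: "toeplitz ?tb ?tf \<in> l2" by (rule toeplitz_bounded(1)[OF mb tf])
      \<comment> \<open>Two limits of the same sequence \<open>T_a (s (r n))\<close>: weak
        convergence of \<open>s (r n)\<close> gives \<open>T_a g\<close>, and rewriting it as
        \<open>T_v T_b f\<close> gives \<open>T_b f\<close>.\<close>
      have "toeplitz ?tb ?tf m = toeplitz ?ta g m" for m
      proof (rule LIMSEQ_unique)
        show "(\<lambda>n. toeplitz ?ta (s (r n)) m) \<longlonglongrightarrow> toeplitz ?ta g m"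
          by (rule toeplitz_weak_convergence[OF _ lim bound g]) (use ma in \<open>simp add: multiplier_def\<close>)
        have "toeplitz ?ta (s n) = toeplitz (v (e n)) (toeplitz ?tb ?tf)" for n
          unfolding s_def using toeplitz_toeplitz[OF mp[OF e(1)] _ tf, of ?ta n] toeplitz_toeplitz[OF mb _ tf, of "v (e n)"]
            ma mv[OF e(1), of n] pa[OF e(1), of n] by (simp add: multiplier_def)
        moreover have "(\<lambda>n. toeplitz (v (e (r n))) (toeplitz ?tb ?tf) m) \<longlonglongrightarrow> toeplitz ?tb ?tf m"
          by (rule filterlim_compose[OF v_lim[OF tbf] filterlim_compose[OF e_lim filterlim_subseq[OF r]]])
        ultimately show "(\<lambda>n. toeplitz ?ta (s (r n)) m) \<longlonglongrightarrow> toeplitz ?tb ?tf m" by simp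
      qed
      then have "P.companion f g" using hol tf g by (auto simp: P.companion_def)
      then show False using P.companion_space f by (auto simp: Hb_eq)
    qed
  qed
qed

end
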